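(* Let $T>0$. Let $\Phi\colon\mathbb{R}^N\to\mathbb{R}$ be a G-function in $\Gamma(\mathbb{R}^N)$ such that $\Phi$ and $\Phi^\star$ satisfy the $\Delta_2$-condition, and let $V\colon[0,T]\times\mathbb{R}^N\to\mathbb{R}$, $(t,q)\mapsto V(t,q)$, be a Carathéodory function which is continuously differentiable and convex in $q$. Let $G\colon\mathbb{R}^{N}\times\mathbb{R}^N\to[0,\infty)$ be the G-function $G(q,p)=\Phi(q)+\Phi^\star(p)$ and let $C_G=C_G(T)$ be the associated constant. Assume: (1) there exists $l\in \mathbf{L}^{\Phi}([0,T],\mathbb{R}^N)$ such that for all $q\in\mathbb{R}^N$ and a.e. $t\in[0,T]$, $\langle l(t),q\rangle\le V(t,q)$; (2) there exist $\Lambda>0$ with $\Lambda^{-1}>T\max\{1,C_G/2\}$ and $\gamma\in \mathbf{L}^1([0,T],\mathbb{R})$ such that for all $q\in\mathbb{R}^N$ and a.e. $t\in[0,T]$, $V(t,q)\le\Phi(\Lambda^2q)+\gamma(t)$; (3) $\lim_{|x|\to\infty}\int_0^TV(t,x)\,dt=\infty$, $x\in\mathbb{R}^N$. Then the problem $$\frac{d}{dt}\nabla\Phi(\dot q)+\nabla V(t,q)=0\ \text{ for a.e. }t\in[0,T],\qquad q(0)=q(T),\quad \dot q(0)=\dot q(T),$$ has at least one solution.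
   Context: $\nabla V$ is the gradient in $q$. $V$ Carathéodory means $V(\cdot,q)$ is measurable for every $q$ and $V(t,\cdot)$ is continuous for a.e. $t$. A solution is an absolutely continuous $q\colon[0,T]\to\mathbb{R}^N$ such that $\nabla\Phi(\dot q)$ is (a.e. equal to) an absolutely continuous function, the equation holds a.e., and the boundary conditions hold. The convex conjugate of $F$ is $F^\star(v)=\sup_u\{\langle u,v\rangle-F(u)\}$. $\Gamma(\mathbb{R}^m)$ is the set of differentiable, strictly convex $F\colon\mathbb{R}^m\to\mathbb{R}$ with $\lim_{|u|\to\infty}F(u)/|u|=\infty$. A G-function is a convex function $G\colon\mathbb{R}^m\to[0,\infty)$ with $G(u)=0\iff u=0$, $G(-u)=G(u)$, and $\lim_{|u|\to\infty}G(u)/|u|=\infty$. The $\Delta_2$-condition: there is $C>0$ with $G(2u)\le CG(u)+1$ for all $u$. $\mathbf{L}^G([0,T],\mathbb{R}^m)$ is the set of measurable $u\colon[0,T]\to\mathbb{R}^m$ with $\int_0^TG(\lambda u)\,dt<\infty$ for some $\lambda>0$. $\mathbf{W}^1_T\mathbf{L}^G$ is the space of absolutely continuous $u\in\mathbf{L}^G$ with $\dot u\in\mathbf{L}^G$ and $u(0)=u(T)$. With $J=\begin{pmatrix}0&I_N\\-I_N&0\end{pmatrix}$, $$C_G(T)=-\inf\left\{\frac{\int_0^T\langle J\dot u,u\rangle\,dt}{\int_0^TG(T\dot u)\,dt}:\ u\in\mathbf{W}^1_T\mathbf{L}^G([0,T],\mathbb{R}^{2N}),\ u\text{ nonconstant}\right\}.$$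 *)

theory Defs
  imports "HOL-Analysis.Analysis"
begin

subsection \<open>Functions on Euclidean space\<close>

text \<open>Only meaningful where \<open>F\<close> is differentiable.\<close>
definition gradient :: "('a::euclidean_space \<Rightarrow> real) \<Rightarrow> 'a \<Rightarrow> 'a" where
  "gradient F x = (THE D. GDERIV F x :> D)"

definition strictly_convex :: "('a::euclidean_space \<Rightarrow> real) \<Rightarrow> bool" where
  "strictly_convex F \<longleftrightarrow>
     (\<forall>x y s. x \<noteq> y \<and> 0 < s \<and> s < 1 \<longrightarrow>
        F ((1 - s) *\<^sub>R x + s *\<^sub>R y) < (1 - s) * F x + s * F y)"

definition superlinear :: "('a::euclidean_space \<Rightarrow> real) \<Rightarrow> bool" where
  "superlinear F \<longleftrightarrow> filterlim (\<lambda>u. F u / norm u) at_top at_infinity"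

text \<open>A real supremum: the conjugate is only meaningful when the set is bounded above for every
  \<open>v\<close>, as is the case for convex superlinear \<open>F\<close>.\<close>
definition convex_conjugate :: "('a::euclidean_space \<Rightarrow> real) \<Rightarrow> 'a \<Rightarrow> real" where
  "convex_conjugate F v = (SUP u. u \<bullet> v - F u)"

definition Gamma_set :: "('a::euclidean_space \<Rightarrow> real) set" where
  "Gamma_set = {F. (\<forall>x. F differentiable (at x)) \<and> strictly_convex F \<and> superlinear F}"

definition G_function :: "('a::euclidean_space \<Rightarrow> real) \<Rightarrow> bool" where
  "G_function G \<longleftrightarrow>
     convex_on UNIV G \<and> (\<forall>u. 0 \<le> G u) \<and> (\<forall>u. G u = 0 \<longleftrightarrow> u = 0) \<and>
     (\<forall>u. G (- u) = G u) \<and> superlinear G"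

definition Delta2 :: "('a::euclidean_space \<Rightarrow> real) \<Rightarrow> bool" where
  "Delta2 G \<longleftrightarrow> (\<exists>C>0. \<forall>u. G (2 *\<^sub>R u) \<le> C * G u + 1)"

definition continuously_differentiable :: "('a::euclidean_space \<Rightarrow> real) \<Rightarrow> bool" where
  "continuously_differentiable F \<longleftrightarrow>
     (\<forall>x. F differentiable (at x)) \<and> continuous_on UNIV (gradient F)"

subsection \<open>Functions on the interval \<open>[0,T]\<close>\<close>

text \<open>A function on \<open>[0,T]\<close> is a function on \<open>real\<close> whose values outside the interval are
  irrelevant; in particular derivatives are taken within \<open>[0,T]\<close>.\<close>

definition abs_continuous_on :: "real \<Rightarrow> real \<Rightarrow> (real \<Rightarrow> 'a::euclidean_space) \<Rightarrow> bool" where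
  "abs_continuous_on a b f \<longleftrightarrow>
     (\<forall>\<epsilon>>0. \<exists>\<delta>>0. \<forall>(n::nat) x y.
        (\<forall>i<n. a \<le> x i \<and> x i \<le> y i \<and> y i \<le> b) \<and>
        disjoint_family_on (\<lambda>i. {x i<..<y i}) {..<n} \<and>
        (\<Sum>i<n. y i - x i) < \<delta> \<longrightarrow>
        (\<Sum>i<n. norm (f (y i) - f (x i))) < \<epsilon>)"

text \<open>Used below for absolutely continuous \<open>u\<close> only, where the derivative exists almost
  everywhere.\<close>
definition dot :: "real \<Rightarrow> (real \<Rightarrow> 'a::euclidean_space) \<Rightarrow> real \<Rightarrow> 'a" where
  "dot T u t = vector_derivative u (at t within {0..T})"

definition Caratheodory :: "real \<Rightarrow> (real \<Rightarrow> 'a::euclidean_space \<Rightarrow> real) \<Rightarrow> bool" where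
  "Caratheodory T V \<longleftrightarrow>
     (\<forall>q. (\<lambda>t. V t q) \<in> borel_measurable (lebesgue_on {0..T})) \<and>
     (AE t in lebesgue_on {0..T}. continuous_on UNIV (V t))"

definition Orlicz :: "('a::euclidean_space \<Rightarrow> real) \<Rightarrow> real \<Rightarrow> (real \<Rightarrow> 'a) set" where
  "Orlicz G T = {u. u \<in> borel_measurable (lebesgue_on {0..T}) \<and>
     (\<exists>r>0. integrable (lebesgue_on {0..T}) (\<lambda>t. G (r *\<^sub>R u t)))}"

definition Orlicz_Sobolev_per :: "('a::euclidean_space \<Rightarrow> real) \<Rightarrow> real \<Rightarrow> (real \<Rightarrow> 'a) set" where
  "Orlicz_Sobolev_per G T =
     {u. abs_continuous_on 0 T u \<and> u \<in> Orlicz G T \<and> dot T u \<in> Orlicz G T \<and> u 0 = u T}"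

definition symp_J :: "'a::euclidean_space \<times> 'a \<Rightarrow> 'a \<times> 'a" where
  "symp_J = (\<lambda>(q, p). (p, - q))"

text \<open>Extended-real valued because the infimum is \<open>-\<infinity>\<close> for some \<open>G\<close>. If the denominator
  is infinite, the Bochner integral is \<open>0\<close> and so is the quotient.\<close>
definition C_const :: "('a::euclidean_space \<times> 'a \<Rightarrow> real) \<Rightarrow> real \<Rightarrow> ereal" where
  "C_const G T =
     - (INF u \<in> {u \<in> Orlicz_Sobolev_per G T. \<not> u constant_on {0..T}}.
          ereal ((LINT t|lebesgue_on {0..T}. symp_J (dot T u t) \<bullet> u t) /
                 (LINT t|lebesgue_on {0..T}. G (T *\<^sub>R dot T u t))))"

definition split_sum :: "('a::euclidean_space \<Rightarrow> real) \<Rightarrow> 'a \<times> 'a \<Rightarrow> real" where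
  "split_sum \<Phi> = (\<lambda>(q, p). \<Phi> q + convex_conjugate \<Phi> p)"

text \<open>Since the momentum \<open>p\<close> is continuous, \<open>\<nabla>\<Phi>(q')\<close> agrees almost everywhere with a continuous
  function; the boundary values of \<open>q'\<close> are the one-sided derivatives of \<open>q\<close> at \<open>0\<close> and \<open>T\<close>, whose
  existence is part of the requirement.\<close>
definition periodic_solution ::
  "real \<Rightarrow> ('a::euclidean_space \<Rightarrow> real) \<Rightarrow> (real \<Rightarrow> 'a \<Rightarrow> real) \<Rightarrow> (real \<Rightarrow> 'a) \<Rightarrow> bool" where
  "periodic_solution T \<Phi> V q \<longleftrightarrow>
     abs_continuous_on 0 T q \<and>
     (\<exists>p. abs_continuous_on 0 T p \<and>
          (AE t in lebesgue_on {0..T}. gradient \<Phi> (dot T q t) = p t) \<and>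
          (AE t in lebesgue_on {0..T}. dot T p t + gradient (V t) (q t) = 0)) \<and>
     q 0 = q T \<and>
     (\<exists>d. (q has_vector_derivative d) (at 0 within {0..T}) \<and>
          (q has_vector_derivative d) (at T within {0..T}))"

end

theory Submission
  imports Defs "HOL-Complex_Analysis.Great_Picard"
begin

text \<open>The equation is the Hamiltonian system \<open>q' = \<nabla>\<Phi>\<^sup>\<star>(p)\<close>, \<open>p' = - \<nabla>V(t, q)\<close>. Discretise it by the implicit
  midpoint rule with \<open>n\<close> cells, replacing \<open>V\<close> by its cell averages plus \<open>\<epsilon> \<Phi>(\<Lambda>\<^sup>2 q)\<close>. Periodic solutions of
  the discrete system are minimisers of Clarke's dual action, a finite-dimensional problem: for
  piecewise linear \<open>q\<close> and \<open>p\<close> the bilinear term is exactly the symplectic integral bounded by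
  \<open>C_G\<close>, so after the rescaling \<open>(L q, p / L)\<close> with \<open>L\<close> slightly larger than \<open>\<Lambda>\<close> the action is coercive
  modulo constants. Comparing the minimiser with \<open>q = 0\<close>, \<open>p' = - \<nabla>V(t, x)\<close>, where \<open>x\<close> minimises the averaged
  potential, bounds the energies of \<open>q'\<close> and \<open>p'\<close> uniformly in \<open>n\<close>. The mean of \<open>p\<close> is then bounded because
  \<open>p = \<nabla>\<Phi>(q')\<close> holds in a cell with small \<open>q'\<close>, the mean of \<open>q\<close> by convexity and hypothesis (3). Bounded
  solutions are equicontinuous, and Arzela-Ascoli with dominated convergence gives a solution as
  \<open>n\<close> tends to infinity and \<open>\<epsilon>\<close> to \<open>0\<close>.\<close>

subsection \<open>Gradients and convex conjugates\<close>

text \<open>The potential may grow only linearly, so its conjugate may be infinite; this is why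
  \<open>\<epsilon> \<Phi>(\<Lambda>\<^sup>2 q)\<close> is added. The gap
  \<open>\<Lambda> < L\<close> pays for it: as long as
  \<open>(1 + \<epsilon>) * \<Lambda>\<^sup>2 \<le> L\<^sup>2\<close>, all bounds are independent of
  \<open>\<epsilon>\<close>. The two members of the maximum in hypothesis (2) have separate uses.
  The bound \<open>T * L \<le> 1\<close> lets convexity pull the factor \<open>T\<close> in the
  definition of \<open>C_G\<close> out of the energies, and \<open>T * L * C_G / 2 < 1\<close>
  leaves a positive fraction of them once the indefinite bilinear term is absorbed. The midpoint
  rule is chosen because an affine function has its midpoint value as mean over a cell: the discrete
  bilinear form is antisymmetric on slopes of sum zero, and no discretisation error enters the
  inequality for \<open>C_G\<close>. Slopes of sum zero do not see the initial values of
  \<open>q\<close> and \<open>p\<close>; these appear as Lagrange multipliers and need estimates of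
  their own.\<close>

lemma GDERIV_unique:
  fixes F :: "'a::euclidean_space \<Rightarrow> real"
  assumes "GDERIV F x :> D" "GDERIV F x :> D'"
  shows "D = D'"
  using has_derivative_unique[OF assms[unfolded gderiv_def]] vector_eq_ldot by metis

lemma gradient_eqI: "GDERIV F x :> D \<Longrightarrow> gradient F x = D"
  unfolding gradient_def by (blast intro: GDERIV_unique)

lemma differentiable_GDERIV:
  fixes F :: "'a::euclidean_space \<Rightarrow> real"
  assumes "F differentiable (at x)"
  shows "GDERIV F x :> gradient F x"
proof -
  obtain F' where F': "FDERIV F x :> F'"
    using assms unfolding differentiable_def by blast
  have "F' = (\<lambda>h. h \<bullet> adjoint F' 1)"
    using adjoint_works[OF has_derivative_linear[OF F']] by (simp add: fun_eq_iff)
  then have "GDERIV F x :> adjoint F' 1"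
    using F' unfolding gderiv_def by metis
  then show ?thesis
    using gradient_eqI[of F x] by metis
qed

lemma GDERIV_along_line:
  fixes F :: "'a::euclidean_space \<Rightarrow> real"
  assumes "GDERIV F (x + s *\<^sub>R w) :> D"
  shows "((\<lambda>s. F (x + s *\<^sub>R w)) has_real_derivative D \<bullet> w) (at s)"
proof -
  have 1: "((\<lambda>s. x + s *\<^sub>R w) has_derivative (\<lambda>s. s *\<^sub>R w)) (at s)"
    by (auto intro!: derivative_eq_intros)
  have "((\<lambda>s. F (x + s *\<^sub>R w)) has_derivative (\<lambda>h. (h *\<^sub>R w) \<bullet> D)) (at s)"
    using has_derivative_compose[OF 1 assms[unfolded gderiv_def]] .
  then show ?thesis
    unfolding has_field_derivative_def
    by (rule has_derivative_eq_rhs) (auto simp: fun_eq_iff inner_commute)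
qed

lemma GDERIV_imp_isCont:
  fixes F :: "'a::euclidean_space \<Rightarrow> real"
  shows "GDERIV F x :> D \<Longrightarrow> isCont F x"
  unfolding gderiv_def by (rule has_derivative_continuous)

lemma convex_GDERIV_above:
  fixes F :: "'a::euclidean_space \<Rightarrow> real"
  assumes conv: "convex_on UNIV F" and D: "GDERIV F x :> D"
  shows "F x + D \<bullet> (y - x) \<le> F y"
proof -
  let ?f = "\<lambda>s::real. F (x + s *\<^sub>R (y - x))"
  have "(?f has_real_derivative D \<bullet> (y - x)) (at 0)"
    by (rule GDERIV_along_line) (use D in simp)
  then have "((\<lambda>s. (?f s - ?f 0) / (s - 0)) \<longlongrightarrow> D \<bullet> (y - x)) (at 0)"
    unfolding has_field_derivative_iff by simp
  then have lim: "((\<lambda>s. (?f s - ?f 0) / (s - 0)) \<longlongrightarrow> D \<bullet> (y - x)) (at_right 0)"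
    by (rule tendsto_mono[OF at_le, rotated]) simp
  have "\<forall>\<^sub>F s in at_right 0. (?f s - ?f 0) / (s - 0) \<le> F y - F x"
    unfolding eventually_at_right_field
  proof (intro exI[of _ 1] conjI allI impI)
    fix s :: real assume s: "0 < s" "s < 1"
    have "?f s = F ((1 - s) *\<^sub>R x + s *\<^sub>R y)"
      by (simp add: algebra_simps)
    also have "\<dots> \<le> (1 - s) * F x + s * F y"
      using s by (intro convex_onD[OF conv]) auto
    finally have "?f s - F x \<le> s * (F y - F x)"
      by (simp add: algebra_simps)
    then show "(?f s - ?f 0) / (s - 0) \<le> F y - F x"
      using s by (simp add: field_simps)
  qed simp
  from tendsto_upperbound[OF lim this] show ?thesis
    by simp
qed

text \<open>Along the direction \<open>D - v\<close> the difference of \<open>F\<close> and its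
  affine minorant has a minimum at \<open>x\<close>, so its derivative
  \<open>(D - v) \<bullet> (D - v)\<close> vanishes.\<close>

lemma subgradient_unique:
  fixes F :: "'a::euclidean_space \<Rightarrow> real"
  assumes sub: "\<And>y. F x + v \<bullet> (y - x) \<le> F y" and D: "GDERIV F x :> D"
  shows "v = D"
proof -
  let ?w = "D - v"
  have "((\<lambda>s. F (x + s *\<^sub>R ?w)) has_real_derivative D \<bullet> ?w) (at 0)"
    by (rule GDERIV_along_line) (use D in simp)
  then have "((\<lambda>s. F (x + s *\<^sub>R ?w) - s * (v \<bullet> ?w)) has_real_derivative D \<bullet> ?w - v \<bullet> ?w) (at 0)"
    by (auto intro!: derivative_eq_intros)
  moreover have "F (x + 0 *\<^sub>R ?w) - 0 * (v \<bullet> ?w) \<le> F (x + s *\<^sub>R ?w) - s * (v \<bullet> ?w)" for s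
    using sub[of "x + s *\<^sub>R ?w"] by simp
  ultimately have "D \<bullet> ?w - v \<bullet> ?w = 0"
    by (intro DERIV_local_min[where x = 0 and d = 1]) auto
  then have "?w \<bullet> ?w = 0"
    by (simp add: inner_diff_left)
  then show ?thesis by simp
qed

text \<open>Differentiability criterion for functions known through subgradients: the error of the
  linear approximation lies between \<open>0\<close> and
  \<open>(g (x + h) - g x) \<bullet> h\<close>, which continuity of \<open>g\<close> makes small. It
  serves for conjugates and for integrals of the potential alike.\<close>

lemma GDERIV_sandwich:
  fixes F :: "'a::euclidean_space \<Rightarrow> real"
  assumes low: "\<And>w. g x \<bullet> w \<le> F (x + w) - F x"
    and up: "\<And>w. F (x + w) - F x \<le> g (x + w) \<bullet> w"
    and cont: "isCont g x"
  shows "GDERIV F x :> g x"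
  unfolding gderiv_def has_derivative_at
proof
  show "bounded_linear (\<lambda>h. h \<bullet> g x)"
    by (rule bounded_linear_inner_left)
  have "(\<lambda>h. g (x + h)) \<midarrow>0\<rightarrow> g x"
    using cont by (simp add: isCont_iff)
  then have lim: "(\<lambda>h. norm (g (x + h) - g x)) \<midarrow>0\<rightarrow> 0"
    by (metis LIM_zero tendsto_norm_zero)
  show "(\<lambda>h. norm (F (x + h) - F x - h \<bullet> g x) / norm h) \<midarrow>0\<rightarrow> 0"
  proof (rule tendsto_sandwich[OF _ _ tendsto_const lim])
    show "\<forall>\<^sub>F h in at 0. norm (F (x + h) - F x - h \<bullet> g x) / norm h \<le> norm (g (x + h) - g x)"
      unfolding eventually_at
    proof (intro exI[of _ 1] conjI ballI impI)
      fix h :: 'a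
      assume "h \<noteq> 0 \<and> dist h 0 < 1"
      then have h: "norm h > 0" by simp
      have "norm (F (x + h) - F x - h \<bullet> g x) \<le> (g (x + h) - g x) \<bullet> h"
        using low[of h] up[of h] by (simp add: inner_commute inner_diff_right)
      also have "\<dots> \<le> norm (g (x + h) - g x) * norm h"
        by (rule norm_cauchy_schwarz)
      finally show "norm (F (x + h) - F x - h \<bullet> g x) / norm h \<le> norm (g (x + h) - g x)"
        using h by (simp add: field_simps)
    qed simp
  qed simp
qed

text \<open>The gradient inequality is tested one unit away in the direction of \<open>D\<close>.
  Bounds on values thus become bounds on gradients, which later yields integrable majorants.\<close>

lemma convex_gradient_bound:
  fixes F :: "'a::euclidean_space \<Rightarrow> real"
  assumes conv: "convex_on UNIV F" and D: "GDERIV F x :> D"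
    and B: "\<And>w. norm w \<le> norm x + 1 \<Longrightarrow> F w \<le> B"
  shows "norm D \<le> B - F x"
proof (cases "D = 0")
  case True
  then show ?thesis using B[of x] by simp
next
  case False
  let ?w = "D /\<^sub>R norm D"
  have "norm (x + ?w) \<le> norm x + 1"
    using norm_triangle_ineq[of x ?w] False by simp
  then have "F x + D \<bullet> ?w \<le> B"
    using convex_GDERIV_above[OF conv D, of "x + ?w"] B by force
  moreover have "D \<bullet> ?w = norm D"
    using False by (simp add: dot_square_norm power2_eq_square)
  ultimately show ?thesis by simp
qed

lemma strictly_convex_imp_convex:
  assumes "strictly_convex F" shows "convex_on UNIV F"
proof (rule convex_onI)
  fix t :: real and x y :: 'a
  assume "0 < t" "t < 1"
  then show "F ((1 - t) *\<^sub>R x + t *\<^sub>R y) \<le> (1 - t) * F x + t * F y"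
    using assms unfolding strictly_convex_def
    by (cases "x = y") (force simp: algebra_simps, fastforce intro: less_imp_le)
qed simp

lemma continuous_bounded_on_ball:
  fixes f :: "'a::euclidean_space \<Rightarrow> real"
  assumes "continuous_on UNIV f"
  obtains B where "B \<ge> 0" "\<And>u. norm u \<le> M \<Longrightarrow> \<bar>f u\<bar> \<le> B"
proof -
  have "bounded (f ` cball 0 M)"
    by (intro compact_imp_bounded compact_continuous_image continuous_on_subset[OF assms]) auto
  then obtain B where B: "\<forall>y\<in>f ` cball 0 M. norm y \<le> B"
    unfolding bounded_iff ..
  have "\<bar>f u\<bar> \<le> max 0 B" if "norm u \<le> M" for u
  proof -
    have "u \<in> cball 0 M" using that by simp
    with B have "norm (f u) \<le> B" by (intro B[rule_format] imageI)
    then show ?thesis by simp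
  qed
  then show thesis using that[of "max 0 B"] by simp
qed

text \<open>Growth beyond a radius, compactness inside: every slope \<open>M\<close> is reached at
  the cost of an additive constant.\<close>

lemma superlinear_lower_bound:
  fixes F :: "'a::euclidean_space \<Rightarrow> real"
  assumes sl: "superlinear F" and cont: "continuous_on UNIV F"
  obtains K where "K \<ge> 0" "\<And>u. M * norm u \<le> F u + K"
proof -
  have "\<forall>\<^sub>F u in at_infinity. M \<le> F u / norm u"
    using sl unfolding superlinear_def filterlim_at_top by blast
  then obtain R where R: "\<And>u. R \<le> norm u \<Longrightarrow> M \<le> F u / norm u"
    unfolding eventually_at_infinity by blast
  have "continuous_on UNIV (\<lambda>u. M * norm u - F u)"
    by (intro continuous_intros cont)
  then obtain B where "\<And>u. norm u \<le> max 1 R \<Longrightarrow> \<bar>M * norm u - F u\<bar> \<le> B"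
    by (rule continuous_bounded_on_ball[where M = "max 1 R"]) blast
  then have B: "M * norm u - F u \<le> B" if "norm u \<le> max 1 R" for u
    using that by (meson abs_le_D1)
  have "M * norm u \<le> F u + max 0 B" for u
  proof (cases "norm u \<le> max 1 R")
    case True then show ?thesis using B[of u] by simp
  next
    case False
    then have "norm u > 0" "M \<le> F u / norm u" using R[of u] by auto
    then show ?thesis by (simp add: field_simps)
  qed
  then show thesis
    using that[of "max 0 B"] by simp
qed

text \<open>By \<open>GDERIV_conj\<close> below, this is the gradient of the conjugate at \<open>v\<close>.\<close>
definition conj_arg :: "('a::euclidean_space \<Rightarrow> real) \<Rightarrow> 'a \<Rightarrow> 'a" where
  "conj_arg F v = (SOME u. \<forall>w. w \<bullet> v - F w \<le> u \<bullet> v - F u)"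

section \<open>Legendre duality in the class \<open>Gamma_set\<close>\<close>

locale Gamma_fun =
  fixes F :: "'a::euclidean_space \<Rightarrow> real"
  assumes Gamma: "F \<in> Gamma_set"
begin

lemma GDERIV: "GDERIV F x :> gradient F x"
  using Gamma differentiable_GDERIV unfolding Gamma_set_def by blast

lemma convex: "convex_on UNIV F"
  using Gamma strictly_convex_imp_convex unfolding Gamma_set_def by blast

lemma cont: "continuous_on UNIV F"
  by (rule convex_on_continuous[OF open_UNIV convex])

lemma lower_bound:
  obtains K where "K \<ge> 0" "\<And>u. M * norm u \<le> F u + K"
  using superlinear_lower_bound[OF _ cont] Gamma unfolding Gamma_set_def by blast

lemma above: "F x + gradient F x \<bullet> (y - x) \<le> F y"
  by (rule convex_GDERIV_above[OF convex GDERIV])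

lemma conj_arg_exists: "\<exists>u. \<forall>w. w \<bullet> v - F w \<le> u \<bullet> v - F u"
proof -
  obtain K where K: "K \<ge> 0" "\<And>u. (norm v + 1) * norm u \<le> F u + K"
    using lower_bound by blast
  \<comment> \<open>Beyond radius \<open>R\<close> the objective is at most
    \<open>K - norm w\<close>, hence below its value \<open>- F 0\<close> at the origin, so it
    suffices to maximise over a ball.\<close>
  define R where "R = K + \<bar>F 0\<bar>"
  have "\<exists>u\<in>cball 0 R. \<forall>w\<in>cball 0 R. w \<bullet> v - F w \<le> u \<bullet> v - F u"
    using K(1) by (intro continuous_attains_sup continuous_intros continuous_on_subset[OF cont])
      (auto simp: R_def)
  then obtain u where u: "u \<in> cball 0 R" "\<And>w. w \<in> cball 0 R \<Longrightarrow> w \<bullet> v - F w \<le> u \<bullet> v - F u"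
    by blast
  have "w \<bullet> v - F w \<le> u \<bullet> v - F u" for w
  proof (cases "w \<in> cball 0 R")
    case False
    have "w \<bullet> v \<le> norm v * norm w"
      using norm_cauchy_schwarz[of w v] by (simp add: mult.commute)
    then have "w \<bullet> v - F w \<le> - F 0"
      using K(2)[of w] False by (simp add: R_def algebra_simps)
    also have "\<dots> \<le> u \<bullet> v - F u"
      using u(2)[of 0] K(1) by (simp add: R_def)
    finally show ?thesis .
  qed (use u in blast)
  then show ?thesis by blast
qed

lemma conj_arg_max: "w \<bullet> v - F w \<le> conj_arg F v \<bullet> v - F (conj_arg F v)"
  unfolding conj_arg_def using someI_ex[OF conj_arg_exists] by blast

lemma bdd_conj: "bdd_above (range (\<lambda>u. u \<bullet> v - F u))"
  using conj_arg_max by (intro bdd_aboveI2)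

lemma Fenchel: "u \<bullet> v - F u \<le> convex_conjugate F v"
  unfolding convex_conjugate_def by (rule cSUP_upper[OF UNIV_I bdd_conj])

lemma conj_le: "(\<And>u. u \<bullet> v - F u \<le> c) \<Longrightarrow> convex_conjugate F v \<le> c"
  unfolding convex_conjugate_def by (rule cSUP_least) auto

lemma conj_eq: "convex_conjugate F v = conj_arg F v \<bullet> v - F (conj_arg F v)"
  by (meson Fenchel conj_arg_max conj_le order_antisym)

lemma gradient_conj_arg: "gradient F (conj_arg F v) = v"
proof -
  have "v = gradient F (conj_arg F v)"
  proof (rule subgradient_unique[OF _ GDERIV])
    show "F (conj_arg F v) + v \<bullet> (y - conj_arg F v) \<le> F y" for y
      using conj_arg_max[of y v] by (simp add: inner_diff_right inner_commute)
  qed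
  then show ?thesis by simp
qed

text \<open>By strict convexity, the midpoint of two distinct maximisers would have a larger
  value.\<close>

lemma conj_arg_unique:
  assumes u: "\<And>w. w \<bullet> v - F w \<le> u \<bullet> v - F u"
  shows "u = conj_arg F v"
proof (rule ccontr)
  let ?u = "conj_arg F v"
  assume ne: "u \<noteq> ?u"
  have eq: "u \<bullet> v - F u = ?u \<bullet> v - F ?u"
    using u conj_arg_max by (meson order_antisym)
  have "F ((1 - 1/2) *\<^sub>R u + (1/2) *\<^sub>R ?u) < (1 - 1/2) * F u + 1/2 * F ?u"
  proof -
    have "strictly_convex F" using Gamma unfolding Gamma_set_def by simp
    from this[unfolded strictly_convex_def, rule_format, of u ?u "1/2"] ne show ?thesis by simp
  qed
  moreover have "((1 - 1/2) *\<^sub>R u + (1/2) *\<^sub>R ?u) \<bullet> v - F ((1 - 1/2) *\<^sub>R u + (1/2) *\<^sub>R ?u) \<le> u \<bullet> v - F u"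
    by (rule u)
  ultimately show False
    using eq by (simp add: inner_add_left)
qed

lemma conj_arg_gradient: "conj_arg F (gradient F u) = u"
proof (rule conj_arg_unique[symmetric])
  show "w \<bullet> gradient F u - F w \<le> u \<bullet> gradient F u - F u" for w
    using above[of u w] by (simp add: inner_diff_right inner_commute)
qed

lemma conj_gradient: "convex_conjugate F (gradient F u) = u \<bullet> gradient F u - F u"
  by (simp add: conj_eq conj_arg_gradient)

lemma conj_arg_bounded:
  obtains R where "R > 0" "\<And>v. norm v \<le> M \<Longrightarrow> norm (conj_arg F v) \<le> R"
proof -
  obtain K where K: "K \<ge> 0" "\<And>u. (M + 1) * norm u \<le> F u + K"
    using lower_bound by blast
  have "norm (conj_arg F v) \<le> K + \<bar>F 0\<bar> + 1" if v: "norm v \<le> M" for v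
  proof -
    let ?u = "conj_arg F v"
    have "?u \<bullet> v \<le> norm ?u * norm v" by (rule norm_cauchy_schwarz)
    also have "\<dots> \<le> norm ?u * M" using v by (intro mult_left_mono) auto
    finally show ?thesis
      using K(2)[of ?u] conj_arg_max[of 0 v] by (simp add: algebra_simps)
  qed
  then show thesis using that[of "K + \<bar>F 0\<bar> + 1"] K by force
qed

text \<open>A map into a compact set with closed graph is continuous. By uniqueness of the maximiser
  the graph is cut out by the closed conditions
  \<open>w \<bullet> v - F w \<le> u \<bullet> v - F u\<close>; the values are bounded only over
  balls, so the argument runs on each ball separately.\<close>

lemma continuous_conj_arg: "continuous_on UNIV (conj_arg F)"
proof -
  have "continuous_on (cball 0 M) (conj_arg F)" for M
  proof -
    obtain R where R: "\<And>v. norm v \<le> M \<Longrightarrow> norm (conj_arg F v) \<le> R"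
      using conj_arg_bounded by blast
    have "(\<lambda>v. (v, conj_arg F v)) ` cball 0 M
        = cball 0 M \<times> UNIV \<inter> (\<Inter>w. {z. w \<bullet> fst z - F w \<le> snd z \<bullet> fst z - F (snd z)})"
      using conj_arg_max conj_arg_unique by (auto simp: image_iff)
    also have "closed \<dots>"
      by (intro closed_Int closed_Times closed_cball closed_UNIV closed_INT ballI closed_Collect_le
          continuous_intros continuous_on_compose2[OF cont]) auto
    finally have cl: "closed ((\<lambda>v. (v, conj_arg F v)) ` cball 0 M)" .
    show ?thesis
    proof (rule continuous_from_closed_graph[OF compact_cball[of 0 R]])
      show "conj_arg F \<in> cball 0 M \<rightarrow> cball 0 R"
        using R by auto
      show "closed ((\<lambda>v. (v, conj_arg F v)) ` cball 0 M)"
        by (rule cl)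
    qed
  qed
  then have "isCont (conj_arg F) v" for v
    by (rule continuous_on_interior[of "cball 0 (norm v + 1)"]) (simp add: interior_cball)
  then show ?thesis
    by (simp add: continuous_at_imp_continuous_on)
qed

text \<open>Each maximiser is a competitor in the supremum at the other point, which gives the two
  subgradient estimates.\<close>

lemma GDERIV_conj: "GDERIV (convex_conjugate F) v :> conj_arg F v"
proof (rule GDERIV_sandwich)
  show "conj_arg F v \<bullet> w \<le> convex_conjugate F (v + w) - convex_conjugate F v" for w
    using Fenchel[of "conj_arg F v" "v + w"] conj_eq[of v] by (simp add: inner_add_right)
  show "convex_conjugate F (v + w) - convex_conjugate F v \<le> conj_arg F (v + w) \<bullet> w" for w
    using Fenchel[of "conj_arg F (v + w)" v] conj_eq[of "v + w"] by (simp add: inner_add_right)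
  show "isCont (conj_arg F) v"
    using continuous_conj_arg by (simp add: continuous_on_eq_continuous_at)
qed

lemma conj_cont: "continuous_on UNIV (convex_conjugate F)"
  using GDERIV_imp_isCont[OF GDERIV_conj] by (simp add: continuous_at_imp_continuous_on)

lemma gradient_bounded:
  obtains B where "B \<ge> 0" "\<And>x. norm x \<le> M \<Longrightarrow> norm (gradient F x) \<le> B"
proof -
  obtain B where B: "\<And>u. norm u \<le> M + 1 \<Longrightarrow> \<bar>F u\<bar> \<le> B"
    by (rule continuous_bounded_on_ball[OF cont, where M = "M + 1"]) blast
  have "norm (gradient F x) \<le> 2 * \<bar>B\<bar>" if "norm x \<le> M" for x
  proof -
    have "norm (gradient F x) \<le> B - F x"
      using that by (intro convex_gradient_bound[OF convex GDERIV]) (force intro: B[THEN abs_le_D1])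
    then show ?thesis using B[of x] that by simp
  qed
  then show thesis using that[of "2 * \<bar>B\<bar>"] by simp
qed

end

subsection \<open>Discrete Clarke duality\<close>

text \<open>If \<open>q\<close> is piecewise linear on a grid of mesh \<open>h\<close> with slopes \<open>a\<close>, then \<open>q 0 + h midsum a i\<close>
  is its value at the midpoint of the \<open>i\<close>-th cell.\<close>
definition midsum :: "(nat \<Rightarrow> 'a::real_vector) \<Rightarrow> nat \<Rightarrow> 'a" where
  "midsum a i = (\<Sum>j<i. a j) + a i /\<^sub>R 2"

text \<open>Weight one half on the diagonal divides the square of index pairs evenly. For slopes of
  sum zero this is integration by parts for periodic functions, without error term.\<close>

lemma midsum_antisymmetric:
  fixes a b :: "nat \<Rightarrow> 'a::real_inner"
  shows "(\<Sum>i<n. a i \<bullet> midsum b i) + (\<Sum>i<n. midsum a i \<bullet> b i) = (\<Sum>i<n. a i) \<bullet> (\<Sum>i<n. b i)"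
  by (induction n) (simp_all add: midsum_def inner_add_left inner_add_right)

lemma midsum_add_scaleR: "midsum (\<lambda>i. a i + s *\<^sub>R b i) i = midsum a i + s *\<^sub>R midsum b i"
  by (simp add: midsum_def sum.distrib scaleR_sum_right scaleR_add_right ac_simps)

lemma midsum_cong: "(\<And>j. j \<le> i \<Longrightarrow> a j = b j) \<Longrightarrow> midsum a i = midsum b i"
  by (simp add: midsum_def)

lemma norm_midsum_le:
  fixes a :: "nat \<Rightarrow> 'a::real_normed_vector"
  assumes "i < n"
  shows "norm (midsum a i) \<le> (\<Sum>j<n. norm (a j))"
proof -
  have "norm (midsum a i) \<le> (\<Sum>j<i. norm (a j)) + norm (a i)"
    unfolding midsum_def by (intro norm_triangle_mono sum_norm_le) auto
  also have "\<dots> = (\<Sum>j<Suc i. norm (a j))"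
    by simp
  also have "\<dots> \<le> (\<Sum>j<n. norm (a j))"
    using assms by (intro sum_mono2) auto
  finally show ?thesis .
qed

text \<open>Discrete du Bois-Reymond lemma; the test sequence is \<open>G\<close> minus its mean.
  The constants it produces are the Lagrange multipliers of the sum-zero constraints.\<close>

lemma constant_if_orthogonal_to_zero_sums:
  fixes G :: "nat \<Rightarrow> 'a::real_inner"
  assumes orth: "\<And>k. (\<Sum>i<n. k i) = 0 \<Longrightarrow> (\<Sum>i<n. G i \<bullet> k i) = 0"
  obtains c where "\<And>i. i < n \<Longrightarrow> G i = c"
proof (cases "n = 0")
  case True
  then show thesis using that by blast
next
  case False
  define c where "c = (\<Sum>i<n. G i) /\<^sub>R real n"
  define k where "k i = G i - c" for i
  have k0: "(\<Sum>i<n. k i) = 0"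
    using False by (simp add: k_def c_def sum_subtractf sum_constant_scaleR)
  have "k i \<bullet> k i = G i \<bullet> k i - c \<bullet> k i" for i
    by (simp add: k_def inner_diff_left)
  then have "(\<Sum>i<n. k i \<bullet> k i) = (\<Sum>i<n. G i \<bullet> k i) - c \<bullet> (\<Sum>i<n. k i)"
    by (simp only: sum_subtractf inner_sum_right)
  also have "\<dots> = 0"
    using orth[OF k0] k0 by simp
  finally have "\<forall>i\<in>{..<n}. k i \<bullet> k i = 0"
    by (subst (asm) sum_nonneg_eq_0_iff) auto
  then show thesis
    using that[of c] by (simp add: k_def)
qed

text \<open>The finite-dimensional problem on its own. The sequences \<open>a\<close> and
  \<open>b\<close> stand for the slopes of \<open>q\<close> and \<open>p\<close> on \<open>n\<close>
  cells, \<open>\<Psi>\<close> for a common minorant of the reflected conjugate potentials up to the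
  constants \<open>g\<close>, and \<open>\<theta>\<close> for the fraction of the energies that the
  bilinear term can consume.\<close>

locale discrete_dual =
  fixes n :: nat and h \<theta> K :: real
    and \<Phi> :: "'a::euclidean_space \<Rightarrow> real" and U :: "nat \<Rightarrow> 'a \<Rightarrow> real"
    and \<Psi> :: "'a \<Rightarrow> real" and g :: "nat \<Rightarrow> real"
  assumes Phi: "Gamma_fun \<Phi>" and Phi0: "\<Phi> 0 = 0" and Phi_nonneg: "\<And>x. 0 \<le> \<Phi> x"
    and U: "\<And>i. i < n \<Longrightarrow> Gamma_fun (U i)"
    and Psi_nonneg: "\<And>x. 0 \<le> \<Psi> x" and Psi_lower: "\<And>x. norm x \<le> \<Psi> x + K"
    and Psi_le: "\<And>i x. i < n \<Longrightarrow> \<Psi> x \<le> convex_conjugate (U i) (- x) + g i"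
    and theta: "\<theta> < 1"
    and coercive: "\<And>a b. (\<Sum>i<n. a i) = 0 \<Longrightarrow> (\<Sum>i<n. b i) = 0 \<Longrightarrow>
          h * (\<Sum>i<n. a i \<bullet> midsum b i) \<le> \<theta> * (\<Sum>i<n. \<Phi> (a i) + \<Psi> (b i))"
begin

text \<open>Clarke's dual action divided by the mesh. The kinetic part of the Hamiltonian is the
  conjugate of \<open>\<Phi>\<close>, so \<open>\<Phi>\<close> itself appears here. By
  \<open>midsum_antisymmetric\<close> the bilinear terms sum to half of the symplectic pairing when
  the slopes have sum zero.\<close>

definition dual_action :: "(nat \<Rightarrow> 'a) \<Rightarrow> (nat \<Rightarrow> 'a) \<Rightarrow> real" where
  "dual_action a b =
     (\<Sum>i<n. \<Phi> (a i) + convex_conjugate (U i) (- b i) - h * (a i \<bullet> midsum b i))"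

text \<open>The coercivity hypothesis absorbs the bilinear term at the cost of a fraction
  \<open>\<theta>\<close> of the energies.\<close>

lemma dual_action_lower:
  assumes "(\<Sum>i<n. a i) = 0" "(\<Sum>i<n. b i) = 0"
  shows "(1 - \<theta>) * (\<Sum>i<n. \<Phi> (a i) + \<Psi> (b i)) \<le> dual_action a b + (\<Sum>i<n. g i)"
proof -
  have "(\<Sum>i<n. \<Phi> (a i) + \<Psi> (b i)) \<le> (\<Sum>i<n. \<Phi> (a i) + (convex_conjugate (U i) (- b i) + g i))"
    using Psi_le by (intro sum_mono add_left_mono) auto
  then show ?thesis
    using coercive[OF assms]
    by (simp add: dual_action_def sum.distrib sum_subtractf sum_distrib_left algebra_simps)
qed

lemma dual_action_cong:
  assumes "\<And>i. i < n \<Longrightarrow> a i = a' i" "\<And>i. i < n \<Longrightarrow> b i = b' i"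
  shows "dual_action a b = dual_action a' b'"
  unfolding dual_action_def
proof (rule sum.cong[OF refl])
  fix i assume "i \<in> {..<n}"
  then have "midsum b i = midsum b' i"
    using assms(2) by (intro midsum_cong) auto
  then show "\<Phi> (a i) + convex_conjugate (U i) (- b i) - h * (a i \<bullet> midsum b i)
      = \<Phi> (a' i) + convex_conjugate (U i) (- b' i) - h * (a' i \<bullet> midsum b' i)"
    using assms \<open>i \<in> {..<n}\<close> by simp
qed

lemma continuous_dual_action: "continuous_on UNIV (\<lambda>w. dual_action (fst \<circ> w) (snd \<circ> w))"
  unfolding dual_action_def midsum_def comp_def
proof (intro continuous_intros)
  fix i
  show "continuous_on UNIV (\<lambda>x::nat \<Rightarrow> 'a \<times> 'a. \<Phi> (fst (x i)))"
    by (rule continuous_on_compose2[OF Gamma_fun.cont[OF Phi]])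
      (auto intro!: continuous_intros continuous_on_product_coordinates)
  assume "i \<in> {..<n}"
  then show "continuous_on UNIV (\<lambda>x::nat \<Rightarrow> 'a \<times> 'a. convex_conjugate (U i) (- snd (x i)))"
    by (intro continuous_on_compose2[OF Gamma_fun.conj_cont[OF U]])
      (auto intro!: continuous_intros continuous_on_product_coordinates)
qed (auto intro!: continuous_intros continuous_on_product_coordinates)

lemma dual_action_minimizer:
  obtains a b where "(\<Sum>i<n. a i) = 0" "(\<Sum>i<n. b i) = 0"
    "\<And>a' b'. (\<Sum>i<n. a' i) = 0 \<Longrightarrow> (\<Sum>i<n. b' i) = 0 \<Longrightarrow> dual_action a b \<le> dual_action a' b'"
proof -
  obtain K' where K': "\<And>x. 1 * norm x \<le> \<Phi> x + K'"
    using Gamma_fun.lower_bound[OF Phi] by metis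
  \<comment> \<open>Bound on the energy of all slopes whose action is at most that of the zero
    slopes; a minimiser has to be sought among these only.\<close>
  define M where "M = (dual_action (\<lambda>_. 0) (\<lambda>_. 0) + (\<Sum>i<n. g i)) / (1 - \<theta>)"
  define R where "R = \<bar>M + K'\<bar> + \<bar>M + K\<bar>"
  have bound: "norm (a i, b i) \<le> R"
    if "(\<Sum>i<n. a i) = 0" "(\<Sum>i<n. b i) = 0" "dual_action a b \<le> dual_action (\<lambda>_. 0) (\<lambda>_. 0)" "i < n"
    for a b :: "nat \<Rightarrow> 'a" and i
  proof -
    have "\<Phi> (a i) + \<Psi> (b i) \<le> (\<Sum>i<n. \<Phi> (a i) + \<Psi> (b i))"
      using \<open>i < n\<close> Phi_nonneg Psi_nonneg
      by (intro member_le_sum[of i "{..<n}" "\<lambda>i. \<Phi> (a i) + \<Psi> (b i)"]) (auto intro: add_nonneg_nonneg)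
    also have "\<dots> \<le> M"
      using dual_action_lower[OF that(1,2)] that(3) theta by (simp add: M_def field_simps)
    finally have "norm (a i) \<le> M + K'" "norm (b i) \<le> M + K"
      using K'[of "a i"] Psi_lower[of "b i"] Phi_nonneg[of "a i"] Psi_nonneg[of "b i"] by linarith+
    then show ?thesis
      using norm_Pair_le[of "a i" "b i"] by (simp add: R_def)
  qed
  \<comment> \<open>Slopes are functions on all naturals; pinning the coordinates from
    \<open>n\<close> on to \<open>0\<close> makes the search set compact in the product topology.
    Competitors are truncated accordingly, which leaves their action unchanged.\<close>
  define C where "C = (\<Pi>\<^sub>E i\<in>UNIV. if i < n then cball 0 R else {0 :: 'a \<times> 'a})"
  define S where "S = C \<inter> {w. (\<Sum>i<n. w i) = 0}"
  have "compactin (product_topology (\<lambda>i. euclidean) UNIV) C"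
    unfolding C_def compactin_PiE by (auto simp: compactin_euclidean_iff)
  then have "compact C"
    by (simp add: euclidean_product_topology)
  moreover have "closed {w :: nat \<Rightarrow> 'a \<times> 'a. (\<Sum>i<n. w i) = 0}"
    by (intro closed_Collect_eq continuous_intros continuous_on_product_coordinates)
  ultimately have "compact S"
    unfolding S_def by (rule compact_Int_closed)
  moreover have R0: "R \<ge> 0" by (simp add: R_def)
  then have "(\<lambda>_. 0) \<in> S"
    by (auto simp: S_def C_def)
  ultimately obtain w where w: "w \<in> S"
    and min: "\<And>w'. w' \<in> S \<Longrightarrow> dual_action (fst \<circ> w) (snd \<circ> w) \<le> dual_action (fst \<circ> w') (snd \<circ> w')"
    using continuous_attains_inf[of S "\<lambda>w. dual_action (fst \<circ> w) (snd \<circ> w)"]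
      continuous_on_subset[OF continuous_dual_action subset_UNIV] by blast
  have min0: "dual_action (fst \<circ> w) (snd \<circ> w) \<le> dual_action (\<lambda>_. 0) (\<lambda>_. 0)"
    using min[OF \<open>(\<lambda>_. 0) \<in> S\<close>] by (simp add: comp_def)
  have w0: "(\<Sum>i<n. w i) = 0" using w by (simp add: S_def)
  show thesis
  proof
    show "(\<Sum>i<n. (fst \<circ> w) i) = 0" "(\<Sum>i<n. (snd \<circ> w) i) = 0"
      using arg_cong[OF w0, of fst] arg_cong[OF w0, of snd] by (simp_all add: fst_sum snd_sum)
    fix a' b' :: "nat \<Rightarrow> 'a"
    assume z: "(\<Sum>i<n. a' i) = 0" "(\<Sum>i<n. b' i) = 0"
    show "dual_action (fst \<circ> w) (snd \<circ> w) \<le> dual_action a' b'"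
    proof (cases "dual_action a' b' \<le> dual_action (\<lambda>_. 0) (\<lambda>_. 0)")
      case True
      define w' where "w' i = (if i < n then (a' i, b' i) else 0)" for i
      have "w' \<in> S"
        using bound[OF z True] z
        by (auto simp: S_def C_def w'_def sum_prod dist_norm zero_prod_def norm_Pair)
      moreover have "dual_action (fst \<circ> w') (snd \<circ> w') = dual_action a' b'"
        by (rule dual_action_cong) (auto simp: w'_def)
      ultimately show ?thesis
        using min by metis
    qed (use min0 in simp)
  qed
qed

text \<open>Varying \<open>a\<close> and \<open>b\<close> within sequences of sum zero gives the
  discrete Hamiltonian system, with the multipliers \<open>d\<close> and \<open>c\<close> in the
  place of \<open>p(0)\<close> and \<open>q(0)\<close>. The last clause comes from the competitor
  with \<open>a = 0\<close>, where the bilinear term vanishes.\<close>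

theorem critical_point:
  "\<exists>a b c d. (\<Sum>i<n. a i) = 0 \<and> (\<Sum>i<n. b i) = 0 \<and>
    (\<forall>i<n. gradient \<Phi> (a i) = d + h *\<^sub>R midsum b i) \<and>
    (\<forall>i<n. gradient (U i) (c + h *\<^sub>R midsum a i) = - b i) \<and>
    (\<forall>b'. (\<Sum>i<n. b' i) = 0 \<longrightarrow> (1 - \<theta>) * (\<Sum>i<n. \<Phi> (a i) + \<Psi> (b i))
        \<le> (\<Sum>i<n. convex_conjugate (U i) (- b' i)) + (\<Sum>i<n. g i))"
proof -
  obtain a b where z: "(\<Sum>i<n. a i) = 0" "(\<Sum>i<n. b i) = 0"
    and min: "\<And>a' b'. (\<Sum>i<n. a' i) = 0 \<Longrightarrow> (\<Sum>i<n. b' i) = 0 \<Longrightarrow> dual_action a b \<le> dual_action a' b'"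
    using dual_action_minimizer by blast
  obtain d where d: "\<And>i. i < n \<Longrightarrow> gradient \<Phi> (a i) - h *\<^sub>R midsum b i = d"
  proof (rule constant_if_orthogonal_to_zero_sums)
    fix k :: "nat \<Rightarrow> 'a" assume k: "(\<Sum>i<n. k i) = 0"
    let ?f = "\<lambda>s. dual_action (\<lambda>i. a i + s *\<^sub>R k i) b"
    have "(?f has_real_derivative (\<Sum>i<n. gradient \<Phi> (a i) \<bullet> k i - h * (k i \<bullet> midsum b i))) (at 0)"
      unfolding dual_action_def inner_add_left inner_scaleR_left
      by (auto intro!: derivative_eq_intros GDERIV_along_line Gamma_fun.GDERIV[OF Phi]
          simp: mult.commute)
    moreover have "?f 0 \<le> ?f s" for s
      using min[of "\<lambda>i. a i + s *\<^sub>R k i" b] z k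
      by (simp add: sum.distrib flip: scaleR_sum_right)
    ultimately have "(\<Sum>i<n. gradient \<Phi> (a i) \<bullet> k i - h * (k i \<bullet> midsum b i)) = 0"
      by (intro DERIV_local_min[where x = 0 and d = 1]) auto
    then show "(\<Sum>i<n. (gradient \<Phi> (a i) - h *\<^sub>R midsum b i) \<bullet> k i) = 0"
      by (simp add: inner_diff_left inner_commute inner_diff_right)
  qed blast
  obtain c where c: "\<And>i. i < n \<Longrightarrow> conj_arg (U i) (- b i) - h *\<^sub>R midsum a i = c"
  proof (rule constant_if_orthogonal_to_zero_sums)
    fix k :: "nat \<Rightarrow> 'a" assume k: "(\<Sum>i<n. k i) = 0"
    let ?f = "\<lambda>s. dual_action a (\<lambda>i. b i + s *\<^sub>R k i)"
    have eq: "?f = (\<lambda>s. (\<Sum>i<n. \<Phi> (a i) + convex_conjugate (U i) (- b i + s *\<^sub>R (- k i))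
        - h * (a i \<bullet> midsum b i + s * (a i \<bullet> midsum k i))))"
      by (simp add: dual_action_def midsum_add_scaleR inner_add_right)
    have "((\<lambda>s. convex_conjugate (U i) (- b i + s *\<^sub>R (- k i))) has_real_derivative
        conj_arg (U i) (- b i) \<bullet> (- k i)) (at 0)" if "i < n" for i
      using Gamma_fun.GDERIV_conj[OF U[OF that]] by (intro GDERIV_along_line) simp
    then have "(?f has_real_derivative
        (\<Sum>i<n. conj_arg (U i) (- b i) \<bullet> (- k i) - h * (a i \<bullet> midsum k i))) (at 0)"
      unfolding eq
      by (intro DERIV_sum) (auto intro!: derivative_eq_intros simp del: scaleR_minus_right inner_minus_right)
    moreover have "?f 0 \<le> ?f s" for s
      using min[of a "\<lambda>i. b i + s *\<^sub>R k i"] z k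
      by (simp add: sum.distrib flip: scaleR_sum_right)
    ultimately have "(\<Sum>i<n. conj_arg (U i) (- b i) \<bullet> (- k i) - h * (a i \<bullet> midsum k i)) = 0"
      by (intro DERIV_local_min[where x = 0 and d = 1]) auto
    \<comment> \<open>The variation sits inside \<open>midsum\<close>; summation by parts moves the
      midpoint sum onto \<open>a\<close>.\<close>
    moreover have "(\<Sum>i<n. a i \<bullet> midsum k i) = - (\<Sum>i<n. midsum a i \<bullet> k i)"
      using midsum_antisymmetric[where a = a and b = k and n = n] z by simp
    ultimately show "(\<Sum>i<n. (conj_arg (U i) (- b i) - h *\<^sub>R midsum a i) \<bullet> k i) = 0"
      by (simp add: inner_diff_left sum_subtractf sum_negf flip: sum_distrib_left)
  qed blast
  show ?thesis
  proof (intro exI conjI allI impI)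
    fix i assume that: "i < n"
    show "gradient \<Phi> (a i) = d + h *\<^sub>R midsum b i"
      using d[OF that] by (simp add: algebra_simps)
    show "gradient (U i) (c + h *\<^sub>R midsum a i) = - b i"
    proof -
      have "c + h *\<^sub>R midsum a i = conj_arg (U i) (- b i)"
        using c[OF that] by (simp add: algebra_simps)
      then show ?thesis
        using Gamma_fun.gradient_conj_arg[OF U[OF that]] by simp
    qed
  next
    fix b' :: "nat \<Rightarrow> 'a" assume b': "(\<Sum>i<n. b' i) = 0"
    have "dual_action a b \<le> dual_action (\<lambda>_. 0) b'"
      using min b' by simp
    also have "\<dots> = (\<Sum>i<n. convex_conjugate (U i) (- b' i))"
      by (simp add: dual_action_def Phi0)
    finally show "(1 - \<theta>) * (\<Sum>i<n. \<Phi> (a i) + \<Psi> (b i))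
        \<le> (\<Sum>i<n. convex_conjugate (U i) (- b' i)) + (\<Sum>i<n. g i)"
      using dual_action_lower[OF z] by simp
  qed (use z in auto)
qed

end

subsection \<open>Indefinite integrals\<close>

text \<open>Completeness of Lebesgue measure, applied after extension by zero. Derivatives of
  primitives are known only almost everywhere and inherit measurability in this way.\<close>

lemma borel_measurable_lebesgue_on_AE:
  fixes f g :: "'a::euclidean_space \<Rightarrow> 'b::euclidean_space"
  assumes f: "f \<in> borel_measurable (lebesgue_on S)" and ae: "AE x in lebesgue_on S. f x = g x"
    and S: "S \<in> sets lebesgue"
  shows "g \<in> borel_measurable (lebesgue_on S)"
proof -
  have "AE x in lebesgue. x \<in> S \<longrightarrow> f x = g x"
    using ae S by (simp add: AE_restrict_space_iff)
  then have "AE x in lebesgue. (if x \<in> S then f x else 0) = (if x \<in> S then g x else 0)"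
    by (rule eventually_mono) simp
  then have "(\<lambda>x. if x \<in> S then g x else 0) \<in> borel_measurable lebesgue"
    using borel_measurable_AE[OF iffD2[OF borel_measurable_if[OF S] f]] by simp
  then show ?thesis
    by (rule iffD1[OF borel_measurable_if[OF S]])
qed

lemma integral_diff_Icc:
  fixes f :: "real \<Rightarrow> 'a::banach"
  assumes "f integrable_on {0..T}" "0 \<le> s" "s \<le> t" "t \<le> T"
  shows "integral {0..t} f - integral {0..s} f = integral {s..t} f"
proof -
  have "f integrable_on {0..t}"
    by (rule integrable_on_subinterval[OF assms(1)]) (use assms in auto)
  then show ?thesis
    using Henstock_Kurzweil_Integration.integral_combine[of 0 s t f] assms by (simp add: algebra_simps)
qed

text \<open>Truncating \<open>norm (f t)\<close> at a height \<open>k\<close> leaves a remainder of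
  integral below \<open>\<epsilon> / 2\<close>; the truncated part contributes at most
  \<open>k\<close> times the total length of the intervals.\<close>

lemma indefinite_integral_abs_continuous:
  fixes f :: "real \<Rightarrow> 'a::euclidean_space"
  assumes f: "f absolutely_integrable_on {0..T}"
  shows "abs_continuous_on 0 T (\<lambda>t. c + integral {0..t} f)"
  unfolding abs_continuous_on_def
proof (intro allI impI)
  fix \<epsilon> :: real assume "\<epsilon> > 0"
  define m where "m k t = min (norm (f t)) (real k)" for k t
  have nf: "(\<lambda>t. norm (f t)) absolutely_integrable_on {0..T}"
    by (rule absolutely_integrable_norm[OF f, unfolded comp_def])
  have m: "m k integrable_on {0..T}" for k
    unfolding m_def
    by (rule set_lebesgue_integral_eq_integral(1)[OF absolutely_integrable_min_1[OF nf]])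
      (simp add: absolutely_integrable_continuous_real)
  have nf': "(\<lambda>t. norm (f t)) integrable_on {0..T}"
    using f by (simp add: absolutely_integrable_on_def)
  have "(\<lambda>k. integral {0..T} (m k)) \<longlonglongrightarrow> integral {0..T} (\<lambda>t. norm (f t))"
  proof (rule dominated_convergence(2)[OF m nf'])
    fix t
    show "(\<lambda>k. m k t) \<longlonglongrightarrow> norm (f t)"
    proof (rule tendsto_eventually)
      obtain K where "norm (f t) \<le> real K"
        using real_arch_simple by blast
      then show "\<forall>\<^sub>F k in sequentially. m k t = norm (f t)"
        unfolding eventually_sequentially m_def by (intro exI[of _ K]) auto
    qed
  qed (auto simp: m_def)
  then have "\<forall>\<^sub>F k in sequentially. dist (integral {0..T} (m k)) (integral {0..T} (\<lambda>t. norm (f t))) < \<epsilon> / 2"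
    using \<open>\<epsilon> > 0\<close> by (intro tendstoD) auto
  then obtain k where k: "\<bar>integral {0..T} (m k) - integral {0..T} (\<lambda>t. norm (f t))\<bar> < \<epsilon> / 2"
    unfolding eventually_sequentially dist_real_def by blast
  define r where "r t = norm (f t) - m k t" for t
  have r: "r integrable_on {0..T}" and r0: "\<And>t. r t \<ge> 0"
    using integrable_diff[OF nf' m[of k]] by (simp_all add: r_def[abs_def]) (simp add: m_def)
  have "integral {0..T} r = integral {0..T} (\<lambda>t. norm (f t)) - integral {0..T} (m k)"
    using integral_diff[OF nf' m[of k]] by (simp add: r_def[abs_def])
  then have ir: "integral {0..T} r < \<epsilon> / 2"
    using k by linarith
  have sub: "g integrable_on {a..b}" if "g integrable_on {0..T}" "0 \<le> a" "b \<le> T"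
    for g :: "real \<Rightarrow> 'b::euclidean_space" and a b
    by (rule integrable_on_subinterval[OF that(1)]) (use that in auto)
  define \<delta> where "\<delta> = \<epsilon> / (2 * (real k + 1))"
  show "\<exists>\<delta>>0. \<forall>(n::nat) x y.
        (\<forall>i<n. 0 \<le> x i \<and> x i \<le> y i \<and> y i \<le> T) \<and>
        disjoint_family_on (\<lambda>i. {x i<..<y i}) {..<n} \<and>
        (\<Sum>i<n. y i - x i) < \<delta> \<longrightarrow>
        (\<Sum>i<n. norm (c + integral {0..y i} f - (c + integral {0..x i} f))) < \<epsilon>"
  proof (intro exI[of _ \<delta>] conjI allI impI)
    show "\<delta> > 0" using \<open>\<epsilon> > 0\<close> by (simp add: \<delta>_def)
    fix n :: nat and x y :: "nat \<Rightarrow> real"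
    assume H: "(\<forall>i<n. 0 \<le> x i \<and> x i \<le> y i \<and> y i \<le> T) \<and>
        disjoint_family_on (\<lambda>i. {x i<..<y i}) {..<n} \<and> (\<Sum>i<n. y i - x i) < \<delta>"
    have "norm (c + integral {0..y i} f - (c + integral {0..x i} f))
        \<le> integral {x i..y i} r + real k * (y i - x i)" if "i < n" for i
    proof -
      have i: "0 \<le> x i" "x i \<le> y i" "y i \<le> T" using H that by auto
      have fi: "f integrable_on {x i..y i}" and ri: "r integrable_on {x i..y i}"
        using i sub[of f "x i" "y i"] sub[OF r] f by (simp_all add: absolutely_integrable_on_def)
      have "norm (c + integral {0..y i} f - (c + integral {0..x i} f)) = norm (integral {x i..y i} f)"
        using integral_diff_Icc[of f T "x i" "y i"] f i by (simp add: absolutely_integrable_on_def)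
      also have "\<dots> \<le> integral {x i..y i} (\<lambda>t. r t + real k)"
      proof (rule integral_norm_bound_integral)
        show "(\<lambda>t. r t + real k) integrable_on {x i..y i}"
          by (intro integrable_add ri integrable_const_ivl)
      qed (auto simp: fi r_def m_def)
      also have "\<dots> = integral {x i..y i} r + real k * (y i - x i)"
        using i by (subst integral_add) (auto intro: ri)
      finally show ?thesis .
    qed
    then have "(\<Sum>i<n. norm (c + integral {0..y i} f - (c + integral {0..x i} f)))
        \<le> (\<Sum>i<n. integral {x i..y i} r + real k * (y i - x i))"
      by (intro sum_mono) auto
    also have "\<dots> = (\<Sum>i<n. integral {x i..y i} r) + real k * (\<Sum>i<n. y i - x i)"
      by (simp add: sum.distrib sum_distrib_left)
    also have "(\<Sum>i<n. integral {x i..y i} r) \<le> integral {0..T} r"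
    proof (rule has_integral_subset_le[where f = r])
      show "(r has_integral (\<Sum>i<n. integral {x i..y i} r)) (\<Union>i<n. {x i<..<y i})"
      proof (rule has_integral_UN)
        fix i assume "i \<in> {..<n}"
        then have "r integrable_on {x i..y i}" using H by (intro sub[OF r]) auto
        then show "(r has_integral integral {x i..y i} r) {x i<..<y i}"
          by (metis has_integral_Icc_iff_Ioo integrable_integral)
      next
        show "pairwise (\<lambda>i i'. negligible ({x i<..<y i} \<inter> {x i'<..<y i'})) {..<n}"
          using H unfolding pairwise_def disjoint_family_on_def by fastforce
      qed simp
      show "(\<Union>i<n. {x i<..<y i}) \<subseteq> {0..T}"
        using H by force
    qed (use r r0 in auto)
    also have "real k * (\<Sum>i<n. y i - x i) \<le> real k * \<delta>"
      using H by (intro mult_left_mono) auto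
    also have "real k * \<delta> \<le> \<epsilon> / 2"
      using \<open>\<epsilon> > 0\<close> by (simp add: \<delta>_def field_simps)
    finally show "(\<Sum>i<n. norm (c + integral {0..y i} f - (c + integral {0..x i} f))) < \<epsilon>"
      using ir by simp
  qed
qed

text \<open>\<open>integrable_ccontinuous_explicit\<close> only gives right difference quotients; the left ones are
  obtained by reflection.\<close>
lemma indefinite_integral_derivative_AE:
  fixes f :: "real \<Rightarrow> 'a::euclidean_space"
  assumes f: "f integrable_on {0..T}"
  shows "AE t in lebesgue_on {0..T}.
           ((\<lambda>t. c + integral {0..t} f) has_vector_derivative f t) (at t within {0..T})"
proof -
  define F where "F t = (if t \<in> {0..T} then f t else 0)" for t
  have "F integrable_on UNIV"
    using f integrable_restrict_UNIV[of "{0..T}" f] by (simp only: F_def[abs_def])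
  then have Fab: "F integrable_on cbox a b" for a b
    by (rule integrable_on_subcbox) auto
  have Fab': "(\<lambda>t. F (- t)) integrable_on cbox a b" for a b
    using integrable_reflect[of F "- a" "- b"] Fab by simp
  obtain N1 where N1: "negligible N1" and
    right: "\<And>x e. \<lbrakk>x \<notin> N1; 0 < e\<rbrakk> \<Longrightarrow> \<exists>d>0. \<forall>h. 0 < h \<and> h < d \<longrightarrow>
      norm (integral (cbox x (x + h *\<^sub>R One)) F /\<^sub>R h ^ DIM(real) - F x) < e"
    using integrable_ccontinuous_explicit[of F, OF Fab] by blast
  obtain N2 where N2: "negligible N2" and
    left: "\<And>x e. \<lbrakk>x \<notin> N2; 0 < e\<rbrakk> \<Longrightarrow> \<exists>d>0. \<forall>h. 0 < h \<and> h < d \<longrightarrow>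
      norm (integral (cbox x (x + h *\<^sub>R One)) (\<lambda>t. F (- t)) /\<^sub>R h ^ DIM(real) - F (- x)) < e"
    using integrable_ccontinuous_explicit[of "\<lambda>t. F (- t)", OF Fab'] by blast
  have "negligible (uminus ` N2)"
    by (rule negligible_differentiable_image_negligible[OF order_refl N2])
      (auto intro!: derivative_intros simp: differentiable_on_def)
  then have neg: "negligible (N1 \<union> uminus ` N2)"
    by (rule negligible_Un[OF N1])
  have ball: "((\<lambda>t. c + integral {0..t} f) has_vector_derivative f t) (at t within {0..T})"
    if t: "t \<in> {0..T}" "t \<notin> N1 \<union> uminus ` N2" for t
    unfolding has_vector_derivative_def has_derivative_within_alt
  proof (intro conjI allI impI)
    show "bounded_linear (\<lambda>x. x *\<^sub>R f t)"
      by (rule bounded_linear_scaleR_left)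
    fix e :: real assume "e > 0"
    have "- t \<notin> N2" using t by force
    then obtain d2 where d2: "d2 > 0" "\<And>h. 0 < h \<Longrightarrow> h < d2 \<Longrightarrow>
        norm (integral {- t..- t + h} (\<lambda>t. F (- t)) /\<^sub>R h - F t) < e"
      using left[of "- t" e] \<open>e > 0\<close> by auto
    obtain d1 where d1: "d1 > 0" "\<And>h. 0 < h \<Longrightarrow> h < d1 \<Longrightarrow>
        norm (integral {t..t + h} F /\<^sub>R h - F t) < e"
      using right[of t e] t \<open>e > 0\<close> by auto
    have eq: "integral {a..b} F = integral {a..b} f" if "0 \<le> a" "b \<le> T" for a b
      by (rule integral_cong) (use that in \<open>auto simp: F_def\<close>)
    have Ft: "F t = f t" using t by (simp add: F_def)
    show "\<exists>d>0. \<forall>y\<in>{0..T}. norm (y - t) < d \<longrightarrow>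
        norm (c + integral {0..y} f - (c + integral {0..t} f) - (y - t) *\<^sub>R f t) \<le> e * norm (y - t)"
    proof (intro exI[of _ "min d1 d2"] conjI ballI impI)
      fix y assume y: "y \<in> {0..T}" "norm (y - t) < min d1 d2"
      have scale: "norm (I - h *\<^sub>R f t) \<le> e * h" if "norm (I /\<^sub>R h - F t) < e" "h > 0" for I h
      proof -
        have "I - h *\<^sub>R f t = h *\<^sub>R (I /\<^sub>R h - F t)"
          using that Ft by (simp add: algebra_simps)
        then have "norm (I - h *\<^sub>R f t) = h * norm (I /\<^sub>R h - F t)"
          using that by simp
        then show ?thesis using that by (simp add: mult.commute)
      qed
      consider "y = t" | "t < y" | "y < t" by linarith
      then show "norm (c + integral {0..y} f - (c + integral {0..t} f) - (y - t) *\<^sub>R f t) \<le> e * norm (y - t)"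
      proof cases
        case 2
        then have "norm (integral {t..y} f - (y - t) *\<^sub>R f t) \<le> e * (y - t)"
          using d1(2)[of "y - t"] y t eq[of t y] by (intro scale) auto
        then show ?thesis
          using integral_diff_Icc[OF f, of t y] 2 y t by simp
      next
        case 3
        have "integral {- t..- t + (t - y)} (\<lambda>t. F (- t)) = integral {y..t} f"
          using integral_reflect_real[of t y F] eq[of y t] y t by simp
        then have "norm (integral {y..t} f - (t - y) *\<^sub>R f t) \<le> e * (t - y)"
          using d2(2)[of "t - y"] y 3 by (intro scale) auto
        moreover have "norm (c + integral {0..y} f - (c + integral {0..t} f) - (y - t) *\<^sub>R f t)
            = norm (integral {y..t} f - (t - y) *\<^sub>R f t)"
          using integral_diff_Icc[OF f, of y t] 3 y t
          by (subst norm_minus_cancel[symmetric]) (simp add: algebra_simps)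
        ultimately show ?thesis using 3 by simp
      qed simp
    qed (use d1 d2 in auto)
  qed
  have "AE t in lebesgue. t \<notin> N1 \<union> uminus ` N2"
    using neg by (intro AE_not_in) (simp add: negligible_iff_null_sets)
  then have "AE t in lebesgue. t \<in> {0..T} \<longrightarrow>
      ((\<lambda>t. c + integral {0..t} f) has_vector_derivative f t) (at t within {0..T})"
    by (rule eventually_mono) (intro impI ball)
  then show ?thesis
    by (simp add: AE_restrict_space_iff)
qed

text \<open>For \<open>T > 0\<close> no point of the interval is isolated, so the derivative within
  it is unique.\<close>

corollary dot_indefinite_integral_AE:
  fixes f :: "real \<Rightarrow> 'a::euclidean_space"
  assumes "f integrable_on {0..T}" "T > 0"
  shows "AE t in lebesgue_on {0..T}. dot T (\<lambda>t. c + integral {0..t} f) t = f t"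
proof -
  show ?thesis
  proof (rule AE_mp[OF indefinite_integral_derivative_AE[OF assms(1), of c] AE_I2], intro impI)
    fix t
    assume "t \<in> space (lebesgue_on {0..T})"
      and d: "((\<lambda>t. c + integral {0..t} f) has_vector_derivative f t) (at t within {0..T})"
    then have "t \<in> cbox 0 T" by simp
    then show "dot T (\<lambda>t. c + integral {0..t} f) t = f t"
      unfolding dot_def using d by (metis vector_derivative_within_cbox assms(2) box_real(2))
  qed
qed

subsection \<open>Step functions\<close>

definition cell_of :: "real \<Rightarrow> real \<Rightarrow> nat" where
  "cell_of h t = nat \<lfloor>t / h\<rfloor>"

lemma cell_of_eq:
  assumes "h > 0" "t \<in> {h * real i..<h * real (Suc i)}"
  shows "cell_of h t = i"
proof -
  have "\<lfloor>t / h\<rfloor> = int i"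
    using assms by (simp add: floor_eq_iff field_simps)
  then show ?thesis by (simp add: cell_of_def)
qed

lemma cell_of_less:
  assumes "h > 0" "t \<in> {0..<h * real n}"
  shows "cell_of h t < n" "t \<in> {h * real (cell_of h t)..<h * real (Suc (cell_of h t))}"
proof -
  have nn: "\<lfloor>t / h\<rfloor> \<ge> 0" using assms by simp
  have "t / h < real n" using assms by (simp add: field_simps)
  then show "cell_of h t < n" using nn unfolding cell_of_def by linarith
  have "real (cell_of h t) \<le> t / h" "t / h < real (cell_of h t) + 1"
    using nn unfolding cell_of_def by linarith+
  then show "t \<in> {h * real (cell_of h t)..<h * real (Suc (cell_of h t))}"
    using assms(1) by (simp add: field_simps)
qed

lemma has_integral_cell:
  fixes G :: "nat \<Rightarrow> real \<Rightarrow> 'a::banach"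
  assumes "h > 0" "(G i has_integral I) {h * real i..s}" "s \<le> h * real (Suc i)"
  shows "((\<lambda>t. G (cell_of h t) t) has_integral I) {h * real i..s}"
\<comment> \<open>At \<open>h * real (Suc i)\<close> the index is already \<open>Suc i\<close>; a
  single point does not affect the integral.\<close>
proof (rule has_integral_spike_finite[OF _ _ assms(2), of "{h * real (Suc i)}"])
  fix t assume "t \<in> {h * real i..s} - {h * real (Suc i)}"
  then have "t \<in> {h * real i..<h * real (Suc i)}"
    using assms(3) by (simp add: order_less_le)
  then show "G (cell_of h t) t = G i t"
    by (simp only: cell_of_eq[OF assms(1)])
qed simp

lemma has_integral_cells:
  fixes G :: "nat \<Rightarrow> real \<Rightarrow> 'a::banach"
  assumes h: "h > 0"
    and G: "\<And>i. i < n \<Longrightarrow> (G i has_integral I i) {h * real i..h * real (Suc i)}"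
  shows "((\<lambda>t. G (cell_of h t) t) has_integral (\<Sum>i<n. I i)) {0..h * real n}"
  using G
proof (induction n)
  case (Suc n)
  have "((\<lambda>t. G (cell_of h t) t) has_integral (\<Sum>i<n. I i)) {0..h * real n}"
    by (rule Suc.IH) (use Suc.prems in auto)
  moreover have "((\<lambda>t. G (cell_of h t) t) has_integral I n) {h * real n..h * real (Suc n)}"
    by (rule has_integral_cell[OF h Suc.prems]) auto
  ultimately show ?case
    unfolding sum.lessThan_Suc
    using h by (intro has_integral_combine[of 0 "h * real n"]) (auto simp: mult_left_mono)
qed (use has_integral_refl(1)[of "\<lambda>t. G (cell_of h t) t" "0 :: real"] in simp)

lemma has_integral_step:
  fixes v :: "nat \<Rightarrow> 'a::euclidean_space"
  assumes "h > 0"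
  shows "((\<lambda>t. v (cell_of h t)) has_integral h *\<^sub>R (\<Sum>i<n. v i)) {0..h * real n}"
proof -
  have "((\<lambda>t. v i) has_integral h *\<^sub>R v i) {h * real i..h * real (Suc i)}" for i
    using has_integral_const_real[of "v i" "h * real i" "h * real (Suc i)"] assms
    by (simp add: algebra_simps)
  from has_integral_cells[OF assms this] show ?thesis
    by (simp add: scaleR_sum_right)
qed

lemma absolutely_integrable_step:
  fixes v :: "nat \<Rightarrow> 'a::euclidean_space"
  assumes "h > 0"
  shows "(\<lambda>t. v (cell_of h t)) absolutely_integrable_on {0..h * real n}"
  using has_integral_step[OF assms, of v n] has_integral_step[OF assms, of "\<lambda>i. norm (v i)" n]
  unfolding absolutely_integrable_on_def integrable_on_def by blast

lemma integral_step:
  fixes v :: "nat \<Rightarrow> 'a::euclidean_space"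
  assumes "h > 0" "t \<in> {h * real i..h * real (Suc i)}"
  shows "integral {0..t} (\<lambda>t. v (cell_of h t)) = h *\<^sub>R (\<Sum>j<i. v j) + (t - h * real i) *\<^sub>R v i"
proof (rule integral_unique, rule has_integral_combine[of 0 "h * real i" t])
  have "((\<lambda>t. v i) has_integral (t - h * real i) *\<^sub>R v i) {h * real i..t}"
    using has_integral_const_real[of "v i" "h * real i" t] assms by simp
  then show "((\<lambda>t. v (cell_of h t)) has_integral (t - h * real i) *\<^sub>R v i) {h * real i..t}"
    using has_integral_cell[OF assms(1), of "\<lambda>i t. v i" i _ t] assms(2) by simp
qed (use assms has_integral_step[OF assms(1)] in auto)

subsection \<open>The constant of the symplectic inequality on piecewise linear functions\<close>

lemma has_integral_affine:
  fixes c w :: "'a::euclidean_space"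
  assumes "h \<ge> 0"
  shows "((\<lambda>t. c + (t - s) *\<^sub>R w) has_integral h *\<^sub>R c + (h\<^sup>2 / 2) *\<^sub>R w) {s..s + h}"
proof -
  have "((\<lambda>t. c + (t - s) *\<^sub>R w) has_integral
      ((s + h - s) *\<^sub>R c + ((s + h - s)\<^sup>2 / 2) *\<^sub>R w) - ((s - s) *\<^sub>R c + ((s - s)\<^sup>2 / 2) *\<^sub>R w)) {s..s + h}"
    using assms
    by (intro fundamental_theorem_of_calculus[where f = "\<lambda>t. (t - s) *\<^sub>R c + ((t - s)\<^sup>2 / 2) *\<^sub>R w"])
      (auto intro!: derivative_eq_intros simp: has_vector_derivative_def fun_eq_iff algebra_simps diff_divide_distrib)
  then show ?thesis by simp
qed

text \<open>On each cell \<open>u\<close> is affine, so its integral is \<open>h\<close> times its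
  midpoint value \<open>h *\<^sub>R midsum v i\<close>. The symplectic integral of a piecewise
  linear curve is therefore the discrete form exactly.\<close>

lemma symp_J_step:
  fixes v :: "nat \<Rightarrow> 'a::euclidean_space \<times> 'a"
  assumes h: "h > 0"
  defines "u \<equiv> \<lambda>t. integral {0..t} (\<lambda>t. v (cell_of h t))"
  shows "((\<lambda>t. symp_J (v (cell_of h t)) \<bullet> u t) has_integral
           h\<^sup>2 * (\<Sum>i<n. symp_J (v i) \<bullet> midsum v i)) {0..h * real n}"
proof -
  have "((\<lambda>t. symp_J (v i) \<bullet> u t) has_integral h\<^sup>2 * (symp_J (v i) \<bullet> midsum v i))
      {h * real i..h * real (Suc i)}" for i
  proof -
    have "((\<lambda>t. h *\<^sub>R (\<Sum>j<i. v j) + (t - h * real i) *\<^sub>R v i) has_integral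
        h *\<^sub>R (h *\<^sub>R (\<Sum>j<i. v j)) + (h\<^sup>2 / 2) *\<^sub>R v i) {h * real i..h * real i + h}"
      using h by (intro has_integral_affine) simp
    also have "h *\<^sub>R (h *\<^sub>R (\<Sum>j<i. v j)) + (h\<^sup>2 / 2) *\<^sub>R v i = h\<^sup>2 *\<^sub>R midsum v i"
      by (simp add: midsum_def power2_eq_square scaleR_add_right)
    also have "h * real i + h = h * real (Suc i)"
      by (simp add: algebra_simps)
    finally have "(u has_integral h\<^sup>2 *\<^sub>R midsum v i) {h * real i..h * real (Suc i)}"
      using integral_step[OF h] by (subst has_integral_cong[where g = "\<lambda>t. h *\<^sub>R (\<Sum>j<i. v j) + (t - h * real i) *\<^sub>R v i"])
        (simp_all add: u_def)
    from has_integral_linear[OF this bounded_linear_inner_right[of "symp_J (v i)"]]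
    show ?thesis by (simp add: comp_def)
  qed
  from has_integral_cells[OF h this, where n = n] show ?thesis
    by (simp add: sum_distrib_left)
qed

text \<open>The primitive of the step function with values \<open>v\<close> is a competitor in the
  infimum defining \<open>C_const\<close>. Its numerator carries the square of \<open>h\<close> and
  its denominator one factor \<open>h\<close>, which leaves the single \<open>h\<close> on the
  left.\<close>

lemma C_const_step:
  fixes G :: "'a::euclidean_space \<times> 'a \<Rightarrow> real" and v :: "nat \<Rightarrow> 'a \<times> 'a"
  assumes h: "h > 0" and n: "n > 0" and T: "T = h * real n"
    and contG: "continuous_on UNIV G" and G0: "\<And>z. 0 \<le> G z" and Gz: "\<And>z. G z = 0 \<Longrightarrow> z = 0"
    and v0: "(\<Sum>i<n. v i) = 0" and C: "C_const G T \<le> ereal K" and K: "K \<ge> 0"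
  shows "- h * (\<Sum>i<n. symp_J (v i) \<bullet> midsum v i) \<le> K * (\<Sum>i<n. G (T *\<^sub>R v i))"
proof -
  have T0: "T > 0" using h n T by simp
  define w where "w t = v (cell_of h t)" for t
  define u where "u t = integral {0..t} w" for t
  let ?M = "lebesgue_on {0..T}"
  have w: "w absolutely_integrable_on {0..T}"
    unfolding w_def T by (rule absolutely_integrable_step[OF h])
  then have wi: "w integrable_on {0..T}"
    by (simp add: absolutely_integrable_on_def)
  have u_step: "u t = h *\<^sub>R (\<Sum>j<i. v j) + (t - h * real i) *\<^sub>R v i"
    if "t \<in> {h * real i..h * real (Suc i)}" for t i
    using integral_step[OF h that, of v] by (simp add: u_def w_def[abs_def])
  have dot: "AE t in ?M. dot T u t = w t"
    using dot_indefinite_integral_AE[OF wi T0, of 0] by (simp add: u_def[abs_def])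
  have ac: "abs_continuous_on 0 T u"
    using indefinite_integral_abs_continuous[OF w, of 0] by (simp add: u_def[abs_def])
  have contu: "continuous_on {0..T} u"
    unfolding u_def by (rule indefinite_integral_continuous_1[OF wi])
  have w_meas: "w \<in> borel_measurable ?M"
    using wi integrable_imp_measurable by blast
  then have dot_meas: "dot T u \<in> borel_measurable ?M"
    by (rule borel_measurable_lebesgue_on_AE) (rule eventually_mono[OF dot], simp_all)
  have Gw: "integrable ?M (\<lambda>t. G (r *\<^sub>R w t))" for r
    unfolding w_def T
    by (rule absolutely_integrable_imp_integrable[OF absolutely_integrable_step[OF h, where v = "\<lambda>i. G (r *\<^sub>R v i)"]]) simp
  have G_meas: "G \<in> borel_measurable borel"
    by (rule borel_measurable_continuous_onI[OF contG])
  have Gdot_meas: "(\<lambda>t. G (r *\<^sub>R f t)) \<in> borel_measurable ?M" if "f \<in> borel_measurable ?M" for f r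
    by (rule measurable_compose[OF _ G_meas]) (use that in measurable)
  have Gdot: "integrable ?M (\<lambda>t. G (r *\<^sub>R dot T u t))" for r
    by (rule integrable_cong_AE_imp[OF Gw Gdot_meas[OF dot_meas]]) (rule eventually_mono[OF dot], simp)
  have per: "u 0 = u T"
    using u_step[of 0 0] has_integral_step[OF h, of v n] h v0 T
    by (simp add: u_def w_def[abs_def] integral_unique)
  have umeas: "u \<in> borel_measurable ?M"
    using contu by (intro continuous_imp_measurable_on_sets_lebesgue) auto
  have "integrable ?M (\<lambda>t. G (1 *\<^sub>R u t))"
    by (intro absolutely_integrable_imp_integrable absolutely_integrable_continuous_real
        continuous_on_compose2[OF contG] continuous_intros contu) auto
  then have Orlicz: "u \<in> Orlicz_Sobolev_per G T"
    using ac per umeas dot_meas Gdot[of 1]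
    unfolding Orlicz_Sobolev_per_def Orlicz_def mem_Collect_eq by (intro conjI exI[of _ 1]) auto
  show ?thesis
  \<comment> \<open>Constant curves are excluded from the infimum, but for them all slopes
    vanish.\<close>
  proof (cases "u constant_on {0..T}")
    case True
    then obtain y where y: "\<And>t. t \<in> {0..T} \<Longrightarrow> u t = y"
      unfolding constant_on_def by blast
    have "v i = 0" if "i < n" for i
    proof -
      have "h * real i \<in> {0..T}" "h * real (Suc i) \<in> {0..T}"
        using that h by (simp_all add: T)
      then have "u (h * real (Suc i)) - u (h * real i) = 0"
        using y by simp
      moreover have "u (h * real (Suc i)) - u (h * real i) = h *\<^sub>R v i"
        using u_step[of "h * real i" i] u_step[of "h * real (Suc i)" i] h
        by (simp add: algebra_simps)
      ultimately show ?thesis using h by simp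
    qed
    moreover have "symp_J (0 :: 'a \<times> 'a) = 0"
      by (simp add: symp_J_def zero_prod_def)
    ultimately show ?thesis
      using K G0 by simp
  next
    case False
    have B: "(LINT t|?M. G (T *\<^sub>R dot T u t)) = h * (\<Sum>i<n. G (T *\<^sub>R v i))"
    proof -
      have "(LINT t|?M. G (T *\<^sub>R dot T u t)) = (LINT t|?M. G (T *\<^sub>R w t))"
        by (rule integral_cong_AE[OF Gdot_meas[OF dot_meas] Gdot_meas[OF w_meas]])
          (rule eventually_mono[OF dot], simp)
      also have "\<dots> = integral {0..T} (\<lambda>t. G (T *\<^sub>R w t))"
        by (rule lebesgue_integral_eq_integral[OF Gw]) simp
      also have "\<dots> = h * (\<Sum>i<n. G (T *\<^sub>R v i))"
        using has_integral_step[OF h, of "\<lambda>i. G (T *\<^sub>R v i)" n]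
        by (simp add: w_def T integral_unique)
      finally show ?thesis .
    qed
    have J: "(\<lambda>t. symp_J (f t)) \<in> borel_measurable ?M"
      if "f \<in> borel_measurable ?M" for f :: "real \<Rightarrow> 'a \<times> 'a"
    proof (rule measurable_compose[OF that])
      show "(symp_J :: 'a \<times> 'a \<Rightarrow> _) \<in> borel_measurable borel"
        unfolding symp_J_def split_beta
        by (intro borel_measurable_continuous_onI continuous_intros)
    qed
    have Ju: "(\<lambda>t. symp_J (f t) \<bullet> u t) \<in> borel_measurable ?M" if "f \<in> borel_measurable ?M" for f
      by (intro borel_measurable_inner J that umeas)
    have A: "(LINT t|?M. symp_J (dot T u t) \<bullet> u t) = h\<^sup>2 * (\<Sum>i<n. symp_J (v i) \<bullet> midsum v i)"
    proof -
      have "(LINT t|?M. symp_J (dot T u t) \<bullet> u t) = (LINT t|?M. symp_J (w t) \<bullet> u t)"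
        by (rule integral_cong_AE[OF Ju[OF dot_meas] Ju[OF w_meas]]) (rule eventually_mono[OF dot], simp)
      also have "\<dots> = integral {0..T} (\<lambda>t. symp_J (w t) \<bullet> u t)"
      proof (rule lebesgue_integral_eq_integral)
        have "bounded (u ` {0..T})"
          by (intro compact_imp_bounded compact_continuous_image contu) simp
        then obtain B where B: "\<And>t. t \<in> {0..T} \<Longrightarrow> norm (u t) \<le> B"
          unfolding bounded_iff by blast
        have "integrable ?M (\<lambda>t. norm (w t) * B)"
          using absolutely_integrable_imp_integrable[OF w] by simp
        then show "integrable ?M (\<lambda>t. symp_J (w t) \<bullet> u t)"
        proof (rule measurable_bounded_by_integrable_imp_lebesgue_integrable[rotated])
          fix t assume "t \<in> {0..T}"
          have "norm (symp_J (w t) \<bullet> u t) \<le> norm (symp_J (w t)) * norm (u t)"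
            by (rule Cauchy_Schwarz_ineq2[folded real_norm_def])
          also have "norm (symp_J (w t)) = norm (w t)"
            by (simp add: symp_J_def norm_prod_def split_beta add.commute)
          finally show "norm (symp_J (w t) \<bullet> u t) \<le> norm (w t) * B"
            using B[OF \<open>t \<in> {0..T}\<close>] by (meson mult_left_mono norm_ge_zero order_trans)
        qed (simp_all add: Ju[OF w_meas])
      qed simp
      also have "\<dots> = h\<^sup>2 * (\<Sum>i<n. symp_J (v i) \<bullet> midsum v i)"
        using symp_J_step[OF h, of v n] by (simp add: w_def[abs_def] u_def[abs_def] T integral_unique)
      finally show ?thesis .
    qed
    let ?A = "h\<^sup>2 * (\<Sum>i<n. symp_J (v i) \<bullet> midsum v i)" and ?B = "h * (\<Sum>i<n. G (T *\<^sub>R v i))"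
    have "(INF u\<in>{u \<in> Orlicz_Sobolev_per G T. \<not> u constant_on {0..T}}.
        ereal ((LINT t|?M. symp_J (dot T u t) \<bullet> u t) / (LINT t|?M. G (T *\<^sub>R dot T u t))))
      \<le> ereal (?A / ?B)"
      using Orlicz False by (intro INF_lower2[of u]) (auto simp: A B)
    moreover have "ereal (- K) \<le> (INF u\<in>{u \<in> Orlicz_Sobolev_per G T. \<not> u constant_on {0..T}}.
        ereal ((LINT t|?M. symp_J (dot T u t) \<bullet> u t) / (LINT t|?M. G (T *\<^sub>R dot T u t))))"
      using C unfolding C_const_def by (subst (asm) ereal_uminus_le_reorder) simp
    ultimately have le: "- K \<le> ?A / ?B"
      by (meson ereal_less_eq(3) order_trans)
    \<comment> \<open>A nonzero slope makes the denominator positive, so the bound on the quotient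
      can be multiplied out.\<close>
    have "\<exists>i<n. v i \<noteq> 0"
    proof (rule ccontr)
      assume "\<not> ?thesis"
      then have "\<And>i. i < n \<Longrightarrow> v i = 0" by blast
      then have zero: "(\<Sum>j<i. v j) = 0" if "i \<le> n" for i
        using that by (intro sum.neutral) auto
      have "u t = 0" if "t \<in> {0..T}" for t
      proof (cases "t = T")
        case True
        then show ?thesis using per by (simp add: u_def)
      next
        case False
        then have "t \<in> {0..<h * real n}" using that T by simp
        note cell = cell_of_less[OF h this]
        have "u t = h *\<^sub>R (\<Sum>j<cell_of h t. v j) + (t - h * real (cell_of h t)) *\<^sub>R v (cell_of h t)"
          using cell by (intro u_step) auto
        then show ?thesis
          using zero[of "cell_of h t"] cell \<open>\<And>i. i < n \<Longrightarrow> v i = 0\<close> by simp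
      qed
      then show False
        using False unfolding constant_on_def by blast
    qed
    then obtain i where i: "i < n" "v i \<noteq> 0" by blast
    have "(\<Sum>i<n. G (T *\<^sub>R v i)) > 0"
    proof (rule sum_pos2[of _ i])
      have "T *\<^sub>R v i \<noteq> 0" using i T0 by simp
      then show "0 < G (T *\<^sub>R v i)"
        using G0 Gz by (metis order_le_less)
    qed (use i G0 in auto)
    then have "?B > 0" using h by simp
    then have "- K * ?B \<le> ?A"
      using le by (simp add: pos_le_divide_eq)
    then have "h * (- h * (\<Sum>i<n. symp_J (v i) \<bullet> midsum v i)) \<le> h * (K * (\<Sum>i<n. G (T *\<^sub>R v i)))"
      by (simp add: power2_eq_square algebra_simps)
    then show ?thesis
      using h by (simp only: mult_le_cancel_left_pos)
  qed
qed

subsection \<open>Kinetic energies\<close>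

locale kinetic = Gamma_fun \<Phi> for \<Phi> :: "'a::euclidean_space \<Rightarrow> real" +
  assumes G_fun: "G_function \<Phi>"
begin

lemma nonneg: "0 \<le> \<Phi> x" and zero_iff: "\<Phi> x = 0 \<longleftrightarrow> x = 0" and even: "\<Phi> (- x) = \<Phi> x"
  using G_fun unfolding G_function_def by blast+

lemma zero [simp]: "\<Phi> 0 = 0"
  by (simp add: zero_iff)

lemma scale_le:
  assumes "0 \<le> s" "s \<le> 1"
  shows "\<Phi> (s *\<^sub>R x) \<le> s * \<Phi> x"
  using convex_onD[OF convex, of s 0 x] assms zero by simp

lemma conj_nonneg: "0 \<le> convex_conjugate \<Phi> x"
  using Fenchel[of 0 x] zero by simp

lemma conj_scale_le:
  assumes "0 \<le> s" "s \<le> 1"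
  shows "convex_conjugate \<Phi> (s *\<^sub>R x) \<le> s * convex_conjugate \<Phi> x"
proof (rule conj_le)
  fix u
  have "s * (u \<bullet> x - \<Phi> u) \<le> s * convex_conjugate \<Phi> x"
    by (intro mult_left_mono Fenchel assms)
  moreover have "s * \<Phi> u \<le> \<Phi> u"
    using mult_right_mono[OF assms(2) nonneg[of u]] by simp
  ultimately show "u \<bullet> s *\<^sub>R x - \<Phi> u \<le> s * convex_conjugate \<Phi> x"
    by (simp add: algebra_simps)
qed

text \<open>A zero of the conjugate is a subgradient of \<open>\<Phi>\<close> at its minimum, and so is \<open>0\<close>.\<close>
lemma conj_zero:
  assumes "convex_conjugate \<Phi> x = 0"
  shows "x = 0"
proof -
  have "x = gradient \<Phi> 0"
    using Fenchel[of u x for u] assms zero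
    by (intro subgradient_unique[OF _ GDERIV]) (simp add: inner_commute[of x])
  moreover have "0 = gradient \<Phi> 0"
    using nonneg zero by (intro subgradient_unique[OF _ GDERIV]) simp
  ultimately show ?thesis by simp
qed

text \<open>The Fenchel inequality is tested with the vector of length \<open>M\<close> in the
  direction of \<open>x\<close>; \<open>\<Phi>\<close> is bounded on the ball of radius
  \<open>M\<close>.\<close>

lemma conj_lower_bound:
  assumes "M \<ge> 0"
  obtains K where "\<And>x. M * norm x \<le> convex_conjugate \<Phi> x + K"
proof -
  obtain K where K: "K \<ge> 0" "\<And>u. norm u \<le> M \<Longrightarrow> \<bar>\<Phi> u\<bar> \<le> K"
    by (rule continuous_bounded_on_ball[OF cont, where M = M]) blast
  have "M * norm x \<le> convex_conjugate \<Phi> x + K" for x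
  proof -
    let ?u = "M *\<^sub>R (x /\<^sub>R norm x)"
    have "?u \<bullet> x - \<Phi> ?u \<le> convex_conjugate \<Phi> x"
      by (rule Fenchel)
    moreover have "?u \<bullet> x = M * norm x"
      by (cases "x = 0") (simp_all add: dot_square_norm power2_eq_square)
    moreover have "\<bar>\<Phi> ?u\<bar> \<le> K"
      using assms by (intro K(2), cases "x = 0") (simp_all add: field_simps)
    ultimately show ?thesis by linarith
  qed
  then show thesis using that by blast
qed

text \<open>The symplectic form is invariant under \<open>(q, p) \<mapsto> (L q, p / L)\<close>.\<close>
lemma symplectic_step_bound:
  fixes a b :: "nat \<Rightarrow> 'a"
  assumes h: "h > 0" and n: "n > 0" and T: "T = h * real n"
    and a0: "(\<Sum>i<n. a i) = 0" and b0: "(\<Sum>i<n. b i) = 0"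
    and C: "C_const (split_sum \<Phi>) T \<le> ereal K" and K: "K \<ge> 0"
    and L: "L > 0" "T * L \<le> 1"
  shows "h * (\<Sum>i<n. a i \<bullet> midsum b i)
    \<le> (T * L * K / 2) * (\<Sum>i<n. \<Phi> (a i) + convex_conjugate \<Phi> (b i /\<^sub>R L\<^sup>2))"
proof -
  define v where "v i = (L *\<^sub>R a i, b i /\<^sub>R L)" for i
  have T0: "T \<ge> 0" using h T by simp
  have mid: "midsum v i = (L *\<^sub>R midsum a i, midsum b i /\<^sub>R L)" for i
    by (simp add: midsum_def v_def sum_prod scaleR_sum_right scaleR_add_right)
  have "symp_J (v i) \<bullet> midsum v i = midsum a i \<bullet> b i - a i \<bullet> midsum b i" for i
    using L(1) by (simp add: mid v_def symp_J_def inner_commute[of "b i"] flip: mult.assoc)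
  moreover have "(\<Sum>i<n. midsum a i \<bullet> b i) = - (\<Sum>i<n. a i \<bullet> midsum b i)"
    using midsum_antisymmetric[where a = a and b = b and n = n] a0 by simp
  ultimately have J: "(\<Sum>i<n. symp_J (v i) \<bullet> midsum v i) = - 2 * (\<Sum>i<n. a i \<bullet> midsum b i)"
    by (simp add: sum_subtractf)
  have "- h * (\<Sum>i<n. symp_J (v i) \<bullet> midsum v i) \<le> K * (\<Sum>i<n. split_sum \<Phi> (T *\<^sub>R v i))"
  proof (rule C_const_step[OF h n T _ _ _ _ C K])
    show "continuous_on UNIV (split_sum \<Phi>)"
      unfolding split_sum_def split_beta
      by (intro continuous_intros continuous_on_compose2[OF cont] continuous_on_compose2[OF conj_cont]) auto
    show "0 \<le> split_sum \<Phi> z" for z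
      using nonneg conj_nonneg by (simp add: split_sum_def split_beta)
    show "z = 0" if "split_sum \<Phi> z = 0" for z
    proof -
      have "\<Phi> (fst z) + convex_conjugate \<Phi> (snd z) = 0"
        using that by (simp add: split_sum_def split_beta)
      then have "\<Phi> (fst z) = 0" "convex_conjugate \<Phi> (snd z) = 0"
        using nonneg[of "fst z"] conj_nonneg[of "snd z"] by linarith+
      then show ?thesis
        using zero_iff conj_zero by (simp add: prod_eq_iff)
    qed
    show "(\<Sum>i<n. v i) = 0"
      using a0 b0 by (simp add: v_def sum_prod zero_prod_def flip: scaleR_sum_right)
  qed
  \<comment> \<open>The factor \<open>T\<close> of \<open>C_const\<close> is absorbed here:
    \<open>T / L = (T * L) / L\<^sup>2\<close>, and \<open>T * L \<le> 1\<close> comes out of both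
    energies by convexity. Together with the factor \<open>2\<close> in \<open>J\<close> this
    produces \<open>T * L * K / 2\<close>.\<close>
  also have "(\<Sum>i<n. split_sum \<Phi> (T *\<^sub>R v i))
      \<le> (\<Sum>i<n. T * L * (\<Phi> (a i) + convex_conjugate \<Phi> (b i /\<^sub>R L\<^sup>2)))"
  proof (rule sum_mono)
    fix i
    have "\<Phi> ((T * L) *\<^sub>R a i) \<le> T * L * \<Phi> (a i)"
      using L T0 by (intro scale_le) auto
    moreover have "convex_conjugate \<Phi> (T *\<^sub>R (b i /\<^sub>R L)) \<le> T * L * convex_conjugate \<Phi> (b i /\<^sub>R L\<^sup>2)"
    proof -
      have "T *\<^sub>R (b i /\<^sub>R L) = (T * L) *\<^sub>R (b i /\<^sub>R L\<^sup>2)"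
        using L(1) by (simp add: power2_eq_square)
      then show ?thesis
        using conj_scale_le[of "T * L" "b i /\<^sub>R L\<^sup>2"] L T0 by (metis mult_nonneg_nonneg order_less_imp_le)
    qed
    ultimately show "split_sum \<Phi> (T *\<^sub>R v i) \<le> T * L * (\<Phi> (a i) + convex_conjugate \<Phi> (b i /\<^sub>R L\<^sup>2))"
      by (simp add: split_sum_def v_def distrib_left)
  qed
  finally have "- h * (- 2 * (\<Sum>i<n. a i \<bullet> midsum b i))
      \<le> K * (\<Sum>i<n. T * L * (\<Phi> (a i) + convex_conjugate \<Phi> (b i /\<^sub>R L\<^sup>2)))"
    using K unfolding J by (simp add: mult_left_mono)
  then show ?thesis
    by (simp add: ac_simps flip: sum_distrib_left)
qed

end

subsection \<open>Averaged potentials\<close>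

lemma superlinearI:
  fixes F :: "'a::euclidean_space \<Rightarrow> real"
  assumes "\<And>M. \<exists>K. \<forall>x. M * norm x - K \<le> F x"
  shows "superlinear F"
  unfolding superlinear_def filterlim_at_top
proof
  fix Z :: real
  obtain K where K: "\<And>x. (Z + 1) * norm x - K \<le> F x"
    using assms[of "Z + 1"] by blast
  show "\<forall>\<^sub>F x in at_infinity. Z \<le> F x / norm x"
    unfolding eventually_at_infinity
  proof (intro exI[of _ "max 1 K"] allI impI)
    fix x :: 'a assume "max 1 K \<le> norm x"
    then have x: "norm x > 0" "K \<le> norm x" by auto
    have "Z * norm x \<le> F x"
      using K[of x] x by (simp add: algebra_simps)
    then show "Z \<le> F x / norm x"
      using x by (simp add: field_simps)
  qed
qed

text \<open>All conditions are imposed at every time, and \<open>l\<close> and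
  \<open>\<gamma>\<close> are taken absolutely integrable; the exceptional null sets are removed
  once, in the proof of the final theorem.\<close>

locale potential = kinetic \<Phi> for \<Phi> :: "'a::euclidean_space \<Rightarrow> real" +
  fixes T \<Lambda> :: real and V :: "real \<Rightarrow> 'a \<Rightarrow> real" and l :: "real \<Rightarrow> 'a" and \<gamma> :: "real \<Rightarrow> real"
  assumes T: "T > 0" and Lambda: "\<Lambda> > 0"
    and V_meas: "\<And>q. (\<lambda>t. V t q) \<in> borel_measurable (lebesgue_on {0..T})"
    and V_diff: "\<And>t q. V t differentiable (at q)"
    and V_grad_cont: "\<And>t. continuous_on UNIV (gradient (V t))"
    and V_convex: "\<And>t. convex_on UNIV (V t)"
    and V_lower: "\<And>t q. l t \<bullet> q \<le> V t q"
    and V_upper: "\<And>t q. V t q \<le> \<Phi> (\<Lambda>\<^sup>2 *\<^sub>R q) + \<gamma> t"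
    and l_int: "l absolutely_integrable_on {0..T}"
    and gamma_int: "\<gamma> absolutely_integrable_on {0..T}"
begin

lemma V_GDERIV: "GDERIV (V t) q :> gradient (V t) q"
  by (rule differentiable_GDERIV[OF V_diff])

lemma V_above: "V t x + gradient (V t) x \<bullet> (y - x) \<le> V t y"
  by (rule convex_GDERIV_above[OF V_convex V_GDERIV])

text \<open>Each component is a pointwise limit of measurable difference quotients with increments
  \<open>1 / real (Suc n)\<close>.\<close>

lemma grad_meas: "(\<lambda>t. gradient (V t) q) \<in> borel_measurable (lebesgue_on {0..T})"
proof (rule iffD2[OF borel_measurable_euclidean_space], rule ballI)
  fix b :: 'a
  show "(\<lambda>t. gradient (V t) q \<bullet> b) \<in> borel_measurable (lebesgue_on {0..T})"
  proof (rule borel_measurable_LIMSEQ_real)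
    fix t
    have "((\<lambda>s. V t (q + s *\<^sub>R b)) has_real_derivative gradient (V t) q \<bullet> b) (at 0)"
      by (rule GDERIV_along_line) (use V_GDERIV in simp)
    then have "(\<lambda>s. (V t (q + s *\<^sub>R b) - V t q) / s) \<midarrow>0\<rightarrow> gradient (V t) q \<bullet> b"
      by (simp add: DERIV_def)
    moreover have "filterlim (\<lambda>n. 1 / real (Suc n)) (at 0) sequentially"
      using LIMSEQ_inverse_real_of_nat
      by (auto simp: filterlim_at inverse_eq_divide)
    ultimately show "(\<lambda>n. (V t (q + (1 / real (Suc n)) *\<^sub>R b) - V t q) / (1 / real (Suc n)))
        \<longlonglongrightarrow> gradient (V t) q \<bullet> b"
      by (rule filterlim_compose)
  qed (use V_meas in measurable)
qed

lemma V_integrable: "(\<lambda>t. V t q) absolutely_integrable_on {0..T}"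
proof (rule absolutely_integrable_integrable_bound)
  let ?g = "\<lambda>t. norm (l t) * norm q + \<Phi> (\<Lambda>\<^sup>2 *\<^sub>R q) + \<bar>\<gamma> t\<bar>"
  show "norm (V t q) \<le> ?g t" for t
  proof -
    have "V t q \<le> ?g t"
      using V_upper[of t q] mult_nonneg_nonneg[OF norm_ge_zero norm_ge_zero, of "l t" q] by linarith
    moreover have "- V t q \<le> ?g t"
      using V_lower[of t q] nonneg[of "\<Lambda>\<^sup>2 *\<^sub>R q"] Cauchy_Schwarz_ineq2[of "l t" q] by linarith
    ultimately show ?thesis by simp
  qed
  show g: "?g integrable_on {0..T}"
    using l_int gamma_int unfolding absolutely_integrable_on_def
    by (intro integrable_add integrable_on_mult_left) auto
  show "(\<lambda>t. V t q) integrable_on {0..T}"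
    by (rule measurable_bounded_by_integrable_imp_integrable[OF V_meas g \<open>\<And>t. norm (V t q) \<le> ?g t\<close>]) simp
qed

text \<open>By convexity, gradients on a ball are controlled by the upper bound of \<open>V\<close>
  on the ball of radius one larger and its lower bound on the ball itself. One integrable majorant
  serves all positions in the ball, as dominated convergence along moving positions
  requires.\<close>

lemma grad_dominated:
  obtains m where "m integrable_on {0..T}" "\<And>t. 0 \<le> m t"
    "\<And>t x. norm x \<le> R \<Longrightarrow> norm (gradient (V t) x) \<le> m t"
proof -
  obtain B where B: "B \<ge> 0" "\<And>u. norm u \<le> \<Lambda>\<^sup>2 * (R + 1) \<Longrightarrow> \<bar>\<Phi> u\<bar> \<le> B"
    by (rule continuous_bounded_on_ball[OF cont, where M = "\<Lambda>\<^sup>2 * (R + 1)"]) blast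
  show thesis
  proof
    show "(\<lambda>t. B + \<bar>\<gamma> t\<bar> + norm (l t) * \<bar>R\<bar>) integrable_on {0..T}"
      using l_int gamma_int unfolding absolutely_integrable_on_def
      by (intro integrable_add integrable_on_mult_left) auto
    show "0 \<le> B + \<bar>\<gamma> t\<bar> + norm (l t) * \<bar>R\<bar>" for t
      using B by simp
    fix t and x :: 'a assume x: "norm x \<le> R"
    have "norm (gradient (V t) x) \<le> (B + \<gamma> t) - V t x"
    proof (rule convex_gradient_bound[OF V_convex V_GDERIV])
      fix w :: 'a assume "norm w \<le> norm x + 1"
      then have "norm (\<Lambda>\<^sup>2 *\<^sub>R w) \<le> \<Lambda>\<^sup>2 * (R + 1)"
        using x by (simp add: mult_left_mono)
      then show "V t w \<le> B + \<gamma> t"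
        using B(2) V_upper[of t w] by fastforce
    qed
    moreover have "- V t x \<le> norm (l t) * \<bar>R\<bar>"
    proof -
      have "- V t x \<le> norm (l t) * norm x"
        using V_lower[of t x] Cauchy_Schwarz_ineq2[of "l t" x] by linarith
      also have "\<dots> \<le> norm (l t) * \<bar>R\<bar>"
        using x by (intro mult_left_mono) auto
      finally show ?thesis .
    qed
    ultimately show "norm (gradient (V t) x) \<le> B + \<bar>\<gamma> t\<bar> + norm (l t) * \<bar>R\<bar>"
      by linarith
  qed
qed

lemma grad_integrable: "(\<lambda>t. gradient (V t) q) absolutely_integrable_on {0..T}"
proof -
  obtain m where m: "m integrable_on {0..T}"
    "\<And>t x. norm x \<le> norm q \<Longrightarrow> norm (gradient (V t) x) \<le> m t"
    using grad_dominated[where R = "norm q"] by metis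
  then have "(\<lambda>t. gradient (V t) q) integrable_on {0..T}"
    by (intro measurable_bounded_by_integrable_imp_integrable[OF grad_meas m(1)]) auto
  then show ?thesis
    using m by (intro absolutely_integrable_integrable_bound[where g = m]) auto
qed

text \<open>The regularisation by \<open>\<epsilon> \<Phi>\<close> makes the conjugate of the averaged potential finite and
  differentiable.\<close>
definition avg :: "real \<Rightarrow> real \<Rightarrow> real \<Rightarrow> 'a \<Rightarrow> real" where
  "avg s e \<epsilon> x = integral {s..e} (\<lambda>t. V t x) / (e - s) + \<epsilon> * \<Phi> (\<Lambda>\<^sup>2 *\<^sub>R x)"

definition avg_grad :: "real \<Rightarrow> real \<Rightarrow> real \<Rightarrow> 'a \<Rightarrow> 'a" where
  "avg_grad s e \<epsilon> x = integral {s..e} (\<lambda>t. gradient (V t) x) /\<^sub>R (e - s)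
     + (\<epsilon> * \<Lambda>\<^sup>2) *\<^sub>R gradient \<Phi> (\<Lambda>\<^sup>2 *\<^sub>R x)"

section \<open>Calculus and growth of the potential averaged over one subinterval\<close>

context
  fixes s e :: real
  assumes se: "0 \<le> s" "s < e" "e \<le> T"
begin

lemma sub_integrable:
  fixes f :: "real \<Rightarrow> 'b::euclidean_space"
  shows "f absolutely_integrable_on {0..T} \<Longrightarrow> f integrable_on {s..e}"
  using se by (auto simp: absolutely_integrable_on_def intro: integrable_on_subinterval)

text \<open>Integrating the gradient inequality for \<open>V t\<close> at \<open>x\<close> and at
  \<open>x + w\<close> gives the two estimates of \<open>GDERIV_sandwich\<close>; dominated
  convergence enters only for the continuity of the integrated gradient.\<close>

lemma GDERIV_integral_V:
  "GDERIV (\<lambda>x. integral {s..e} (\<lambda>t. V t x)) x :> integral {s..e} (\<lambda>t. gradient (V t) x)"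
proof (rule GDERIV_sandwich)
  have lin: "(\<lambda>t. gradient (V t) y \<bullet> w) integrable_on {s..e}"
    "integral {s..e} (\<lambda>t. gradient (V t) y) \<bullet> w = integral {s..e} (\<lambda>t. gradient (V t) y \<bullet> w)" for y w
    using integrable_linear[OF sub_integrable[OF grad_integrable] bounded_linear_inner_left]
      integral_linear[OF sub_integrable[OF grad_integrable] bounded_linear_inner_left]
    by (simp_all add: comp_def)
  have V: "(\<lambda>t. V t y) integrable_on {s..e}" for y
    by (rule sub_integrable[OF V_integrable])
  fix w
  have "integral {s..e} (\<lambda>t. gradient (V t) x \<bullet> w) \<le> integral {s..e} (\<lambda>t. V t (x + w) - V t x)"
    using V_above[of _ x "x + w"] by (intro integral_le lin integrable_diff V) (simp add: algebra_simps)
  then show "integral {s..e} (\<lambda>t. gradient (V t) x) \<bullet> w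
      \<le> integral {s..e} (\<lambda>t. V t (x + w)) - integral {s..e} (\<lambda>t. V t x)"
    by (simp add: lin integral_diff[OF V V])
  have "integral {s..e} (\<lambda>t. V t (x + w) - V t x) \<le> integral {s..e} (\<lambda>t. gradient (V t) (x + w) \<bullet> w)"
    using V_above[of _ "x + w" x] by (intro integral_le lin integrable_diff V) (simp add: algebra_simps)
  then show "integral {s..e} (\<lambda>t. V t (x + w)) - integral {s..e} (\<lambda>t. V t x)
      \<le> integral {s..e} (\<lambda>t. gradient (V t) (x + w)) \<bullet> w"
    by (simp add: lin integral_diff[OF V V])
next
  show "isCont (\<lambda>x. integral {s..e} (\<lambda>t. gradient (V t) x)) x"
    unfolding continuous_at_sequentially comp_def
  proof (intro allI impI)
    fix u :: "nat \<Rightarrow> 'a" assume u: "u \<longlonglongrightarrow> x"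
    then obtain R where R: "\<And>n. norm (u n) \<le> R"
      using convergent_imp_Bseq[of u] unfolding Bseq_def convergent_def by blast
    obtain m where m: "m integrable_on {0..T}"
      "\<And>t x. norm x \<le> R \<Longrightarrow> norm (gradient (V t) x) \<le> m t"
      using grad_dominated[where R = R] by metis
    show "(\<lambda>n. integral {s..e} (\<lambda>t. gradient (V t) (u n))) \<longlonglongrightarrow> integral {s..e} (\<lambda>t. gradient (V t) x)"
    proof (rule dominated_convergence(2)[where h = m])
      show "m integrable_on {s..e}"
        by (rule integrable_on_subinterval[OF m(1)]) (use se in auto)
      show "(\<lambda>n. gradient (V t) (u n)) \<longlonglongrightarrow> gradient (V t) x" for t
        using V_grad_cont u by (metis UNIV_I continuous_on_eq_continuous_at isCont_tendsto_compose open_UNIV)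
    qed (use R m in \<open>auto intro: sub_integrable[OF grad_integrable]\<close>)
  qed
qed

lemma avg_GDERIV: "GDERIV (avg s e \<epsilon>) x :> avg_grad s e \<epsilon> x"
proof -
  have 1: "((\<lambda>x. integral {s..e} (\<lambda>t. V t x)) has_derivative
      (\<lambda>h. h \<bullet> integral {s..e} (\<lambda>t. gradient (V t) x))) (at x)"
    using GDERIV_integral_V unfolding gderiv_def .
  have "((\<lambda>x. \<Lambda>\<^sup>2 *\<^sub>R x) has_derivative (\<lambda>h. \<Lambda>\<^sup>2 *\<^sub>R h)) (at x)"
    by (auto intro!: derivative_eq_intros)
  from has_derivative_compose[OF this GDERIV[unfolded gderiv_def]]
  have 2: "((\<lambda>x. \<Phi> (\<Lambda>\<^sup>2 *\<^sub>R x)) has_derivative (\<lambda>h. \<Lambda>\<^sup>2 *\<^sub>R h \<bullet> gradient \<Phi> (\<Lambda>\<^sup>2 *\<^sub>R x))) (at x)" .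
  have "((\<lambda>x. (1 / (e - s)) * integral {s..e} (\<lambda>t. V t x) + \<epsilon> * \<Phi> (\<Lambda>\<^sup>2 *\<^sub>R x)) has_derivative
      (\<lambda>h. (1 / (e - s)) * (h \<bullet> integral {s..e} (\<lambda>t. gradient (V t) x))
        + \<epsilon> * (\<Lambda>\<^sup>2 *\<^sub>R h \<bullet> gradient \<Phi> (\<Lambda>\<^sup>2 *\<^sub>R x)))) (at x)"
    by (intro has_derivative_add has_derivative_mult_right 1 2)
  then show ?thesis
    unfolding gderiv_def avg_def[abs_def] avg_grad_def
    by (simp add: inner_add_right inverse_eq_divide mult.assoc)
qed

lemma avg_gradient: "gradient (avg s e \<epsilon>) x = avg_grad s e \<epsilon> x"
  by (rule gradient_eqI[OF avg_GDERIV])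

lemma avg_lower:
  "avg s e \<epsilon> x \<ge> \<epsilon> * \<Phi> (\<Lambda>\<^sup>2 *\<^sub>R x) - integral {s..e} (\<lambda>t. norm (l t)) / (e - s) * norm x"
proof -
  have l: "(\<lambda>t. - (norm (l t) * norm x)) integrable_on {s..e}"
    using sub_integrable[OF absolutely_integrable_norm[OF l_int]]
    by (intro integrable_neg integrable_on_mult_left) (simp add: comp_def)
  have "integral {s..e} (\<lambda>t. - (norm (l t) * norm x)) \<le> integral {s..e} (\<lambda>t. V t x)"
  proof (rule integral_le[OF l sub_integrable[OF V_integrable]])
    show "- (norm (l t) * norm x) \<le> V t x" for t
      using V_lower[of t x] Cauchy_Schwarz_ineq2[of "l t" x] by linarith
  qed
  then have "- (integral {s..e} (\<lambda>t. norm (l t)) * norm x) / (e - s) \<le> integral {s..e} (\<lambda>t. V t x) / (e - s)"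
    using se by (intro divide_right_mono) simp_all
  then show ?thesis by (simp add: avg_def)
qed

lemma integral_V_convex:
  assumes "0 \<le> r" "r \<le> 1"
  shows "integral {s..e} (\<lambda>t. V t ((1 - r) *\<^sub>R x + r *\<^sub>R y))
    \<le> (1 - r) * integral {s..e} (\<lambda>t. V t x) + r * integral {s..e} (\<lambda>t. V t y)"
proof -
  have V: "(\<lambda>t. c * V t z) integrable_on {s..e}" for c z
    by (intro integrable_on_mult_right sub_integrable[OF V_integrable])
  have "integral {s..e} (\<lambda>t. V t ((1 - r) *\<^sub>R x + r *\<^sub>R y))
      \<le> integral {s..e} (\<lambda>t. (1 - r) * V t x + r * V t y)"
    using assms by (intro integral_le sub_integrable[OF V_integrable] integrable_add V convex_onD[OF V_convex]) auto
  also have "\<dots> = (1 - r) * integral {s..e} (\<lambda>t. V t x) + r * integral {s..e} (\<lambda>t. V t y)"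
    by (simp add: integral_add[OF V V])
  finally show ?thesis .
qed

text \<open>Strict convexity is supplied by the term \<open>\<epsilon> * \<Phi>\<close>, and so is
  superlinearity: thanks to the minorant \<open>l\<close>, the averaged potential loses at most a
  linear term.\<close>

lemma avg_Gamma:
  assumes eps: "\<epsilon> > 0"
  shows "Gamma_fun (avg s e \<epsilon>)"
proof -
  have "avg s e \<epsilon> differentiable (at x)" for x
    using avg_GDERIV unfolding gderiv_def differentiable_def by blast
  moreover have "strictly_convex (avg s e \<epsilon>)"
    unfolding strictly_convex_def
  proof (intro allI impI)
    fix x y :: 'a and r :: real
    assume r: "x \<noteq> y \<and> 0 < r \<and> r < 1"
    let ?z = "(1 - r) *\<^sub>R x + r *\<^sub>R y"
    have "strictly_convex \<Phi>" using Gamma unfolding Gamma_set_def by simp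
    moreover have "\<Lambda>\<^sup>2 *\<^sub>R x \<noteq> \<Lambda>\<^sup>2 *\<^sub>R y" using r Lambda by simp
    ultimately have "\<Phi> ((1 - r) *\<^sub>R (\<Lambda>\<^sup>2 *\<^sub>R x) + r *\<^sub>R (\<Lambda>\<^sup>2 *\<^sub>R y))
        < (1 - r) * \<Phi> (\<Lambda>\<^sup>2 *\<^sub>R x) + r * \<Phi> (\<Lambda>\<^sup>2 *\<^sub>R y)"
      using r unfolding strictly_convex_def by blast
    then have "\<Phi> (\<Lambda>\<^sup>2 *\<^sub>R ?z) < (1 - r) * \<Phi> (\<Lambda>\<^sup>2 *\<^sub>R x) + r * \<Phi> (\<Lambda>\<^sup>2 *\<^sub>R y)"
      by (simp add: scaleR_add_right mult.commute)
    then have "\<epsilon> * \<Phi> (\<Lambda>\<^sup>2 *\<^sub>R ?z) < \<epsilon> * ((1 - r) * \<Phi> (\<Lambda>\<^sup>2 *\<^sub>R x) + r * \<Phi> (\<Lambda>\<^sup>2 *\<^sub>R y))"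
      using eps by simp
    moreover have "integral {s..e} (\<lambda>t. V t ?z) / (e - s)
        \<le> ((1 - r) * integral {s..e} (\<lambda>t. V t x) + r * integral {s..e} (\<lambda>t. V t y)) / (e - s)"
      using r se by (intro divide_right_mono integral_V_convex) auto
    ultimately show "avg s e \<epsilon> ?z < (1 - r) * avg s e \<epsilon> x + r * avg s e \<epsilon> y"
      by (simp add: avg_def algebra_simps add_divide_distrib diff_divide_distrib)
  qed
  moreover have "superlinear (avg s e \<epsilon>)"
  proof (rule superlinearI)
    fix M
    define c where "c = integral {s..e} (\<lambda>t. norm (l t)) / (e - s)"
    \<comment> \<open>The slope covers both \<open>M\<close> and the linear loss \<open>c\<close>,
      and undoes the factors \<open>\<epsilon>\<close> and \<open>\<Lambda>\<^sup>2\<close>.\<close>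
    obtain K where K: "\<And>u. (M + c) / (\<epsilon> * \<Lambda>\<^sup>2) * norm u \<le> \<Phi> u + K"
      using lower_bound by metis
    have "M * norm x - \<epsilon> * K \<le> avg s e \<epsilon> x" for x
    proof -
      have "(M + c) / (\<epsilon> * \<Lambda>\<^sup>2) * norm (\<Lambda>\<^sup>2 *\<^sub>R x) = (M + c) / \<epsilon> * norm x"
        using Lambda by simp
      then have "(M + c) / \<epsilon> * norm x \<le> \<Phi> (\<Lambda>\<^sup>2 *\<^sub>R x) + K"
        using K[of "\<Lambda>\<^sup>2 *\<^sub>R x"] by simp
      then have "\<epsilon> * ((M + c) / \<epsilon> * norm x) \<le> \<epsilon> * (\<Phi> (\<Lambda>\<^sup>2 *\<^sub>R x) + K)"
        using eps by (intro mult_left_mono) auto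
      then have "(M + c) * norm x \<le> \<epsilon> * \<Phi> (\<Lambda>\<^sup>2 *\<^sub>R x) + \<epsilon> * K"
        using eps by (simp add: distrib_left)
      then show ?thesis
        using avg_lower[of \<epsilon> x] by (simp add: c_def algebra_simps)
    qed
    then show "\<exists>K. \<forall>x. M * norm x - K \<le> avg s e \<epsilon> x" by blast
  qed
  ultimately show ?thesis
    by (simp add: Gamma_fun_def Gamma_set_def)
qed

text \<open>By convexity and \<open>\<Phi> 0 = 0\<close>, enlarging the argument from
  \<open>\<Lambda>\<^sup>2 x\<close> to \<open>L\<^sup>2 x\<close> gains a factor
  \<open>L\<^sup>2 / \<Lambda>\<^sup>2\<close>, which absorbs \<open>1 + \<epsilon>\<close>.\<close>

lemma avg_upper:
  assumes eps: "\<epsilon> \<ge> 0" and L: "(1 + \<epsilon>) * \<Lambda>\<^sup>2 \<le> L\<^sup>2"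
  shows "avg s e \<epsilon> x \<le> \<Phi> (L\<^sup>2 *\<^sub>R x) + integral {s..e} \<gamma> / (e - s)"
proof -
  have g: "\<gamma> integrable_on {s..e}" by (rule sub_integrable[OF gamma_int])
  have "integral {s..e} (\<lambda>t. V t x) \<le> integral {s..e} (\<lambda>t. \<Phi> (\<Lambda>\<^sup>2 *\<^sub>R x) + \<gamma> t)"
    by (intro integral_le sub_integrable[OF V_integrable] integrable_add g integrable_const_ivl V_upper)
  also have "\<dots> = (e - s) * \<Phi> (\<Lambda>\<^sup>2 *\<^sub>R x) + integral {s..e} \<gamma>"
    using se by (subst integral_add) (auto intro: g)
  finally have "integral {s..e} (\<lambda>t. V t x) / (e - s) \<le> ((e - s) * \<Phi> (\<Lambda>\<^sup>2 *\<^sub>R x) + integral {s..e} \<gamma>) / (e - s)"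
    using se by (intro divide_right_mono) auto
  then have 1: "integral {s..e} (\<lambda>t. V t x) / (e - s) \<le> \<Phi> (\<Lambda>\<^sup>2 *\<^sub>R x) + integral {s..e} \<gamma> / (e - s)"
    using se by (simp add: add_divide_distrib)
  have L0: "L\<^sup>2 > 0" "\<Lambda>\<^sup>2 \<le> L\<^sup>2"
  proof -
    have "1 * \<Lambda>\<^sup>2 \<le> (1 + \<epsilon>) * \<Lambda>\<^sup>2" using eps by (intro mult_right_mono) auto
    then show "\<Lambda>\<^sup>2 \<le> L\<^sup>2" using L by simp
    then show "L\<^sup>2 > 0" using Lambda by (meson order_less_le_trans zero_less_power)
  qed
  have "\<Phi> ((\<Lambda>\<^sup>2 / L\<^sup>2) *\<^sub>R (L\<^sup>2 *\<^sub>R x)) \<le> \<Lambda>\<^sup>2 / L\<^sup>2 * \<Phi> (L\<^sup>2 *\<^sub>R x)"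
    using L0 by (intro scale_le) auto
  then have "\<Phi> (\<Lambda>\<^sup>2 *\<^sub>R x) \<le> \<Lambda>\<^sup>2 / L\<^sup>2 * \<Phi> (L\<^sup>2 *\<^sub>R x)"
    using L0 by simp
  then have "(1 + \<epsilon>) * \<Phi> (\<Lambda>\<^sup>2 *\<^sub>R x) \<le> (1 + \<epsilon>) * (\<Lambda>\<^sup>2 / L\<^sup>2 * \<Phi> (L\<^sup>2 *\<^sub>R x))"
    using eps by (intro mult_left_mono) auto
  also have "\<dots> = ((1 + \<epsilon>) * \<Lambda>\<^sup>2 / L\<^sup>2) * \<Phi> (L\<^sup>2 *\<^sub>R x)"
    by simp
  also have "\<dots> \<le> 1 * \<Phi> (L\<^sup>2 *\<^sub>R x)"
    using L L0 nonneg by (intro mult_right_mono) auto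
  finally show ?thesis
    using 1 by (simp add: avg_def algebra_simps)
qed

text \<open>Conjugation reverses the order in \<open>avg_upper\<close> and inverts the scaling by
  \<open>L\<^sup>2\<close>; evenness of \<open>\<Phi>\<close> takes care of the sign of
  \<open>b\<close>. This supplies the minorant \<open>\<Psi>\<close> of the discrete
  problem.\<close>

lemma conj_avg_lower:
  assumes eps: "\<epsilon> > 0" and L: "(1 + \<epsilon>) * \<Lambda>\<^sup>2 \<le> L\<^sup>2" "L > 0"
  shows "convex_conjugate \<Phi> (b /\<^sub>R L\<^sup>2)
    \<le> convex_conjugate (avg s e \<epsilon>) (- b) + integral {s..e} \<gamma> / (e - s)"
proof (rule conj_le)
  fix w :: 'a
  interpret U: Gamma_fun "avg s e \<epsilon>" by (rule avg_Gamma[OF eps])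
  let ?u = "- (w /\<^sub>R L\<^sup>2)"
  have "?u \<bullet> (- b) - avg s e \<epsilon> ?u \<le> convex_conjugate (avg s e \<epsilon>) (- b)"
    by (rule U.Fenchel)
  moreover have "avg s e \<epsilon> ?u \<le> \<Phi> w + integral {s..e} \<gamma> / (e - s)"
    using avg_upper[of \<epsilon> L ?u] eps L even by simp
  ultimately show "w \<bullet> (b /\<^sub>R L\<^sup>2) - \<Phi> w \<le> convex_conjugate (avg s e \<epsilon>) (- b) + integral {s..e} \<gamma> / (e - s)"
    by simp
qed

end

end

subsection \<open>Solutions of the discretised problems\<close>

lemma sum_integral_cells:
  fixes f :: "real \<Rightarrow> 'a::euclidean_space"
  assumes h: "h > 0" and f: "f integrable_on {0..h * real n}"
  shows "(\<Sum>i<n. integral {h * real i..h * real (Suc i)} f) = integral {0..h * real n} f"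
proof -
  have "(f has_integral integral {h * real i..h * real (Suc i)} f) {h * real i..h * real (Suc i)}"
    if "i < n" for i
  proof (rule integrable_integral, rule integrable_on_subinterval[OF f])
    have "h * real (Suc i) \<le> h * real n"
      using that h by (intro mult_left_mono) auto
    then show "{h * real i..h * real (Suc i)} \<subseteq> {0..h * real n}"
      using h by auto
  qed
  from has_integral_cells[OF h, of n "\<lambda>i. f", OF this] show ?thesis
    by (simp add: integral_unique)
qed

text \<open>\<open>K\<close> bounds \<open>C_G\<close> by a real number. \<open>L\<close> takes the
  place of \<open>\<Lambda>\<close> in the dual scaling, so that some \<open>\<epsilon> > 0\<close>
  fits into \<open>(1 + \<epsilon>) * \<Lambda>\<^sup>2 \<le> L\<^sup>2\<close>.\<close>

locale periodic_problem = potential +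
  fixes L K :: real
  assumes L: "L > \<Lambda>" "T * L \<le> 1" and K: "K \<ge> 0" and TLK: "T * L * K / 2 < 1"
    and C_le: "C_const (split_sum \<Phi>) T \<le> ereal K"
    and coercive: "filterlim (\<lambda>x. integral {0..T} (\<lambda>t. V t x)) at_top at_infinity"
begin

lemma L_pos: "L > 0"
  using L Lambda by simp

definition cell_avg :: "nat \<Rightarrow> real \<Rightarrow> nat \<Rightarrow> 'a \<Rightarrow> real" where
  "cell_avg n \<epsilon> i = avg (T / real n * real i) (T / real n * real (Suc i)) \<epsilon>"

definition cell_grad :: "nat \<Rightarrow> real \<Rightarrow> nat \<Rightarrow> 'a \<Rightarrow> 'a" where
  "cell_grad n \<epsilon> i = avg_grad (T / real n * real i) (T / real n * real (Suc i)) \<epsilon>"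

lemma cell_ineqs:
  assumes "i < n"
  shows "0 \<le> T / real n * real i" "T / real n * real i < T / real n * real (Suc i)"
    "T / real n * real (Suc i) \<le> T"
    "T / real n * real (Suc i) - T / real n * real i = T / real n"
proof -
  have "T / real n * real (Suc i) \<le> T / real n * real n"
    using assms T by (intro mult_left_mono) auto
  then show "T / real n * real (Suc i) \<le> T" using assms by simp
qed (use assms T in \<open>auto simp: field_simps\<close>)

lemma sum_cells:
  fixes f :: "real \<Rightarrow> 'b::euclidean_space"
  assumes "n > 0" "f absolutely_integrable_on {0..T}"
  shows "(\<Sum>i<n. integral {T / real n * real i..T / real n * real (Suc i)} f) = integral {0..T} f"
  using sum_integral_cells[of "T / real n" f n] assms T by (simp add: absolutely_integrable_on_def)

lemma sum_cell_avg:
  assumes "n > 0"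
  shows "(T / real n) * (\<Sum>i<n. cell_avg n \<epsilon> i x)
    = integral {0..T} (\<lambda>t. V t x) + T * \<epsilon> * \<Phi> (\<Lambda>\<^sup>2 *\<^sub>R x)"
proof -
  let ?h = "T / real n"
  have h: "?h > 0" using assms T by simp
  have "?h * cell_avg n \<epsilon> i x = integral {?h * real i..?h * real (Suc i)} (\<lambda>t. V t x) + ?h * \<epsilon> * \<Phi> (\<Lambda>\<^sup>2 *\<^sub>R x)"
    if "i < n" for i
    unfolding cell_avg_def avg_def cell_ineqs(4)[OF that]
    using h by (simp add: distrib_left)
  then have "?h * (\<Sum>i<n. cell_avg n \<epsilon> i x)
      = (\<Sum>i<n. integral {?h * real i..?h * real (Suc i)} (\<lambda>t. V t x) + ?h * \<epsilon> * \<Phi> (\<Lambda>\<^sup>2 *\<^sub>R x))"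
    unfolding sum_distrib_left by (intro sum.cong) auto
  also have "\<dots> = integral {0..T} (\<lambda>t. V t x) + T * \<epsilon> * \<Phi> (\<Lambda>\<^sup>2 *\<^sub>R x)"
    using assms by (simp only: sum.distrib sum_cells[OF assms V_integrable]) simp
  finally show ?thesis .
qed

lemma sum_cell_grad:
  assumes "n > 0"
  shows "(T / real n) *\<^sub>R (\<Sum>i<n. cell_grad n \<epsilon> i x) = T *\<^sub>R avg_grad 0 T \<epsilon> x"
proof -
  let ?h = "T / real n"
  have h: "?h > 0" using assms T by simp
  let ?G = "(\<epsilon> * \<Lambda>\<^sup>2) *\<^sub>R gradient \<Phi> (\<Lambda>\<^sup>2 *\<^sub>R x)"
  have "?h *\<^sub>R cell_grad n \<epsilon> i x
      = integral {?h * real i..?h * real (Suc i)} (\<lambda>t. gradient (V t) x) + ?h *\<^sub>R ?G"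
    if "i < n" for i
    unfolding cell_grad_def avg_grad_def cell_ineqs(4)[OF that] scaleR_add_right
    using h by simp
  then have "?h *\<^sub>R (\<Sum>i<n. cell_grad n \<epsilon> i x)
      = (\<Sum>i<n. integral {?h * real i..?h * real (Suc i)} (\<lambda>t. gradient (V t) x) + ?h *\<^sub>R ?G)"
    unfolding scaleR_sum_right by (intro sum.cong) auto
  also have "\<dots> = integral {0..T} (\<lambda>t. gradient (V t) x) + T *\<^sub>R ?G"
    using assms by (simp only: sum.distrib sum_cells[OF assms grad_integrable]) (simp add: sum_constant_scaleR)
  also have "\<dots> = T *\<^sub>R avg_grad 0 T \<epsilon> x"
    using T by (simp add: avg_grad_def scaleR_add_right)
  finally show ?thesis .
qed

text \<open>Hypothesis (3) outside a ball, continuity inside. This bound limits the action of the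
  comparison slopes.\<close>

lemma integral_V_bounded_below:
  obtains c where "\<And>x. - c \<le> integral {0..T} (\<lambda>t. V t x)"
proof -
  have "\<forall>\<^sub>F x in at_infinity. 0 \<le> integral {0..T} (\<lambda>t. V t x)"
    using coercive unfolding filterlim_at_top by blast
  then obtain R where R: "\<And>x. R \<le> norm x \<Longrightarrow> 0 \<le> integral {0..T} (\<lambda>t. V t x)"
    unfolding eventually_at_infinity by blast
  have "continuous_on UNIV (\<lambda>x. integral {0..T} (\<lambda>t. V t x))"
    using T GDERIV_imp_isCont[OF GDERIV_integral_V[of 0 T]] by (simp add: continuous_at_imp_continuous_on)
  then obtain B where B: "B \<ge> 0" "\<And>u. norm u \<le> R \<Longrightarrow> \<bar>integral {0..T} (\<lambda>t. V t u)\<bar> \<le> B"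
    by (rule continuous_bounded_on_ball[where M = R]) blast
  have "- B \<le> integral {0..T} (\<lambda>t. V t x)" for x
    using R[of x] B(1) B(2)[of x] by (cases "R \<le> norm x") auto
  then show thesis using that by blast
qed

text \<open>The comparison slopes sum to zero exactly because \<open>x\<close> is a critical point
  of the average over the whole interval. Fenchel's equality turns their conjugates into the
  negative averaged potential at \<open>x\<close>, which is at most \<open>c0\<close> since the
  regularisation has the favourable sign; hence the energy bound is free of \<open>n\<close> and
  \<open>\<epsilon>\<close>.\<close>

lemma discrete_solution:
  assumes n: "n > 0" and eps: "\<epsilon> > 0" "(1 + \<epsilon>) * \<Lambda>\<^sup>2 \<le> L\<^sup>2"
    and c0: "\<And>x. - c0 \<le> integral {0..T} (\<lambda>t. V t x)"
  defines "h \<equiv> T / real n"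
  shows "\<exists>a b c d. (\<Sum>i<n. a i) = 0 \<and> (\<Sum>i<n. b i) = 0 \<and>
    (\<forall>i<n. gradient \<Phi> (a i) = d + h *\<^sub>R midsum b i \<and>
      cell_grad n \<epsilon> i (c + h *\<^sub>R midsum a i) = - b i) \<and>
    h * (\<Sum>i<n. \<Phi> (a i) + convex_conjugate \<Phi> (b i /\<^sub>R L\<^sup>2))
        \<le> (c0 + integral {0..T} \<gamma>) / (1 - T * L * K / 2)"
proof -
  have h: "h > 0" and hn: "T = h * real n" using n T by (auto simp: h_def)
  let ?U = "cell_avg n \<epsilon>"
  define g where "g i = integral {h * real i..h * real (Suc i)} \<gamma> / h" for i
  have U: "Gamma_fun (?U i)" if "i < n" for i
    unfolding cell_avg_def by (rule avg_Gamma[OF cell_ineqs(1-3)[OF that] eps(1)])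
  have U_grad: "gradient (?U i) x = cell_grad n \<epsilon> i x" if "i < n" for i x
    unfolding cell_avg_def cell_grad_def by (rule avg_gradient[OF cell_ineqs(1-3)[OF that]])
  obtain K0 where K0: "\<And>x. L\<^sup>2 * norm x \<le> convex_conjugate \<Phi> x + K0"
    using conj_lower_bound[of "L\<^sup>2"] by auto
  interpret dd: discrete_dual n h "T * L * K / 2" K0 \<Phi> ?U "\<lambda>x. convex_conjugate \<Phi> (x /\<^sub>R L\<^sup>2)" g
  proof (rule discrete_dual.intro)
    show "Gamma_fun \<Phi>" by (rule Gamma_fun_axioms)
    show "norm x \<le> convex_conjugate \<Phi> (x /\<^sub>R L\<^sup>2) + K0" for x
      using K0[of "x /\<^sub>R L\<^sup>2"] L_pos by (simp flip: mult.assoc)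
    show "convex_conjugate \<Phi> (x /\<^sub>R L\<^sup>2) \<le> convex_conjugate (?U i) (- x) + g i" if "i < n" for i x
      unfolding cell_avg_def g_def
      using conj_avg_lower[OF cell_ineqs(1-3)[OF that] eps L_pos, of x] cell_ineqs(4)[OF that]
      by (simp add: h_def)
    show "h * (\<Sum>i<n. a i \<bullet> midsum b i)
        \<le> T * L * K / 2 * (\<Sum>i<n. \<Phi> (a i) + convex_conjugate \<Phi> (b i /\<^sub>R L\<^sup>2))"
      if "(\<Sum>i<n. a i) = 0" "(\<Sum>i<n. b i) = 0" for a b
      by (rule symplectic_step_bound[OF h n hn that C_le K L_pos L(2)])
  qed (use nonneg conj_nonneg U TLK in auto)
  obtain a b c d where sol: "(\<Sum>i<n. a i) = 0" "(\<Sum>i<n. b i) = 0"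
    "\<And>i. i < n \<Longrightarrow> gradient \<Phi> (a i) = d + h *\<^sub>R midsum b i"
    "\<And>i. i < n \<Longrightarrow> gradient (?U i) (c + h *\<^sub>R midsum a i) = - b i"
    and min: "\<And>b'. (\<Sum>i<n. b' i) = 0 \<Longrightarrow>
      (1 - T * L * K / 2) * (\<Sum>i<n. \<Phi> (a i) + convex_conjugate \<Phi> (b i /\<^sub>R L\<^sup>2))
        \<le> (\<Sum>i<n. convex_conjugate (?U i) (- b' i)) + (\<Sum>i<n. g i)"
    using dd.critical_point by blast
  have T': "0 \<le> (0::real)" "0 < T" "T \<le> T" using T by auto
  interpret A: Gamma_fun "avg 0 T \<epsilon>" by (rule avg_Gamma[OF T' eps(1)])
  \<comment> \<open>At slope \<open>0\<close> the maximiser in the conjugate is the minimiser of the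
    function.\<close>
  define x where "x = conj_arg (avg 0 T \<epsilon>) 0"
  have "avg_grad 0 T \<epsilon> x = 0"
    using A.gradient_conj_arg[of 0] avg_gradient[OF T'] by (simp add: x_def)
  then have g0: "(\<Sum>i<n. cell_grad n \<epsilon> i x) = 0"
    using sum_cell_grad[OF n, of \<epsilon> x] n T by simp
  have "(\<Sum>i<n. convex_conjugate (?U i) (cell_grad n \<epsilon> i x)) = (\<Sum>i<n. x \<bullet> cell_grad n \<epsilon> i x - ?U i x)"
    using Gamma_fun.conj_gradient[OF U] U_grad by (intro sum.cong refl) (metis lessThan_iff)
  also have "\<dots> = x \<bullet> (\<Sum>i<n. cell_grad n \<epsilon> i x) - (\<Sum>i<n. ?U i x)"
    by (simp add: sum_subtractf inner_sum_right)
  finally have "h * (\<Sum>i<n. convex_conjugate (?U i) (cell_grad n \<epsilon> i x)) = - (h * (\<Sum>i<n. ?U i x))"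
    using g0 by simp
  also have "\<dots> \<le> c0"
  proof -
    have "0 \<le> T * \<epsilon> * \<Phi> (\<Lambda>\<^sup>2 *\<^sub>R x)" using T eps nonneg by simp
    then show ?thesis
      using sum_cell_avg[OF n, of \<epsilon> x] c0[of x] by (simp add: h_def)
  qed
  finally have 1: "h * (\<Sum>i<n. convex_conjugate (?U i) (cell_grad n \<epsilon> i x)) \<le> c0" .
  have 2: "h * (\<Sum>i<n. g i) = integral {0..T} \<gamma>"
    using sum_cells[OF n gamma_int] n T by (simp add: g_def sum_distrib_left h_def)
  have "h * ((1 - T * L * K / 2) * (\<Sum>i<n. \<Phi> (a i) + convex_conjugate \<Phi> (b i /\<^sub>R L\<^sup>2)))
      \<le> h * ((\<Sum>i<n. convex_conjugate (?U i) (cell_grad n \<epsilon> i x)) + (\<Sum>i<n. g i))"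
    using min[of "\<lambda>i. - cell_grad n \<epsilon> i x"] g0 h by (simp add: sum_negf)
  then have "(1 - T * L * K / 2) * (h * (\<Sum>i<n. \<Phi> (a i) + convex_conjugate \<Phi> (b i /\<^sub>R L\<^sup>2)))
      \<le> c0 + integral {0..T} \<gamma>"
    using 1 2 by (simp add: distrib_left mult.left_commute)
  then have bound: "h * (\<Sum>i<n. \<Phi> (a i) + convex_conjugate \<Phi> (b i /\<^sub>R L\<^sup>2))
      \<le> (c0 + integral {0..T} \<gamma>) / (1 - T * L * K / 2)"
    using TLK by (simp add: pos_le_divide_eq mult.commute)
  have "cell_grad n \<epsilon> i (c + h *\<^sub>R midsum a i) = - b i" if "i < n" for i
    using sol(4)[OF that] U_grad[OF that] by simp
  then show ?thesis
    using sol(1-3) bound by blast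
qed

lemma discrete_solution_bounded:
  obtains R where "\<And>n \<epsilon>. n > 0 \<Longrightarrow> \<epsilon> > 0 \<Longrightarrow> (1 + \<epsilon>) * \<Lambda>\<^sup>2 \<le> L\<^sup>2 \<Longrightarrow>
    \<exists>a b c d. (\<Sum>i<n. a i) = 0 \<and> (\<Sum>i<n. b i) = 0 \<and> norm c \<le> R \<and> norm d \<le> R \<and>
      (\<forall>i<n. a i = conj_arg \<Phi> (d + (T / real n) *\<^sub>R midsum b i) \<and>
        b i = - cell_grad n \<epsilon> i (c + (T / real n) *\<^sub>R midsum a i) \<and>
        norm (c + (T / real n) *\<^sub>R midsum a i) \<le> R \<and> norm (d + (T / real n) *\<^sub>R midsum b i) \<le> R)"
proof -
  obtain c0 where c0: "\<And>x. - c0 \<le> integral {0..T} (\<lambda>t. V t x)"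
    using integral_V_bounded_below by blast
  obtain K1 where K1: "\<And>x. 1 * norm x \<le> \<Phi> x + K1"
    using lower_bound[of 1] by metis
  obtain K2 where K2: "\<And>x. L\<^sup>2 * norm x \<le> convex_conjugate \<Phi> x + K2"
    using conj_lower_bound[of "L\<^sup>2"] by auto
  define E0 where "E0 = (c0 + integral {0..T} \<gamma>) / (1 - T * L * K / 2)"
  \<comment> \<open>\<open>A0\<close> and \<open>B0\<close> will bound the integrals of the norms of
    the slopes; the linear lower bounds of the two energies cost \<open>K1\<close> and
    \<open>K2\<close> per unit of time.\<close>
  define A0 where "A0 = max 0 (E0 + T * K1)"
  define B0 where "B0 = max 0 (E0 + T * K2)"
  obtain M where M: "M \<ge> 0" "\<And>x. norm x \<le> A0 / T \<Longrightarrow> norm (gradient \<Phi> x) \<le> M"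
    using gradient_bounded[where M = "A0 / T"] by metis
  obtain Bq where Bq: "Bq \<ge> 0" "\<And>u. norm u \<le> L\<^sup>2 * A0 \<Longrightarrow> \<bar>\<Phi> u\<bar> \<le> Bq"
    by (rule continuous_bounded_on_ball[OF cont, where M = "L\<^sup>2 * A0"]) blast
  \<comment> \<open>The two halves arise from convexity at \<open>c / 2\<close>, the midpoint
    between the position in a cell and the negative of its deviation from \<open>c\<close>.\<close>
  define D where "D = (integral {0..T} \<gamma> + A0 * B0) / 2 + (T * Bq + integral {0..T} \<gamma>) / 2"
  have "\<forall>\<^sub>F x in at_infinity. D + 1 \<le> integral {0..T} (\<lambda>t. V t x)"
    using coercive unfolding filterlim_at_top by blast
  then obtain R1 where R1: "\<And>x. R1 \<le> norm x \<Longrightarrow> D + 1 \<le> integral {0..T} (\<lambda>t. V t x)"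
    unfolding eventually_at_infinity by blast
  \<comment> \<open>\<open>2 * R1\<close> because the potential is estimated at
    \<open>c / 2\<close>; \<open>2 * B0\<close> because the deviation from \<open>d\<close> enters
    once in bounding \<open>d\<close> and once in bounding the momentum.\<close>
  define R where "R = max (2 * R1 + A0) (M + 2 * B0)"
  show thesis
  proof (rule that[of R])
    fix n :: nat and \<epsilon> :: real
    assume n: "n > 0" and eps: "\<epsilon> > 0" "(1 + \<epsilon>) * \<Lambda>\<^sup>2 \<le> L\<^sup>2"
    define h where "h = T / real n"
    have h: "h > 0" and hn: "T = h * real n" using n T by (auto simp: h_def)
    obtain a b c d where sum0: "(\<Sum>i<n. a i) = 0" "(\<Sum>i<n. b i) = 0"
      and grad: "\<And>i. i < n \<Longrightarrow> gradient \<Phi> (a i) = d + h *\<^sub>R midsum b i"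
        "\<And>i. i < n \<Longrightarrow> cell_grad n \<epsilon> i (c + h *\<^sub>R midsum a i) = - b i"
      and E: "h * (\<Sum>i<n. \<Phi> (a i) + convex_conjugate \<Phi> (b i /\<^sub>R L\<^sup>2)) \<le> E0"
      unfolding h_def E0_def using discrete_solution[OF n eps c0] by blast
    have E1: "h * (\<Sum>i<n. \<Phi> (a i)) \<le> E0"
    proof -
      have "h * (\<Sum>i<n. \<Phi> (a i)) \<le> h * (\<Sum>i<n. \<Phi> (a i) + convex_conjugate \<Phi> (b i /\<^sub>R L\<^sup>2))"
        using h conj_nonneg by (intro mult_left_mono sum_mono) auto
      then show ?thesis using E by simp
    qed
    have E2: "h * (\<Sum>i<n. convex_conjugate \<Phi> (b i /\<^sub>R L\<^sup>2)) \<le> E0"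
    proof -
      have "h * (\<Sum>i<n. convex_conjugate \<Phi> (b i /\<^sub>R L\<^sup>2)) \<le> h * (\<Sum>i<n. \<Phi> (a i) + convex_conjugate \<Phi> (b i /\<^sub>R L\<^sup>2))"
        using h nonneg by (intro mult_left_mono sum_mono) auto
      then show ?thesis using E by simp
    qed
    have A: "h * (\<Sum>i<n. norm (a i)) \<le> A0"
    proof -
      have "h * (\<Sum>i<n. norm (a i)) \<le> h * (\<Sum>i<n. \<Phi> (a i) + K1)"
        using h K1 by (intro mult_left_mono sum_mono) auto
      also have "\<dots> \<le> A0" using E1 by (simp add: sum.distrib distrib_left hn A0_def)
      finally show ?thesis .
    qed
    have B: "h * (\<Sum>i<n. norm (b i)) \<le> B0"
    proof -
      have "norm (b i) \<le> convex_conjugate \<Phi> (b i /\<^sub>R L\<^sup>2) + K2" for i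
        using K2[of "b i /\<^sub>R L\<^sup>2"] L_pos by (simp flip: mult.assoc)
      then have "h * (\<Sum>i<n. norm (b i)) \<le> h * (\<Sum>i<n. convex_conjugate \<Phi> (b i /\<^sub>R L\<^sup>2) + K2)"
        using h by (intro mult_left_mono sum_mono) auto
      also have "\<dots> \<le> B0" using E2 by (simp add: sum.distrib distrib_left hn B0_def)
      finally show ?thesis .
    qed
    have midA: "norm (h *\<^sub>R midsum a i) \<le> A0" and midB: "norm (h *\<^sub>R midsum b i) \<le> B0" if "i < n" for i
    proof -
      have "norm (h *\<^sub>R midsum f i) \<le> h * (\<Sum>i<n. norm (f i))" for f :: "nat \<Rightarrow> 'a"
        using mult_left_mono[OF norm_midsum_le[OF that, of f], of h] h by simp
      from this[of a] this[of b] show "norm (h *\<^sub>R midsum a i) \<le> A0" "norm (h *\<^sub>R midsum b i) \<le> B0"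
        using A B by linarith+
    qed
    \<comment> \<open>Otherwise the mean of the norms would exceed \<open>A0 / T\<close>. In the
      cell so found the momentum \<open>gradient \<Phi> (a j)\<close> is bounded by
      \<open>M\<close>.\<close>
    have "\<exists>i<n. norm (a i) \<le> A0 / T"
    proof (rule ccontr)
      assume "\<not> ?thesis"
      then have "(\<Sum>i<n. A0 / T) < (\<Sum>i<n. norm (a i))"
        using n by (intro sum_strict_mono) (auto simp: not_le)
      then have "real n * (A0 / T) < (\<Sum>i<n. norm (a i))"
        by simp
      then have "h * (real n * (A0 / T)) < h * (\<Sum>i<n. norm (a i))"
        using h by (rule mult_strict_left_mono)
      moreover have "h * (real n * (A0 / T)) = A0"
        using T n by (simp add: h_def)
      ultimately show False using A by simp
    qed
    then obtain j where j: "j < n" "norm (a j) \<le> A0 / T" by blast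
    have "norm d \<le> norm (d + h *\<^sub>R midsum b j) + norm (h *\<^sub>R midsum b j)"
      using norm_triangle_sub[of d "- (h *\<^sub>R midsum b j)"] by simp
    also have "\<dots> \<le> M + B0"
      using M(2)[OF j(2)] grad(1)[OF j(1)] midB[OF j(1)] by simp
    finally have d: "norm d \<le> M + B0" .
    have B0: "B0 \<ge> 0" and A0: "A0 \<ge> 0" by (auto simp: A0_def B0_def)
    have y: "norm (d + h *\<^sub>R midsum b i) \<le> M + 2 * B0" if "i < n" for i
      using norm_triangle_ineq[of d "h *\<^sub>R midsum b i"] d midB[OF that] by linarith
    let ?x = "\<lambda>i. c + h *\<^sub>R midsum a i"
    define g where "g i = integral {h * real i..h * real (Suc i)} \<gamma> / h" for i
    have hg: "h * (\<Sum>i<n. g i) = integral {0..T} \<gamma>"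
      using sum_cells[OF n gamma_int] n T by (simp add: g_def sum_distrib_left h_def)
    have up: "cell_avg n \<epsilon> i x \<le> \<Phi> (L\<^sup>2 *\<^sub>R x) + g i" if "i < n" for i x
      using avg_upper[OF cell_ineqs(1-3)[OF that] _ eps(2), of x] eps(1) cell_ineqs(4)[OF that]
      by (simp add: cell_avg_def g_def h_def)
    have cv: "Gamma_fun (cell_avg n \<epsilon> i)" if "i < n" for i
      unfolding cell_avg_def by (rule avg_Gamma[OF cell_ineqs(1-3)[OF that] eps(1)])
    have gr: "gradient (cell_avg n \<epsilon> i) (?x i) = - b i" if "i < n" for i
      using grad(2)[OF that] avg_gradient[OF cell_ineqs(1-3)[OF that]]
      by (simp add: cell_avg_def cell_grad_def)
    define S where "S = h * (\<Sum>i<n. b i \<bullet> ?x i)"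
    \<comment> \<open>The gradient inequality between the position and \<open>0\<close> bounds the
      value at \<open>?x i\<close>; the growth condition bounds the other value, whose argument
      stays in a fixed ball.\<close>
    have "cell_avg n \<epsilon> i (c /\<^sub>R 2) \<le> (g i - b i \<bullet> ?x i) / 2 + (Bq + g i) / 2" if "i < n" for i
    proof -
      have "cell_avg n \<epsilon> i (?x i) \<le> g i - b i \<bullet> ?x i"
        using Gamma_fun.above[OF cv[OF that], of "?x i" 0] gr[OF that] up[OF that, of 0]
        by (simp add: inner_add_right inner_diff_right)
      moreover have "cell_avg n \<epsilon> i (- (h *\<^sub>R midsum a i)) \<le> Bq + g i"
      proof -
        have "norm (L\<^sup>2 *\<^sub>R - (h *\<^sub>R midsum a i)) \<le> L\<^sup>2 * A0"
          using mult_left_mono[OF midA[OF that], of "L\<^sup>2"]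
          by (simp add: abs_mult mult.assoc)
        from Bq(2)[OF this] show ?thesis
          using up[OF that, of "- (h *\<^sub>R midsum a i)"] by linarith
      qed
      moreover have "cell_avg n \<epsilon> i ((1 - 1/2) *\<^sub>R ?x i + (1/2) *\<^sub>R (- (h *\<^sub>R midsum a i)))
          \<le> (1 - 1/2) * cell_avg n \<epsilon> i (?x i) + 1/2 * cell_avg n \<epsilon> i (- (h *\<^sub>R midsum a i))"
        by (intro convex_onD[OF Gamma_fun.convex[OF cv[OF that]]]) auto
      moreover have "(1 - 1/2) *\<^sub>R ?x i + (1/2) *\<^sub>R (- (h *\<^sub>R midsum a i)) = c /\<^sub>R 2"
        by (simp add: algebra_simps)
      ultimately show ?thesis by (simp add: field_simps)
    qed
    then have "h * (\<Sum>i<n. cell_avg n \<epsilon> i (c /\<^sub>R 2)) \<le> h * (\<Sum>i<n. (g i - b i \<bullet> ?x i) / 2 + (Bq + g i) / 2)"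
      using h by (intro mult_left_mono sum_mono) auto
    also have "\<dots> = (h * (\<Sum>i<n. g i) - S) / 2 + (T * Bq + h * (\<Sum>i<n. g i)) / 2"
      unfolding S_def sum.distrib sum_divide_distrib[symmetric] sum_subtractf
      by (simp add: hn distrib_left right_diff_distrib)
    also have "\<dots> = (integral {0..T} \<gamma> - S) / 2 + (T * Bq + integral {0..T} \<gamma>) / 2"
      unfolding hg ..
    also have "\<dots> \<le> D"
    proof -
      \<comment> \<open>The unknown \<open>c\<close> drops out because the slopes \<open>b\<close>
        sum to zero.\<close>
      have "h * (\<Sum>i<n. b i \<bullet> ?x i) = (h * (\<Sum>i<n. b i \<bullet> (h *\<^sub>R midsum a i)))"
        using sum0 by (simp add: inner_add_right sum.distrib flip: inner_sum_left)
      moreover have "\<bar>h * (\<Sum>i<n. b i \<bullet> (h *\<^sub>R midsum a i))\<bar> \<le> h * (\<Sum>i<n. norm (b i) * A0)"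
      proof -
        have "\<bar>\<Sum>i<n. b i \<bullet> (h *\<^sub>R midsum a i)\<bar> \<le> (\<Sum>i<n. norm (b i) * A0)"
        proof (rule order_trans[OF sum_abs], rule sum_mono)
          fix i assume "i \<in> {..<n}"
          then show "\<bar>b i \<bullet> (h *\<^sub>R midsum a i)\<bar> \<le> norm (b i) * A0"
            using Cauchy_Schwarz_ineq2[of "b i" "h *\<^sub>R midsum a i"] midA[of i]
            by (meson lessThan_iff mult_left_mono norm_ge_zero order_trans)
        qed
        then show ?thesis using h by (simp add: abs_mult)
      qed
      moreover have "h * (\<Sum>i<n. norm (b i) * A0) \<le> A0 * B0"
        using mult_left_mono[OF B A0] by (simp add: sum_distrib_left ac_simps)
      ultimately have "- S \<le> A0 * B0"
        unfolding S_def by linarith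
      then show ?thesis unfolding D_def by (intro add_mono divide_right_mono) auto
    qed
    finally have "integral {0..T} (\<lambda>t. V t (c /\<^sub>R 2)) + T * \<epsilon> * \<Phi> (\<Lambda>\<^sup>2 *\<^sub>R (c /\<^sub>R 2)) \<le> D"
      using sum_cell_avg[OF n, of \<epsilon> "c /\<^sub>R 2"] by (simp add: h_def)
    moreover have "0 \<le> T * \<epsilon> * \<Phi> (\<Lambda>\<^sup>2 *\<^sub>R (c /\<^sub>R 2))" using T eps nonneg by simp
    ultimately have "\<not> R1 \<le> norm (c /\<^sub>R 2)"
      using R1[of "c /\<^sub>R 2"] by linarith
    then have c: "norm c \<le> 2 * R1" by simp
    have x: "norm (?x i) \<le> 2 * R1 + A0" if "i < n" for i
      using norm_triangle_ineq[of c "h *\<^sub>R midsum a i"] c midA[OF that] by linarith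
    show "\<exists>a b c d. (\<Sum>i<n. a i) = 0 \<and> (\<Sum>i<n. b i) = 0 \<and> norm c \<le> R \<and> norm d \<le> R \<and>
      (\<forall>i<n. a i = conj_arg \<Phi> (d + (T / real n) *\<^sub>R midsum b i) \<and>
        b i = - cell_grad n \<epsilon> i (c + (T / real n) *\<^sub>R midsum a i) \<and>
        norm (c + (T / real n) *\<^sub>R midsum a i) \<le> R \<and> norm (d + (T / real n) *\<^sub>R midsum b i) \<le> R)"
    proof (intro exI conjI allI impI)
      fix i assume i: "i < n"
      show "a i = conj_arg \<Phi> (d + (T / real n) *\<^sub>R midsum b i)"
        using conj_arg_gradient[of "a i"] grad(1)[OF i] by (simp add: h_def)
      show "b i = - cell_grad n \<epsilon> i (c + (T / real n) *\<^sub>R midsum a i)"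
        using grad(2)[OF i] by (simp add: h_def)
      show "norm (c + (T / real n) *\<^sub>R midsum a i) \<le> R" "norm (d + (T / real n) *\<^sub>R midsum b i) \<le> R"
        using x[OF i] y[OF i] by (simp_all add: R_def h_def)
    qed (use sum0 c d A0 B0 in \<open>auto simp: R_def\<close>)
  qed
qed

end

subsection \<open>Passage to the limit\<close>

context periodic_problem
begin

text \<open>Reads a discrete slope of \<open>p\<close> as an exact integral of the force with the
  position frozen and the time running, so that averages need no limit of their own.\<close>

lemma cell_grad_has_integral:
  assumes "i < n"
  shows "((\<lambda>s. gradient (V s) x + (\<epsilon> * \<Lambda>\<^sup>2) *\<^sub>R gradient \<Phi> (\<Lambda>\<^sup>2 *\<^sub>R x)) has_integral
    (T / real n) *\<^sub>R cell_grad n \<epsilon> i x) {T / real n * real i..T / real n * real (Suc i)}"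
proof -
  let ?s = "T / real n * real i" and ?e = "T / real n * real (Suc i)"
  let ?G = "(\<epsilon> * \<Lambda>\<^sup>2) *\<^sub>R gradient \<Phi> (\<Lambda>\<^sup>2 *\<^sub>R x)"
  have "((\<lambda>s. gradient (V s) x) has_integral integral {?s..?e} (\<lambda>s. gradient (V s) x)) {?s..?e}"
    by (rule integrable_integral[OF sub_integrable[OF cell_ineqs(1-3)[OF assms] grad_integrable]])
  moreover have "((\<lambda>s. ?G) has_integral (?e - ?s) *\<^sub>R ?G) {?s..?e}"
    using has_integral_const_real[of ?G ?s ?e] cell_ineqs(2)[OF assms] by simp
  ultimately have "((\<lambda>s. gradient (V s) x + ?G) has_integral
      integral {?s..?e} (\<lambda>s. gradient (V s) x) + (?e - ?s) *\<^sub>R ?G) {?s..?e}"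
    by (rule has_integral_add)
  then show ?thesis
    using assms T
    unfolding cell_grad_def avg_grad_def cell_ineqs(4)[OF assms] scaleR_add_right by simp
qed

text \<open>Uniform continuity of the primitive. The forces have merely an integrable majorant, so
  this replaces a Lipschitz bound for the momenta.\<close>

lemma indefinite_integral_small:
  fixes m :: "real \<Rightarrow> real"
  assumes m: "m integrable_on {0..T}" "\<And>t. 0 \<le> m t" and e: "e > 0"
  obtains \<delta> where "\<delta> > 0"
    "\<And>s t. 0 \<le> s \<Longrightarrow> s \<le> t \<Longrightarrow> t \<le> T \<Longrightarrow> t - s < \<delta> \<Longrightarrow> integral {s..t} m < e"
proof -
  have "uniformly_continuous_on {0..T} (\<lambda>t. integral {0..t} m)"
    by (intro compact_uniformly_continuous indefinite_integral_continuous_1 m(1)) simp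
  then obtain \<delta> where d: "\<delta> > 0" "\<And>s t. s \<in> {0..T} \<Longrightarrow> t \<in> {0..T} \<Longrightarrow> dist t s < \<delta> \<Longrightarrow>
      dist (integral {0..t} m) (integral {0..s} m) < e"
    using e unfolding uniformly_continuous_on_def by metis
  have "integral {s..t} m < e" if "0 \<le> s" "s \<le> t" "t \<le> T" "t - s < \<delta>" for s t
    using d(2)[of s t] that integral_diff_Icc[OF m(1), of s t] by (auto simp: dist_real_def)
  then show thesis using that d(1) by blast
qed

lemma hamiltonian_solution:
  obtains q p where "continuous_on {0..T} q" "continuous_on {0..T} p"
    "(\<lambda>s. gradient (V s) (q s)) absolutely_integrable_on {0..T}"
    "\<And>t. t \<in> {0..T} \<Longrightarrow> q t = q 0 + integral {0..t} (\<lambda>s. conj_arg \<Phi> (p s))"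
    "\<And>t. t \<in> {0..T} \<Longrightarrow> p t = p 0 - integral {0..t} (\<lambda>s. gradient (V s) (q s))"
    "q T = q 0" "p T = p 0"
proof -
  obtain R where R: "\<And>n \<epsilon>. n > 0 \<Longrightarrow> \<epsilon> > 0 \<Longrightarrow> (1 + \<epsilon>) * \<Lambda>\<^sup>2 \<le> L\<^sup>2 \<Longrightarrow>
    \<exists>a b c d. (\<Sum>i<n. a i) = 0 \<and> (\<Sum>i<n. b i) = 0 \<and> norm c \<le> R \<and> norm d \<le> R \<and>
      (\<forall>i<n. a i = conj_arg \<Phi> (d + (T / real n) *\<^sub>R midsum b i) \<and>
        b i = - cell_grad n \<epsilon> i (c + (T / real n) *\<^sub>R midsum a i) \<and>
        norm (c + (T / real n) *\<^sub>R midsum a i) \<le> R \<and> norm (d + (T / real n) *\<^sub>R midsum b i) \<le> R)"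
    using discrete_solution_bounded by blast
  \<comment> \<open>The largest value allowed by
    \<open>(1 + \<epsilon>) * \<Lambda>\<^sup>2 \<le> L\<^sup>2\<close>.\<close>
  define \<epsilon>0 where "\<epsilon>0 = L\<^sup>2 / \<Lambda>\<^sup>2 - 1"
  define \<epsilon> where "\<epsilon> n = \<epsilon>0 / real (Suc n)" for n
  define h where "h n = T / real (Suc n)" for n
  have "\<Lambda>\<^sup>2 < L\<^sup>2"
    using L(1) Lambda by (intro power_strict_mono) auto
  then have eps0: "\<epsilon>0 > 0"
    using Lambda by (simp add: \<epsilon>0_def)
  have eps: "\<epsilon> n > 0" "\<epsilon> n \<le> \<epsilon>0" for n
    using eps0 by (auto simp: \<epsilon>_def field_simps)
  have epsL: "(1 + \<epsilon> n) * \<Lambda>\<^sup>2 \<le> L\<^sup>2" for n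
  proof -
    have "(1 + \<epsilon> n) * \<Lambda>\<^sup>2 \<le> (1 + \<epsilon>0) * \<Lambda>\<^sup>2"
      using eps(2) by (intro mult_right_mono) auto
    then show ?thesis using Lambda by (simp add: \<epsilon>0_def)
  qed
  have h: "h n > 0" "h n * real (Suc n) = T" for n
    using T by (auto simp: h_def)
  define Q where "Q n a b c d \<longleftrightarrow> (\<Sum>i<Suc n. a i) = 0 \<and> (\<Sum>i<Suc n. b i) = 0 \<and> norm c \<le> R \<and> norm d \<le> R \<and>
      (\<forall>i<Suc n. a i = conj_arg \<Phi> (d + h n *\<^sub>R midsum b i) \<and>
        b i = - cell_grad (Suc n) (\<epsilon> n) i (c + h n *\<^sub>R midsum a i) \<and>
        norm (c + h n *\<^sub>R midsum a i) \<le> R \<and> norm (d + h n *\<^sub>R midsum b i) \<le> R)" for n a b c d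
  have "\<forall>n. \<exists>a b c d. Q n a b c d"
    unfolding Q_def h_def using R[OF _ eps(1) epsL] by blast
  then obtain a b c d where "\<And>n. Q n (a n) (b n) (c n) (d n)"
    by metis
  then have sum0: "(\<Sum>i<Suc n. a n i) = 0" "(\<Sum>i<Suc n. b n i) = 0"
    and cd: "norm (c n) \<le> R" "norm (d n) \<le> R"
    and ai: "\<And>i. i < Suc n \<Longrightarrow> a n i = conj_arg \<Phi> (d n + h n *\<^sub>R midsum (b n) i)"
    and bi: "\<And>i. i < Suc n \<Longrightarrow> b n i = - cell_grad (Suc n) (\<epsilon> n) i (c n + h n *\<^sub>R midsum (a n) i)"
    and xR: "\<And>i. i < Suc n \<Longrightarrow> norm (c n + h n *\<^sub>R midsum (a n) i) \<le> R"
    and yR: "\<And>i. i < Suc n \<Longrightarrow> norm (d n + h n *\<^sub>R midsum (b n) i) \<le> R" for n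
    unfolding Q_def by blast+
  \<comment> \<open>The minimum makes the step functions take their last value also at the endpoint \<open>T\<close>.\<close>
  define x where "x n i = c n + h n *\<^sub>R midsum (a n) (min i n)" for n i
  define y where "y n i = d n + h n *\<^sub>R midsum (b n) (min i n)" for n i
  define xs where "xs n t = x n (cell_of (h n) t)" for n t
  define ys where "ys n t = y n (cell_of (h n) t)" for n t
  have xsR: "norm (xs n t) \<le> R" and ysR: "norm (ys n t) \<le> R" for n t
    using xR yR by (auto simp: xs_def ys_def x_def y_def)
  define A where "A n s = conj_arg \<Phi> (ys n s)" for n s
  define f where "f n s = gradient (V s) (xs n s) + (\<epsilon> n * \<Lambda>\<^sup>2) *\<^sub>R gradient \<Phi> (\<Lambda>\<^sup>2 *\<^sub>R xs n s)" for n s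
  define q where "q n t = c n + integral {0..t} (A n)" for n t
  define p where "p n t = d n - integral {0..t} (f n)" for n t
  obtain Ma where Ma: "Ma > 0" "\<And>v. norm v \<le> R \<Longrightarrow> norm (conj_arg \<Phi> v) \<le> Ma"
    using conj_arg_bounded[where M = R] by metis
  obtain m0 where m0: "m0 integrable_on {0..T}" "\<And>t. 0 \<le> m0 t"
    "\<And>t x. norm x \<le> R \<Longrightarrow> norm (gradient (V t) x) \<le> m0 t"
    using grad_dominated[where R = R] by metis
  obtain B where B: "B \<ge> 0" "\<And>x. norm x \<le> \<Lambda>\<^sup>2 * R \<Longrightarrow> norm (gradient \<Phi> x) \<le> B"
    using gradient_bounded[where M = "\<Lambda>\<^sup>2 * R"] by metis
  have gradB: "norm (gradient \<Phi> (\<Lambda>\<^sup>2 *\<^sub>R xs n s)) \<le> B" for n s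
    using xsR[of n s] by (intro B(2)) (simp add: mult_left_mono)
  \<comment> \<open>A majorant common to all \<open>n\<close>: it gives equicontinuity of the
    momenta and dominates the forces in the limit.\<close>
  define m where "m s = m0 s + \<epsilon>0 * \<Lambda>\<^sup>2 * B" for s
  have m: "m integrable_on {0..T}" "\<And>t. 0 \<le> m t"
    using m0 eps0 B(1) by (auto simp: m_def[abs_def] intro!: integrable_add integrable_const_ivl)
  have A_bound: "norm (A n s) \<le> Ma" for n s
    unfolding A_def by (rule Ma(2)[OF ysR])
  have f_bound: "norm (f n s) \<le> m s" for n s
  proof -
    have "norm (f n s) \<le> norm (gradient (V s) (xs n s)) + \<epsilon> n * \<Lambda>\<^sup>2 * norm (gradient \<Phi> (\<Lambda>\<^sup>2 *\<^sub>R xs n s))"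
      unfolding f_def using eps(1)[of n] by (intro norm_triangle_le) simp
    also have "\<dots> \<le> m0 s + \<epsilon>0 * \<Lambda>\<^sup>2 * B"
      using eps eps0 gradB by (intro add_mono m0(3)[OF xsR] mult_mono) (auto intro: less_imp_le)
    finally show ?thesis by (simp add: m_def)
  qed
  have A_int: "A n integrable_on {0..T}" for n
    using absolutely_integrable_step[OF h(1)[of n], where v = "\<lambda>i. conj_arg \<Phi> (y n i)" and n = "Suc n"]
    unfolding h(2) A_def[abs_def] ys_def by (simp add: absolutely_integrable_on_def)
  have f_cells: "(f n has_integral - (h n *\<^sub>R (\<Sum>i<k. b n i))) {0..h n * real k}" if "k \<le> Suc n" for n k
  proof -
    let ?G = "\<lambda>i s. gradient (V s) (x n i) + (\<epsilon> n * \<Lambda>\<^sup>2) *\<^sub>R gradient \<Phi> (\<Lambda>\<^sup>2 *\<^sub>R x n i)"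
    have "(?G i has_integral - (h n *\<^sub>R b n i)) {h n * real i..h n * real (Suc i)}" if "i < k" for i
    proof -
      have i: "i < Suc n" using that \<open>k \<le> Suc n\<close> by simp
      then have "x n i = c n + h n *\<^sub>R midsum (a n) i" by (simp add: x_def)
      then have "cell_grad (Suc n) (\<epsilon> n) i (x n i) = - b n i"
        using bi[OF i] by simp
      then show ?thesis
        using cell_grad_has_integral[OF i, of "x n i" "\<epsilon> n"] by (simp add: h_def)
    qed
    from has_integral_cells[OF h(1) this] show ?thesis
      by (simp add: f_def[abs_def] xs_def scaleR_sum_right sum_negf)
  qed
  have f_int: "f n integrable_on {0..T}" for n
    using f_cells[of "Suc n" n] unfolding h(2) by (auto simp: integrable_on_def)
  have locate: "\<exists>i\<le>n. t \<in> {h n * real i..h n * real (Suc i)} \<and> xs n t = x n i \<and> ys n t = y n i"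
    if "t \<in> {0..T}" for n t
  proof (cases "t = T")
    case True
    have "cell_of (h n) T = Suc n"
      using h[of n] by (intro cell_of_eq) (auto simp: algebra_simps)
    then have "xs n t = x n n" "ys n t = y n n"
      using True by (simp_all add: xs_def ys_def x_def y_def)
    then show ?thesis
      using True h[of n] by (intro exI[of _ n]) (auto simp: algebra_simps)
  next
    case False
    then have "t \<in> {0..<h n * real (Suc n)}"
      unfolding h(2) using that by simp
    from cell_of_less[OF h(1) this] show ?thesis
      by (intro exI[of _ "cell_of (h n) t"]) (auto simp: xs_def ys_def)
  qed
  have sub: "g integrable_on {s..t}" if "g integrable_on {0..T}" "0 \<le> s" "t \<le> T"
    for g :: "real \<Rightarrow> 'b::euclidean_space" and s t
    by (rule integrable_on_subinterval[OF that(1)]) (use that in auto)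
  \<comment> \<open>\<open>q n\<close> is affine in the cell, and \<open>xs n t\<close> is its value
    at the midpoint.\<close>
  have q_xs: "norm (q n t - xs n t) \<le> h n * Ma" if t: "t \<in> {0..T}" for n t
  proof -
    obtain i where i: "i \<le> n" "t \<in> {h n * real i..h n * real (Suc i)}" "xs n t = x n i"
      using locate[OF t] by blast
    have v: "conj_arg \<Phi> (y n j) = a n j" if "j \<le> n" for j
      using ai[of j n] that by (simp add: y_def)
    have "integral {0..t} (A n) = h n *\<^sub>R (\<Sum>j<i. conj_arg \<Phi> (y n j)) + (t - h n * real i) *\<^sub>R conj_arg \<Phi> (y n i)"
      using integral_step[OF h(1) i(2), of "\<lambda>i. conj_arg \<Phi> (y n i)"] by (simp add: A_def[abs_def] ys_def)
    also have "\<dots> = h n *\<^sub>R (\<Sum>j<i. a n j) + (t - h n * real i) *\<^sub>R a n i"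
      using v i(1) by simp
    finally have "q n t - xs n t = (t - h n * real i - h n / 2) *\<^sub>R a n i"
      using i(1) by (simp add: q_def i(3) x_def midsum_def algebra_simps)
    moreover have "\<bar>t - h n * real i - h n / 2\<bar> \<le> h n"
      using i(2) h(1)[of n] by (simp add: algebra_simps abs_le_iff)
    moreover have "norm (a n i) \<le> Ma"
      using v[OF i(1)] i(1) yR[of i n] by (metis Ma(2) le_imp_less_Suc min.absorb1 y_def)
    ultimately show ?thesis
      by (simp add: mult_mono)
  qed
  \<comment> \<open>The force varies within a cell, so the gap is half of its integral over the cell
    minus its integral up to \<open>t\<close>; both are small with the mesh.\<close>
  have p_ys: "norm (p n t - ys n t) \<le> 2 * e"
    if t: "t \<in> {0..T}" and small: "\<And>s t. 0 \<le> s \<Longrightarrow> s \<le> t \<Longrightarrow> t \<le> T \<Longrightarrow> t - s \<le> h n \<Longrightarrow> integral {s..t} m < e" for n t e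
  proof -
    obtain i where i: "i \<le> n" "t \<in> {h n * real i..h n * real (Suc i)}" "ys n t = y n i"
      using locate[OF t] by blast
    let ?s = "h n * real i" and ?e = "h n * real (Suc i)"
    have s: "0 \<le> ?s" "?s \<le> t" "t \<le> ?e" "t \<le> T" "?e \<le> T" "?e - ?s = h n"
    proof -
      have "?e \<le> h n * real (Suc n)"
        using i(1) h(1)[of n] by (intro mult_left_mono) auto
      then show "?e \<le> T" using h(2) by simp
    qed (use i h(1)[of n] t in \<open>auto simp: algebra_simps\<close>)
    have norm_int: "norm (integral {u..v} (f n)) < e" if "0 \<le> u" "u \<le> v" "v \<le> T" "v - u \<le> h n" for u v
    proof -
      have "norm (integral {u..v} (f n)) \<le> integral {u..v} m"
        using that by (intro integral_norm_bound_integral sub[OF f_int] sub[OF m(1)] f_bound) auto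
      then show ?thesis using small[of u v] that by simp
    qed
    have "integral {0..t} (f n) - integral {0..?s} (f n) = integral {?s..t} (f n)"
      using s by (intro integral_diff_Icc[OF f_int]) auto
    moreover have i1: "integral {0..?s} (f n) = - (h n *\<^sub>R (\<Sum>j<i. b n j))"
      using i(1) by (intro integral_unique f_cells) simp
    moreover have "integral {?s..?e} (f n) = - (h n *\<^sub>R b n i)"
    proof -
      have "integral {?s..?e} (f n) = integral {0..?e} (f n) - integral {0..?s} (f n)"
        using s by (intro integral_diff_Icc[OF f_int, symmetric]) auto
      moreover have "integral {0..?e} (f n) = - (h n *\<^sub>R (\<Sum>j<Suc i. b n j))"
        using i(1) by (intro integral_unique f_cells) simp
      ultimately show ?thesis using i1 by (simp add: algebra_simps)
    qed
    ultimately have "p n t - ys n t = (1/2) *\<^sub>R integral {?s..?e} (f n) - integral {?s..t} (f n)"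
      using i(1) by (simp add: p_def i(3) y_def midsum_def algebra_simps)
    also have "norm \<dots> \<le> norm ((1/2) *\<^sub>R integral {?s..?e} (f n)) + norm (integral {?s..t} (f n))"
      by (rule norm_triangle_ineq4)
    also have "\<dots> \<le> 2 * e"
    proof -
      have "?s \<le> ?e" "?e - ?s \<le> h n" "t - ?s \<le> h n"
        using s by linarith+
      then have "norm (integral {?s..?e} (f n)) < e" "norm (integral {?s..t} (f n)) < e"
        using s by (blast intro: norm_int)+
      moreover have "norm ((1/2) *\<^sub>R integral {?s..?e} (f n)) \<le> norm (integral {?s..?e} (f n))"
        by (simp only: norm_scaleR) simp
      ultimately show ?thesis by linarith
    qed
    finally show ?thesis .
  qed
  \<comment> \<open>Bounded momenta give bounded velocities, so the positions share a Lipschitz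
    constant.\<close>
  have q_diff: "norm (q n t - q n s) \<le> Ma * (t - s)" if "0 \<le> s" "s \<le> t" "t \<le> T" for n s t
  proof -
    have "q n t - q n s = integral {s..t} (A n)"
      using integral_diff_Icc[OF A_int that] by (simp add: q_def)
    also have "norm \<dots> \<le> integral {s..t} (\<lambda>_. Ma)"
      using that by (intro integral_norm_bound_integral sub[OF A_int] integrable_const_ivl A_bound) auto
    finally show ?thesis using that by (simp add: mult.commute)
  qed
  have p_diff: "norm (p n t - p n s) \<le> integral {s..t} m" if "0 \<le> s" "s \<le> t" "t \<le> T" for n s t
  proof -
    have "p n s - p n t = integral {s..t} (f n)"
      using integral_diff_Icc[OF f_int that] by (simp add: p_def algebra_simps)
    moreover have "norm (integral {s..t} (f n)) \<le> integral {s..t} m"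
      using that by (intro integral_norm_bound_integral sub[OF f_int] sub[OF m(1)] f_bound) auto
    ultimately show ?thesis by (metis norm_minus_commute)
  qed
  have q0: "q n 0 = c n" "p n 0 = d n" for n
    by (simp_all add: q_def p_def)
  have qT: "q n T = q n 0" "p n T = p n 0" for n
  proof -
    have "integral {0..T} (A n) = h n *\<^sub>R (\<Sum>i<Suc n. conj_arg \<Phi> (y n i))"
      using has_integral_step[OF h(1)[of n], where v = "\<lambda>i. conj_arg \<Phi> (y n i)" and n = "Suc n"]
      unfolding h(2) A_def[abs_def] ys_def by (rule integral_unique)
    also have "(\<Sum>i<Suc n. conj_arg \<Phi> (y n i)) = (\<Sum>i<Suc n. a n i)"
      using ai by (intro sum.cong refl) (auto simp: y_def)
    finally show "q n T = q n 0" using sum0(1) by (simp add: q_def)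
    have "integral {0..T} (f n) = 0"
      using f_cells[of "Suc n" n] sum0(2)[of n] unfolding h(2) by (simp add: integral_unique)
    then show "p n T = p n 0" by (simp add: p_def)
  qed
  \<comment> \<open>Applied to the pairs, so that one subsequence serves positions and
    momenta.\<close>
  obtain z k where z: "continuous_on {0..T} z" and k: "strict_mono (k :: nat \<Rightarrow> nat)"
    and lim: "\<And>e. 0 < e \<Longrightarrow> \<exists>N. \<forall>n t. N \<le> n \<and> t \<in> {0..T} \<longrightarrow> norm ((q (k n) t, p (k n) t) - z t) < e"
  proof (rule Arzela_Ascoli[of "{0..T}" "\<lambda>n t. (q n t, p n t)" "R + Ma * T + (R + integral {0..T} m)"])
    fix n t assume t: "t \<in> {0..T}"
    have "norm (q n t) \<le> R + Ma * T"
    proof -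
      have "Ma * t \<le> Ma * T" using t Ma(1) by (intro mult_left_mono) auto
      then show ?thesis
        using q_diff[of 0 t n] t norm_triangle_sub[of "q n t" "q n 0"] cd(1)[of n] q0 by simp
    qed
    moreover have "norm (p n t) \<le> R + integral {0..T} m"
    proof -
      have "integral {0..t} m \<le> integral {0..T} m"
        using t m by (intro integral_subset_le sub[OF m(1)]) auto
      then show ?thesis
        using p_diff[of 0 t n] t norm_triangle_sub[of "p n t" "p n 0"] cd(2)[of n] q0 by simp
    qed
    ultimately show "norm (q n t, p n t) \<le> R + Ma * T + (R + integral {0..T} m)"
      using norm_Pair_le[of "q n t" "p n t"] by linarith
  next
    fix s e :: real assume s: "s \<in> {0..T}" and e: "0 < e"
    obtain \<delta> where \<delta>: "\<delta> > 0"
      "\<And>s t. 0 \<le> s \<Longrightarrow> s \<le> t \<Longrightarrow> t \<le> T \<Longrightarrow> t - s < \<delta> \<Longrightarrow> integral {s..t} m < e / 2"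
      using indefinite_integral_small[OF m, of "e / 2"] e by auto
    have ordered: "norm ((q n v, p n v) - (q n u, p n u)) < e"
      if "0 \<le> u" "u \<le> v" "v \<le> T" "v - u < min \<delta> (e / (2 * Ma))" for n u v
    proof -
      have "Ma * (v - u) < e / 2"
        using that Ma(1) by (simp add: field_simps)
      then have "norm (q n v - q n u) < e / 2"
        using q_diff[of u v n] that by linarith
      moreover have "norm (p n v - p n u) < e / 2"
        using p_diff[of u v n] \<delta>(2)[of u v] that by simp
      ultimately show ?thesis
        using norm_Pair_le[of "q n v - q n u" "p n v - p n u"] by simp
    qed
    show "\<exists>d>0. \<forall>n t. t \<in> {0..T} \<and> norm (s - t) < d \<longrightarrow> norm ((q n s, p n s) - (q n t, p n t)) < e"
    proof (intro exI[of _ "min \<delta> (e / (2 * Ma))"] conjI allI impI)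
      fix n t assume t: "t \<in> {0..T} \<and> norm (s - t) < min \<delta> (e / (2 * Ma))"
      show "norm ((q n s, p n s) - (q n t, p n t)) < e"
      proof (cases "t \<le> s")
        case True
        then show ?thesis using ordered[of t s n] s t by auto
      next
        case False
        then show ?thesis
          using ordered[of s t n] s t by (subst norm_minus_commute) auto
      qed
    qed (use \<delta> e Ma in auto)
  qed (auto intro: that)
  define q' where "q' t = fst (z t)" for t
  define p' where "p' t = snd (z t)" for t
  have lim_z: "(\<lambda>n. (q (k n) t, p (k n) t)) \<longlonglongrightarrow> z t" if "t \<in> {0..T}" for t
    unfolding LIMSEQ_iff using lim that by blast
  have lim_q: "(\<lambda>n. q (k n) t) \<longlonglongrightarrow> q' t" and lim_p: "(\<lambda>n. p (k n) t) \<longlonglongrightarrow> p' t" if "t \<in> {0..T}" for t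
    using tendsto_fst[OF lim_z[OF that]] tendsto_snd[OF lim_z[OF that]] by (simp_all add: q'_def p'_def)
  have h_lim: "h \<longlonglongrightarrow> 0"
    unfolding h_def using tendsto_mult_right[OF LIMSEQ_inverse_real_of_nat, of T] by (simp add: inverse_eq_divide)
  have eps_lim: "\<epsilon> \<longlonglongrightarrow> 0"
    unfolding \<epsilon>_def using tendsto_mult_right[OF LIMSEQ_inverse_real_of_nat, of \<epsilon>0] by (simp add: inverse_eq_divide)
  have lim_xs: "(\<lambda>n. xs (k n) t) \<longlonglongrightarrow> q' t" if t: "t \<in> {0..T}" for t
  proof -
    have "(\<lambda>n. h n * Ma) \<longlonglongrightarrow> 0"
      using tendsto_mult_left_zero[OF h_lim] .
    then have "(\<lambda>n. q n t - xs n t) \<longlonglongrightarrow> 0"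
      by (rule Lim_null_comparison[rotated]) (use q_xs[OF t] in simp)
    then have "(\<lambda>n. q (k n) t - xs (k n) t) \<longlonglongrightarrow> 0"
      using LIMSEQ_subseq_LIMSEQ[OF _ k] by (auto simp: comp_def)
    from tendsto_diff[OF lim_q[OF t] this] show ?thesis by simp
  qed
  have lim_ys: "(\<lambda>n. ys (k n) t) \<longlonglongrightarrow> p' t" if t: "t \<in> {0..T}" for t
  proof -
    have "(\<lambda>n. p n t - ys n t) \<longlonglongrightarrow> 0"
    proof (rule LIMSEQ_I)
      fix r :: real assume r: "0 < r"
      obtain \<delta> where \<delta>: "\<delta> > 0"
        "\<And>s t. 0 \<le> s \<Longrightarrow> s \<le> t \<Longrightarrow> t \<le> T \<Longrightarrow> t - s < \<delta> \<Longrightarrow> integral {s..t} m < r / 4"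
        using indefinite_integral_small[OF m, of "r / 4"] r by auto
      obtain N where N: "\<And>n. n \<ge> N \<Longrightarrow> h n < \<delta>"
        using LIMSEQ_D[OF h_lim \<delta>(1)] h(1) by (auto simp: abs_less_iff)
      have "norm (p n t - ys n t - 0) < r" if "n \<ge> N" for n
      proof -
        have "norm (p n t - ys n t) \<le> 2 * (r / 4)"
          using \<delta>(2) N[OF that] by (intro p_ys[OF t]) auto
        then show ?thesis using r by simp
      qed
      then show "\<exists>N. \<forall>n\<ge>N. norm (p n t - ys n t - 0) < r" by blast
    qed
    then have "(\<lambda>n. p (k n) t - ys (k n) t) \<longlonglongrightarrow> 0"
      using LIMSEQ_subseq_LIMSEQ[OF _ k] by (auto simp: comp_def)
    from tendsto_diff[OF lim_p[OF t] this] show ?thesis by simp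
  qed
  have lim_A: "(\<lambda>n. A (k n) t) \<longlonglongrightarrow> conj_arg \<Phi> (p' t)" if "t \<in> {0..T}" for t
    unfolding A_def
    using continuous_on_tendsto_compose[OF continuous_conj_arg lim_ys[OF that]] by simp
  \<comment> \<open>The regularising force vanishes: its gradient factor stays below
    \<open>B\<close> while \<open>\<epsilon> n\<close> tends to \<open>0\<close>.\<close>
  have lim_f: "(\<lambda>n. f (k n) t) \<longlonglongrightarrow> gradient (V t) (q' t)" if t: "t \<in> {0..T}" for t
  proof -
    have "(\<lambda>n. \<epsilon> n * \<Lambda>\<^sup>2 * B) \<longlonglongrightarrow> 0"
      using tendsto_mult_left_zero[OF eps_lim, of "\<Lambda>\<^sup>2 * B"] by (simp add: mult.assoc)
    then have "(\<lambda>n. (\<epsilon> n * \<Lambda>\<^sup>2) *\<^sub>R gradient \<Phi> (\<Lambda>\<^sup>2 *\<^sub>R xs n t)) \<longlonglongrightarrow> 0"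
    proof (rule Lim_null_comparison[rotated], intro always_eventually allI)
      fix n
      show "norm ((\<epsilon> n * \<Lambda>\<^sup>2) *\<^sub>R gradient \<Phi> (\<Lambda>\<^sup>2 *\<^sub>R xs n t)) \<le> \<epsilon> n * \<Lambda>\<^sup>2 * B"
        using gradB[of n t] eps(1)[of n] by (simp add: mult_left_mono)
    qed
    then have "(\<lambda>n. (\<epsilon> (k n) * \<Lambda>\<^sup>2) *\<^sub>R gradient \<Phi> (\<Lambda>\<^sup>2 *\<^sub>R xs (k n) t)) \<longlonglongrightarrow> 0"
      using LIMSEQ_subseq_LIMSEQ[OF _ k] by (auto simp: comp_def)
    moreover have "(\<lambda>n. gradient (V t) (xs (k n) t)) \<longlonglongrightarrow> gradient (V t) (q' t)"
      using continuous_on_tendsto_compose[OF V_grad_cont lim_xs[OF t]] by simp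
    ultimately show ?thesis
      unfolding f_def using tendsto_add by fastforce
  qed
  have contq: "continuous_on {0..T} q'" and contp: "continuous_on {0..T} p'"
    unfolding q'_def p'_def by (intro continuous_intros z)+
  have int_q: "(\<lambda>n. integral {0..t} (A (k n))) \<longlonglongrightarrow> integral {0..t} (\<lambda>s. conj_arg \<Phi> (p' s))" if "t \<in> {0..T}" for t
    by (rule dominated_convergence(2)[where h = "\<lambda>_. Ma"])
      (use that A_bound lim_A in \<open>auto intro: sub[OF A_int] integrable_const_ivl\<close>)
  have int_p: "(\<lambda>s. gradient (V s) (q' s)) integrable_on {0..t}"
    "(\<lambda>n. integral {0..t} (f (k n))) \<longlonglongrightarrow> integral {0..t} (\<lambda>s. gradient (V s) (q' s))" if "t \<in> {0..T}" for t
    by (rule dominated_convergence[where h = m and f = "\<lambda>n. f (k n)"];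
        use that f_bound lim_f in \<open>auto intro: sub[OF f_int] sub[OF m(1)]\<close>)+
  have T0: "0 \<in> {0..T}" "T \<in> {0..T}" using T by auto
  show thesis
  proof (rule that[OF contq contp])
    have "bounded (q' ` {0..T})"
      by (intro compact_imp_bounded compact_continuous_image contq) simp
    then obtain R' where R': "\<And>t. t \<in> {0..T} \<Longrightarrow> norm (q' t) \<le> R'"
      unfolding bounded_iff by blast
    obtain m' where m': "m' integrable_on {0..T}"
      "\<And>t x. norm x \<le> R' \<Longrightarrow> norm (gradient (V t) x) \<le> m' t"
      using grad_dominated[where R = R'] by metis
    show "(\<lambda>s. gradient (V s) (q' s)) absolutely_integrable_on {0..T}"
      using R' m' by (intro absolutely_integrable_integrable_bound[where g = m'] int_p[OF T0(2)]) auto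
    show "q' t = q' 0 + integral {0..t} (\<lambda>s. conj_arg \<Phi> (p' s))" if t: "t \<in> {0..T}" for t
    proof (rule LIMSEQ_unique[OF lim_q[OF t]])
      show "(\<lambda>n. q (k n) t) \<longlonglongrightarrow> q' 0 + integral {0..t} (\<lambda>s. conj_arg \<Phi> (p' s))"
        using tendsto_add[OF lim_q[OF T0(1)] int_q[OF t]] by (simp add: q_def)
    qed
    show "p' t = p' 0 - integral {0..t} (\<lambda>s. gradient (V s) (q' s))" if t: "t \<in> {0..T}" for t
    proof (rule LIMSEQ_unique[OF lim_p[OF t]])
      show "(\<lambda>n. p (k n) t) \<longlonglongrightarrow> p' 0 - integral {0..t} (\<lambda>s. gradient (V s) (q' s))"
        using tendsto_diff[OF lim_p[OF T0(1)] int_p(2)[OF t]] by (simp add: p_def)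
    qed
    show "q' T = q' 0"
      using LIMSEQ_unique[OF lim_q[OF T0(2)]] lim_q[OF T0(1)] by (simp add: qT)
    show "p' T = p' 0"
      using LIMSEQ_unique[OF lim_p[OF T0(2)]] lim_p[OF T0(1)] by (simp add: qT)
  qed
qed

text \<open>The velocity \<open>conj_arg \<Phi> (p s)\<close> is continuous, so \<open>q\<close> is
  continuously differentiable up to the endpoints, and periodicity of \<open>p\<close> makes the two
  one-sided derivatives equal.\<close>

theorem periodic_solution_exists: "\<exists>q. periodic_solution T \<Phi> V q"
proof -
  obtain q p where cont: "continuous_on {0..T} q" "continuous_on {0..T} p"
    and Vint: "(\<lambda>s. gradient (V s) (q s)) absolutely_integrable_on {0..T}"
    and q: "\<And>t. t \<in> {0..T} \<Longrightarrow> q t = q 0 + integral {0..t} (\<lambda>s. conj_arg \<Phi> (p s))"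
    and p: "\<And>t. t \<in> {0..T} \<Longrightarrow> p t = p 0 - integral {0..t} (\<lambda>s. gradient (V s) (q s))"
    and per: "q T = q 0" "p T = p 0"
    using hamiltonian_solution by blast
  let ?a = "\<lambda>s. conj_arg \<Phi> (p s)" and ?b = "\<lambda>s. - gradient (V s) (q s)"
  \<comment> \<open>Equal to \<open>q\<close> and \<open>p\<close> on the interval; the lemmas on
    primitives need the integral formula as an identity of functions on the whole line.\<close>
  define q' where "q' t = q 0 + integral {0..t} ?a" for t
  define p' where "p' t = p 0 + integral {0..t} ?b" for t
  have q': "q' t = q t" and p': "p' t = p t" if "t \<in> {0..T}" for t
    using q[OF that] p[OF that] by (simp_all add: q'_def p'_def)
  have conta: "continuous_on {0..T} ?a"
    by (rule continuous_on_compose2[OF continuous_conj_arg cont(2)]) simp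
  then have aint: "?a absolutely_integrable_on {0..T}"
    by (rule absolutely_integrable_continuous_real)
  have bint: "?b absolutely_integrable_on {0..T}"
    using Vint by (auto simp: absolutely_integrable_on_def intro: integrable_neg)
  have "periodic_solution T \<Phi> V q'"
    unfolding periodic_solution_def
  proof (intro conjI exI[of _ p'] exI[of _ "?a 0"])
    show "abs_continuous_on 0 T q'"
      unfolding q'_def[abs_def] by (rule indefinite_integral_abs_continuous[OF aint])
    show "abs_continuous_on 0 T p'"
      unfolding p'_def[abs_def] by (rule indefinite_integral_abs_continuous[OF bint])
    have "AE t in lebesgue_on {0..T}. dot T q' t = ?a t"
      unfolding q'_def[abs_def]
      using aint T by (intro dot_indefinite_integral_AE) (simp_all add: absolutely_integrable_on_def)
    then show "AE t in lebesgue_on {0..T}. gradient \<Phi> (dot T q' t) = p' t"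
      by (rule AE_mp) (rule AE_I2, simp add: gradient_conj_arg p')
    have "AE t in lebesgue_on {0..T}. dot T p' t = ?b t"
      unfolding p'_def[abs_def]
      using bint T by (intro dot_indefinite_integral_AE) (simp_all add: absolutely_integrable_on_def)
    then show "AE t in lebesgue_on {0..T}. dot T p' t + gradient (V t) (q' t) = 0"
      by (rule AE_mp) (rule AE_I2, simp add: q')
    show "q' 0 = q' T"
      using q'[of 0] q'[of T] per T by simp
    have D: "(q' has_vector_derivative ?a t) (at t within {0..T})" if "t \<in> {0..T}" for t
      unfolding q'_def[abs_def]
      using has_vector_derivative_add[OF has_vector_derivative_const[of "q 0"]
          integral_has_vector_derivative[OF conta that]] by simp
    show "(q' has_vector_derivative ?a 0) (at 0 within {0..T})"
      "(q' has_vector_derivative ?a 0) (at T within {0..T})"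
      using D[of 0] D[of T] per T by simp_all
  qed
  then show ?thesis by blast
qed

end

subsection \<open>From almost every time to every time\<close>

text \<open>The exceptional null set depends on \<open>q\<close>; countably many \<open>q\<close> in
  a dense set share one, and continuity extends the inequality to all \<open>q\<close>.\<close>

lemma AE_uniform_bounds:
  fixes V W :: "'b \<Rightarrow> 'a::euclidean_space \<Rightarrow> real"
  assumes le: "\<And>q. AE t in M. V t q \<le> W t q"
    and cont: "AE t in M. continuous_on UNIV (V t)" "AE t in M. continuous_on UNIV (W t)"
  shows "AE t in M. \<forall>q. V t q \<le> W t q"
proof -
  obtain D :: "'a set" where D: "countable D" "\<And>X. open X \<Longrightarrow> X \<noteq> {} \<Longrightarrow> \<exists>d\<in>D. d \<in> X"
    using countable_dense_setE by blast
  have "AE t in M. \<forall>q\<in>D. V t q \<le> W t q"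
    using le by (simp add: AE_ball_countable[OF D(1)])
  then show ?thesis
    using cont
  proof eventually_elim
    fix t
    assume *: "\<forall>q\<in>D. V t q \<le> W t q" "continuous_on UNIV (V t)" "continuous_on UNIV (W t)"
    have "open {q. W t q < V t q}"
      by (intro open_Collect_less *)
    then have "{q. W t q < V t q} = {}"
      using D(2) *(1) by (metis (mono_tags, lifting) mem_Collect_eq not_le)
    then show "\<forall>q. V t q \<le> W t q"
      by (auto simp: not_less)
  qed
qed

lemma integrable_imp_absolutely_integrable:
  fixes f :: "'a::euclidean_space \<Rightarrow> 'b::euclidean_space"
  assumes "integrable (lebesgue_on S) f" "S \<in> sets lebesgue"
  shows "f absolutely_integrable_on S"
  using assms by (simp add: integrable_restrict_space set_integrable_def)

text \<open>Superlinearity bounds the norm by a multiple of \<open>\<Phi> (r *\<^sub>R l t)\<close>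
  plus a constant, and the interval has finite length.\<close>

lemma (in kinetic) Orlicz_integrable:
  assumes "l \<in> Orlicz \<Phi> T"
  shows "integrable (lebesgue_on {0..T}) l"
proof -
  obtain r where r: "r > 0" "integrable (lebesgue_on {0..T}) (\<lambda>t. \<Phi> (r *\<^sub>R l t))"
    and l: "l \<in> borel_measurable (lebesgue_on {0..T})"
    using assms unfolding Orlicz_def by blast
  obtain K where K: "\<And>u. 1 * norm u \<le> \<Phi> u + K"
    using lower_bound[of 1] by metis
  have "integrable (lebesgue_on {0..T}) (\<lambda>t. K)"
    by (intro absolutely_integrable_imp_integrable absolutely_integrable_continuous_real) auto
  then have "integrable (lebesgue_on {0..T}) (\<lambda>t. (\<Phi> (r *\<^sub>R l t) + K) / r)"
    using r(2) by simp
  then show ?thesis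
  proof (rule measurable_bounded_by_integrable_imp_lebesgue_integrable[OF l])
    show "norm (l t) \<le> (\<Phi> (r *\<^sub>R l t) + K) / r" for t
      using K[of "r *\<^sub>R l t"] r(1) by (simp add: field_simps)
  qed simp
qed

theorem theorem6p1:
  fixes T \<Lambda> :: real
    and \<Phi> :: "real ^ 'n \<Rightarrow> real"
    and V :: "real \<Rightarrow> real ^ 'n \<Rightarrow> real"
    and l :: "real \<Rightarrow> real ^ 'n"
    and \<gamma> :: "real \<Rightarrow> real"
  assumes "T > 0"
    and "G_function \<Phi>" and "\<Phi> \<in> Gamma_set"
    and "Delta2 \<Phi>" and "Delta2 (convex_conjugate \<Phi>)"
    and "Caratheodory T V"
    and "AE t in lebesgue_on {0..T}. continuously_differentiable (V t) \<and> convex_on UNIV (V t)"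
    and "l \<in> Orlicz \<Phi> T"
    and "\<forall>q. AE t in lebesgue_on {0..T}. l t \<bullet> q \<le> V t q"
    and "\<Lambda> > 0"
    and "ereal (inverse \<Lambda>) > ereal T * max 1 (C_const (split_sum \<Phi>) T / 2)"
    and "integrable (lebesgue_on {0..T}) \<gamma>"
    and "\<forall>q. AE t in lebesgue_on {0..T}. V t q \<le> \<Phi> (\<Lambda>\<^sup>2 *\<^sub>R q) + \<gamma> t"
    and "filterlim (\<lambda>x. LINT t|lebesgue_on {0..T}. V t x) at_top at_infinity"
  shows "\<exists>q. periodic_solution T \<Phi> V q"
proof -
  let ?M = "lebesgue_on {0..T}"
  interpret kinetic \<Phi>
    using assms by (simp add: kinetic_def Gamma_fun_def kinetic_axioms_def)
  have contV: "AE t in ?M. continuous_on UNIV (V t)"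
    using assms(6) unfolding Caratheodory_def by blast
  have V_measurable: "(\<lambda>t. V t q) \<in> borel_measurable ?M" for q
    using assms(6) unfolding Caratheodory_def by blast
  have low: "AE t in ?M. \<forall>q. l t \<bullet> q \<le> V t q"
    by (rule AE_uniform_bounds[OF assms(9)[rule_format] _ contV]) (intro AE_I2 continuous_intros)
  have up: "AE t in ?M. \<forall>q. V t q \<le> \<Phi> (\<Lambda>\<^sup>2 *\<^sub>R q) + \<gamma> t"
    by (rule AE_uniform_bounds[OF assms(13)[rule_format] contV])
      (intro AE_I2 continuous_intros continuous_on_compose2[OF cont] subset_UNIV)
  define good where "good t \<longleftrightarrow> continuously_differentiable (V t) \<and> convex_on UNIV (V t) \<and>
    (\<forall>q. l t \<bullet> q \<le> V t q) \<and> (\<forall>q. V t q \<le> \<Phi> (\<Lambda>\<^sup>2 *\<^sub>R q) + \<gamma> t)" for t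
  have good: "AE t in ?M. good t"
    using assms(7) low up unfolding good_def by eventually_elim blast
  \<comment> \<open>Zero data at the exceptional times satisfy every condition, the upper bound
    because \<open>\<Phi>\<close> is nonnegative; no integral changes.\<close>
  define V' where "V' t = (if good t then V t else (\<lambda>_. 0))" for t
  define l' where "l' t = (if good t then l t else 0)" for t
  define \<gamma>' where "\<gamma>' t = (if good t then \<gamma> t else 0)" for t
  have V'_meas: "(\<lambda>t. V' t q) \<in> borel_measurable ?M" for q
    by (rule borel_measurable_lebesgue_on_AE[OF V_measurable[of q]])
      (rule eventually_mono[OF good], simp_all add: V'_def)
  have gr0: "GDERIV (\<lambda>_::real ^ 'n. 0) x :> 0" for x
    by (rule GDERIV_const)
  interpret potential \<Phi> T \<Lambda> V' l' \<gamma>'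
  proof unfold_locales
    show "T > 0" "\<Lambda> > 0" by fact+
    show "(\<lambda>t. V' t q) \<in> borel_measurable ?M" for q by (rule V'_meas)
    show "V' t differentiable (at q)" for t q
      by (auto simp: V'_def good_def continuously_differentiable_def)
    show "continuous_on UNIV (gradient (V' t))" for t
      using gradient_eqI[OF gr0]
      by (cases "good t") (auto simp: V'_def good_def continuously_differentiable_def cong: continuous_on_cong)
    show "convex_on UNIV (V' t)" for t
      by (auto simp: V'_def good_def convex_on_const)
    show "l' t \<bullet> q \<le> V' t q" for t q
      by (auto simp: V'_def l'_def good_def)
    show "V' t q \<le> \<Phi> (\<Lambda>\<^sup>2 *\<^sub>R q) + \<gamma>' t" for t q
      using nonneg by (auto simp: V'_def \<gamma>'_def good_def)
    have "l \<in> borel_measurable ?M" "integrable ?M l"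
      using Orlicz_integrable[OF assms(8)] by auto
    moreover from this(1) have "l' \<in> borel_measurable ?M"
      by (rule borel_measurable_lebesgue_on_AE)
        (rule eventually_mono[OF good], simp_all add: l'_def)
    moreover have "AE t in ?M. l t = l' t"
      by (rule eventually_mono[OF good]) (simp add: l'_def)
    ultimately have "integrable ?M l'"
      using integrable_cong_AE_imp by blast
    then show "l' absolutely_integrable_on {0..T}"
      by (rule integrable_imp_absolutely_integrable) simp
    have "\<gamma> \<in> borel_measurable ?M" using assms(12) by auto
    then have "\<gamma>' \<in> borel_measurable ?M"
      by (rule borel_measurable_lebesgue_on_AE)
        (rule eventually_mono[OF good], simp_all add: \<gamma>'_def)
    moreover have "AE t in ?M. \<gamma> t = \<gamma>' t"
      by (rule eventually_mono[OF good]) (simp add: \<gamma>'_def)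
    ultimately have "integrable ?M \<gamma>'"
      using assms(12) integrable_cong_AE_imp by blast
    then show "\<gamma>' absolutely_integrable_on {0..T}"
      by (rule integrable_imp_absolutely_integrable) simp
  qed
  have coercive: "filterlim (\<lambda>x. integral {0..T} (\<lambda>t. V' t x)) at_top at_infinity"
  proof -
    have "(LINT t|?M. V t x) = integral {0..T} (\<lambda>t. V' t x)" for x
    proof -
      have "(LINT t|?M. V t x) = (LINT t|?M. V' t x)"
        by (rule integral_cong_AE[OF V_measurable V'_meas])
          (rule eventually_mono[OF good], simp add: V'_def)
      also have "\<dots> = integral {0..T} (\<lambda>t. V' t x)"
        by (intro lebesgue_integral_eq_integral absolutely_integrable_imp_integrable V_integrable) auto
      finally show ?thesis .
    qed
    then show ?thesis using assms(14) by simp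
  qed
  let ?C = "C_const (split_sum \<Phi>) T"
  \<comment> \<open>The strict inequality in hypothesis (2) excludes infinity, the \<open>1\<close>
    in the maximum excludes minus infinity.\<close>
  obtain r where r: "max 1 (?C / 2) = ereal r"
  proof (cases "max 1 (?C / 2)")
    case PInf
    then show thesis using assms(1,11) by simp
  next
    case MInf
    moreover have "1 \<le> max 1 (?C / 2)" by (rule max.cobounded1)
    ultimately show thesis by simp
  qed (use that in blast)
  have r1: "r \<ge> 1"
    using r by (metis ereal_less_eq(3) max.cobounded1 one_ereal_def)
  have "?C / 2 \<le> ereal r"
    using r by (metis max.cobounded2)
  then have C: "?C \<le> ereal (2 * r)"
    by (cases ?C) auto
  have "T * r < inverse \<Lambda>"
    using assms(11) unfolding r by simp
  then have TrL: "\<Lambda> < inverse (T * r)"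
    using assms(1,10) r1 by (simp add: field_simps)
  \<comment> \<open>The midpoint of the interval left open by hypothesis (2); with
    \<open>K = 2 * r\<close> the coercivity margin reads \<open>T * L * r < 1\<close>.\<close>
  define L where "L = (\<Lambda> + inverse (T * r)) / 2"
  have Lb: "\<Lambda> < L" "L < inverse (T * r)"
    using TrL by (simp_all add: L_def)
  have TLr: "T * L * r < 1"
    using Lb(2) assms(1) r1 by (simp add: field_simps)
  have "T * L * 1 \<le> T * L * r"
    using r1 Lb(1) assms(1,10) by (intro mult_left_mono) auto
  then have TL: "T * L \<le> 1"
    using TLr by simp
  interpret periodic_problem \<Phi> T \<Lambda> V' l' \<gamma>' L "2 * r"
    by unfold_locales (use Lb TL TLr r1 C coercive in auto)
  obtain q where q: "periodic_solution T \<Phi> V' q"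
    using periodic_solution_exists by blast
  then obtain p where p: "abs_continuous_on 0 T p"
    "AE t in ?M. gradient \<Phi> (dot T q t) = p t" "AE t in ?M. dot T p t + gradient (V' t) (q t) = 0"
    unfolding periodic_solution_def by blast
  have "AE t in ?M. dot T p t + gradient (V t) (q t) = 0"
    using p(3) good by eventually_elim (simp add: V'_def)
  then have "periodic_solution T \<Phi> V q"
    using q p(1,2) unfolding periodic_solution_def by blast
  then show ?thesis by blast
qed

end
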